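(* Let $\kappa=\frac12-\log 2$. There is a universal constant $C>0$ such that for every integer $N\ge 1$ there exists a set $\mathcal P_N=\{p_1,\ldots,p_N\}$ of $N$ points in the unit sphere $\mathbb{S}^2$ with the following properties. For all $p\in\mathbb{S}^2$ we have $\sqrt N\,\operatorname{dist}(p,\mathcal P_N)\le C$, and moreover \[ \left|\sum_{i=1}^N\log|p-p_i|+\kappa N-\log\left(\sqrt N\,\operatorname{dist}(p,\mathcal P_N)\right)\right|\le C . \] Equivalently, for all $p\in\mathbb{S}^2$ and all $N$, \[ \frac{\prod_{i=1}^N|p-p_i|^2}{e^{-2\kappa N}\,N\,\operatorname{dist}^2(p,\mathcal P_N)} \] is bounded above and below by positive universal constants (independent of $p$ and $N$). Here, if $p=p_i$ for some $i$, the last quotient is understood as $\dfrac{\prod_{j\ne i}|p_i-p_j|^2}{e^{-2\kappa N}N}$ (and the logarithmic expression as half of its logarithm).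
   Context: $\mathbb{S}^2=\{x\in\mathbb{R}^3:|x|=1\}$, $|\cdot|$ is the Euclidean norm in $\mathbb{R}^3$, and $\operatorname{dist}(p,\mathcal P_N)=\min_i|p-p_i|$ is the Euclidean distance from $p$ to $\mathcal P_N$. *)

theory Defs
  imports "HOL-Analysis.Analysis"
begin

definition kappa :: real where
  "kappa = 1 / 2 - ln 2"

text \<open>Throughout, \<open>P\<close> is finite and nonempty, so that \<open>card P\<close> is the number \<open>N\<close> of points
  and the infimum in \<^const>\<open>infdist\<close> is the minimum over \<open>P\<close>. For \<open>p \<in> P\<close> the quotient is
  \<open>0 / 0\<close>; by convention the vanishing factor of the product and the squared distance are
  both omitted.\<close>

definition product_quotient :: "(real^3) set \<Rightarrow> real^3 \<Rightarrow> real" where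
  "product_quotient P p =
    (if p \<in> P
     then (\<Prod>q\<in>P - {p}. (norm (p - q))\<^sup>2) / (exp (- 2 * kappa * real (card P)) * real (card P))
     else (\<Prod>q\<in>P. (norm (p - q))\<^sup>2) /
          (exp (- 2 * kappa * real (card P)) * real (card P) * (infdist p P)\<^sup>2))"

text \<open>For \<open>p \<in> P\<close> the logarithmic expression has the form \<open>-\<infinity> + \<infinity>\<close> (in HOL, \<open>ln 0 = 0\<close>
  would give a spurious value); by convention it is half the logarithm of the quotient above.\<close>

definition log_expression :: "(real^3) set \<Rightarrow> real^3 \<Rightarrow> real" where
  "log_expression P p =
    (if p \<in> P
     then ln (product_quotient P p) / 2
     else (\<Sum>q\<in>P. ln (norm (p - q))) + kappa * real (card P)
          - ln (sqrt (real (card P)) * infdist p P))"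

end

theory Submission
  imports Defs
begin

text \<open>
  The points are placed on parallels. If \<open>r\<close> points are equally spaced on the parallel at height
  \<open>h\<close>, and \<open>p\<close> has height \<open>t\<close> and longitude \<open>\<alpha>\<close> relative to one of them, then the distances from
  \<open>p\<close> to these points are \<open>\<bar>a - b e\<^sup>i\<^sup>\<theta>\<bar>\<close> with \<open>a\<^sup>2 = (1 - h)(1 + t)\<close>, \<open>b\<^sup>2 = (1 - t)(1 + h)\<close>, where
  \<open>\<theta>\<close> runs through the shifts of \<open>\<alpha>\<close> by multiples of \<open>2 \<pi> / r\<close>. Hence their product is exactly
  \<open>\<bar>a\<^sup>r - b\<^sup>r e\<^sup>i\<^sup>r\<^sup>\<alpha>\<bar>\<close>. It equals \<open>max a b\<close> to the power \<open>r\<close> up to a factor whose logarithm has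
  the order of \<open>(min a b / max a b)\<^sup>r\<close>, unless \<open>p\<close> lies close to the parallel.

  Write \<open>N = K (K + 1) + m\<close> with \<open>K \<le> m \<le> 3 K + 2\<close>. The \<open>j\<close>-th parallel, counted from either pole,
  carries \<open>j\<close> points for \<open>1 \<le> j \<le> K\<close>, and the equator carries \<open>m\<close> points. Each parallel represents a
  band whose area is its share of the sphere: the band of the \<open>j\<close>-th northern parallel consists of the
  heights \<open>1 - u\<close> with \<open>j (j - 1) \<le> N u \<le> j (j + 1)\<close>. Divided among its points, every band splits
  into cells of diameter \<open>O(1 / sqrt N)\<close>. The parallel is placed at \<open>N u = j\<^sup>2 - 1/6\<close> rather than at the
  midpoint \<open>j\<^sup>2\<close>: with the midpoint, replacing the average of \<open>ln u\<close> over the band by its value on the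
  parallel would cost an error of order \<open>1 / j\<close> in the sum of the logarithms, which adds up to
  \<open>ln N\<close>; the shift by \<open>1/6\<close> cancels this term and leaves a summable error of order \<open>1 / j\<^sup>3\<close>
  (\<open>sum_ln_north\<close>). The logarithm of the distance to the opposite pole varies slowly and needs no such
  care (\<open>sum_ln_far\<close>). Adding up, the principal terms \<open>r ln (max a b)\<close> of all parallels give
  \<open>- \<kappa> N + O(1)\<close> (\<open>ring_energy\<close>, \<open>sum_potential\<close>).

  Now let \<open>p\<close> be in the northern hemisphere (the configuration is symmetric), in the band of the
  \<^emph>\<open>active\<close> parallel. For all other parallels the numbers \<open>(min a b / max a b)\<^sup>r\<close> are bounded away from 1
  and have a bounded sum, so that the error terms contribute \<open>O(1)\<close> altogether (\<open>inactive_ring\<close>,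
  \<open>sum_decay\<close>). On the active parallel \<open>a\<^sup>r\<close> and \<open>b\<^sup>r\<close> are comparable, except in the topmost band,
  where \<open>r \<le> 2\<close>. The product over all its points except the nearest one \<open>q\<close> is a sum of \<open>r\<close> terms of
  size \<open>a\<^sup>r\<^sup>-\<^sup>1\<close> that do not cancel (\<open>punctured_ring_lower\<close>, \<open>punctured_ring_lower_small\<close>). Since \<open>r / a\<close>
  has the order of \<open>sqrt N\<close>, the product of the distances from \<open>p\<close> to all points but \<open>q\<close> is \<open>e\<^sup>-\<^sup>\<kappa>\<^sup>N sqrt N\<close> up to a constant factor
  (\<open>nearest_point_estimate\<close>). This is the claim, as the convention for \<open>p \<in> P\<close> amounts to omitting
  the factor of a nearest point of the whole set (\<open>product_quotient_nearest\<close>), and \<open>q\<close> realises the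
  distance to that set up to a constant.

  The equivalence of the two formulations holds for any family of configurations because the
  logarithmic expression is half the logarithm of the quotient (\<open>log_expression_eq\<close>).
\<close>

section \<open>Products over roots of unity\<close>

text \<open>For \<open>y = 1\<close> both sides are monic polynomials in \<open>x\<close> of degree \<open>r - 1\<close> that vanish at the
  nontrivial roots of unity; the general case follows by homogeneity. Unlike the quotient
  \<open>(x\<^sup>r - y\<^sup>r) / (x - y)\<close>, this form also covers \<open>x = y\<close>.\<close>

lemma prod_nontrivial_roots_of_unity:
  fixes x y :: complex
  assumes "r \<ge> 1"
  shows "(\<Prod>k\<in>{1..<r}. x - y * cis (2 * pi * real k / real r)) = (\<Sum>k<r. x ^ (r - 1 - k) * y ^ k)"
proof (cases "y = 0")
  case True
  have "(\<Sum>k<r. x ^ (r - 1 - k) * y ^ k) = (\<Sum>k\<in>{0}. x ^ (r - 1 - k) * y ^ k)"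
    using assms by (intro sum.mono_neutral_right) (auto simp: True)
  then show ?thesis using True by simp
next
  case False
  define w where "w k = cis (2 * pi * real k / real r)" for k
  define p where "p = (\<Prod>k\<in>{1..<r}. [:- w k, 1:])"
  define q where "q = (\<Sum>k<r. monom (1::complex) k)"
  have winj: "inj_on w {..<r}"
    using Complex.bij_betw_roots_unity[of r] assms unfolding bij_betw_def w_def by (simp add: lessThan_def)
  have wr: "w k ^ r = 1" for k
  proof -
    have "real r * (2 * pi * real k / real r) = 2 * pi * real k" using assms by simp
    then show ?thesis using cis_multiple_2pi[of "real k"] by (simp only: w_def Complex.DeMoivre Ints_of_nat)
  qed
  have pq: "p = q"
  proof (rule poly_eqI_degree_lead_coeff[where A = "w ` {1..<r}"])
    have cp: "coeff q i = (if i < r then 1 else 0)" for i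
      by (simp add: q_def coeff_sum if_distrib cong: if_cong)
    show "coeff p (r - 1) = coeff q (r - 1)"
    proof -
      have d: "degree p = r - 1" unfolding p_def by (subst degree_prod_sum_eq) auto
      have "lead_coeff p = 1" unfolding p_def by (simp add: lead_coeff_prod)
      then show ?thesis using assms d by (simp add: cp)
    qed
    show "degree p \<le> r - 1" unfolding p_def by (subst degree_prod_sum_eq) auto
    show "degree q \<le> r - 1" by (rule degree_le) (auto simp: cp)
    have "inj_on w {1..<r}" using winj by (rule inj_on_subset) auto
    then show "r - 1 \<le> card (w ` {1..<r})" by (simp add: card_image)
    fix z assume "z \<in> w ` {1..<r}"
    then obtain k where k: "1 \<le> k" "k < r" "z = w k" by auto
    have "w k \<noteq> w 0" using winj k unfolding inj_on_def by fastforce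
    then have "w k \<noteq> 1" by (simp add: w_def)
    then have "poly q z = 0"
      using k wr by (simp add: q_def poly_sum poly_monom geometric_sum)
    moreover have "poly p z = 0" using k by (auto simp: p_def poly_prod)
    ultimately show "poly p z = poly q z" by simp
  qed
  have "(\<Prod>k\<in>{1..<r}. x - y * w k) = (\<Prod>k\<in>{1..<r}. y * (x / y - w k))"
    using False by (intro prod.cong) (simp_all add: right_diff_distrib)
  also have "\<dots> = y ^ (r - 1) * poly p (x / y)" 
    by (simp add: prod.distrib p_def poly_prod)
  also have "\<dots> = (\<Sum>k<r. y ^ (r - 1) * (x / y) ^ k)"
    by (simp add: pq q_def poly_sum poly_monom sum_distrib_left)
  also have "\<dots> = (\<Sum>k<r. x ^ k * y ^ (r - 1 - k))"
    using False by (intro sum.cong) (auto simp: power_divide power_diff)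
  also have "\<dots> = (\<Sum>k<r. x ^ (r - 1 - k) * y ^ k)"
    by (subst sum.nat_diff_reindex[symmetric]) (auto intro!: sum.cong)
  finally show ?thesis by (simp add: w_def)
qed

lemma prod_roots_of_unity:
  fixes x y :: complex
  assumes "r \<ge> 1"
  shows "(\<Prod>k<r. x - y * cis (2 * pi * real k / real r)) = x ^ r - y ^ r"
proof -
  obtain n where n: "r = Suc n" using assms by (cases r) auto
  have "{..<r} = insert 0 {1..<r}" using assms by auto
  then have "(\<Prod>k<r. x - y * cis (2 * pi * real k / real r)) = (x - y) * (\<Sum>k<r. x ^ (r - 1 - k) * y ^ k)"
    using prod_nontrivial_roots_of_unity[OF assms, of x y] by simp
  also have "(\<Sum>k<r. x ^ (r - 1 - k) * y ^ k) = (\<Sum>k<r. x ^ k * y ^ (r - 1 - k))"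
    by (subst sum.nat_diff_reindex[symmetric]) (auto intro!: sum.cong)
  also have "(x - y) * \<dots> = x ^ r - y ^ r"
    unfolding n by (subst diff_power_eq_sum) simp
  finally show ?thesis .
qed

lemma sum_square_deviations:
  "(\<Sum>k<r. (real k - (real r - 1) / 2)\<^sup>2) = real r * ((real r)\<^sup>2 - 1) / 12"
proof -
  have "(\<Sum>k<r. (real k - c)\<^sup>2) = (real r - 1) * real r * (2 * real r - 1) / 6 - c * (real r - 1) * real r + real r * c\<^sup>2" for c :: real
    by (induction r) (simp_all add: field_simps power2_eq_square)
  from this[of "(real r - 1) / 2"] show ?thesis by (simp add: field_simps power2_eq_square)
qed

lemma cos_ge_one_minus_square: "1 - x\<^sup>2 / 2 \<le> cos (x::real)"
proof -
  have "cos x = 1 - 2 * (sin (x / 2))\<^sup>2" using cos_double_sin[of "x / 2"] by simp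
  moreover have "(sin (x / 2))\<^sup>2 \<le> (x / 2)\<^sup>2"
    using abs_sin_x_le_abs_x[of "x / 2"] unfolding abs_le_square_iff .
  ultimately show ?thesis by (simp add: power_divide)
qed

lemma pi_squared_le: "pi\<^sup>2 \<le> 12"
proof -
  have "pi < 3.2" using pi_approx by simp
  then have "pi\<^sup>2 \<le> 3.2\<^sup>2" by (intro power_mono) auto
  then show ?thesis by (simp add: power2_eq_square)
qed

lemma punctured_ring_upper:
  fixes a b :: real
  assumes "0 \<le> a" "0 \<le> b" "r \<ge> 1"
  shows "cmod (\<Sum>k<r. complex_of_real a ^ (r - 1 - k) * (complex_of_real b * cis \<theta>) ^ k)
    \<le> real r * max a b ^ (r - 1)"
proof -
  have "cmod (\<Sum>k<r. complex_of_real a ^ (r - 1 - k) * (complex_of_real b * cis \<theta>) ^ k)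
     \<le> (\<Sum>k<r. cmod (complex_of_real a ^ (r - 1 - k) * (complex_of_real b * cis \<theta>) ^ k))"
    by (rule norm_sum)
  also have "\<dots> \<le> (\<Sum>k<r. max a b ^ (r - 1))"
  proof (rule sum_mono)
    fix k assume "k \<in> {..<r}"
    then have "max a b ^ (r - 1) = max a b ^ (r - 1 - k) * max a b ^ k"
      by (simp add: power_add[symmetric])
    moreover have "a ^ (r - 1 - k) * b ^ k \<le> max a b ^ (r - 1 - k) * max a b ^ k"
      using assms by (intro mult_mono power_mono) auto
    ultimately show "cmod (complex_of_real a ^ (r - 1 - k) * (complex_of_real b * cis \<theta>) ^ k) \<le> max a b ^ (r - 1)"
      using assms by (simp add: norm_mult norm_power)
  qed
  finally show ?thesis by simp
qed

text \<open>Multiplying the sum by the unimodular factor that centres the exponents at their mean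
  \<open>(r - 1) / 2\<close> and taking the real part leaves cosines of angles that are as small as possible.\<close>

lemma punctured_ring_ge_cos_sum:
  fixes a b :: real
  assumes "0 \<le> a" "0 \<le> b" "r \<ge> 1"
  shows "cmod (\<Sum>k<r. complex_of_real a ^ (r - 1 - k) * (complex_of_real b * cis \<theta>) ^ k)
    \<ge> (\<Sum>k<r. a ^ (r - 1 - k) * b ^ k * cos ((real k - (real r - 1) / 2) * \<theta>))"
    (is "cmod ?S \<ge> ?R")
proof -
  have "cis (- (real r - 1) / 2 * \<theta>) * (complex_of_real a ^ (r - 1 - k) * (complex_of_real b * cis \<theta>) ^ k)
      = of_real (a ^ (r - 1 - k) * b ^ k) * cis ((real k - (real r - 1) / 2) * \<theta>)" for k
  proof -
    have "cis (- (real r - 1) / 2 * \<theta>) * cis (real k * \<theta>) = cis ((real k - (real r - 1) / 2) * \<theta>)"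
      unfolding cis_mult by (rule arg_cong[where f = cis]) (simp add: field_simps)
    moreover have "(complex_of_real b * cis \<theta>) ^ k = of_real (b ^ k) * cis (real k * \<theta>)"
      by (simp only: power_mult_distrib Complex.DeMoivre of_real_power)
    moreover have "u * (v * (w * z)) = v * w * (u * z)" for u v w z :: complex
      by (simp only: mult_ac)
    ultimately show ?thesis by (simp only: of_real_mult of_real_power)
  qed
  moreover have "Re (of_real c * cis x) = c * cos x" for c x :: real
    by simp
  ultimately have "Re (cis (- (real r - 1) / 2 * \<theta>) * ?S) = ?R"
    by (simp only: sum_distrib_left Re_sum)
  moreover have "cmod (cis (- (real r - 1) / 2 * \<theta>) * ?S) = cmod ?S" by (simp add: norm_mult)
  ultimately show ?thesis
    using complex_Re_le_cmod[of "cis (- (real r - 1) / 2 * \<theta>) * ?S"] by (simp only:)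
qed

lemma centred_angle_le:
  assumes "k < r" "\<bar>\<theta>\<bar> \<le> pi / real r"
  shows "\<bar>(real k - (real r - 1) / 2) * \<theta>\<bar> \<le> pi / 2"
proof -
  have "\<bar>real k - (real r - 1) / 2\<bar> \<le> real r / 2" using assms(1) by (auto simp: abs_le_iff field_simps)
  then have "\<bar>(real k - (real r - 1) / 2) * \<theta>\<bar> \<le> real r / 2 * (pi / real r)"
    unfolding abs_mult using assms by (intro mult_mono) auto
  then show ?thesis using assms by simp
qed

text \<open>For \<open>\<bar>\<theta>\<bar> \<le> \<pi> / r\<close> all centred angles lie in \<open>[- \<pi>/2, \<pi>/2]\<close>, so no cancellation takes place,
  and by \<open>cos x \<ge> 1 - x\<^sup>2 / 2\<close> the cosines add up to at least \<open>r (1 - \<pi>\<^sup>2 / 24) \<ge> r / 2\<close>.\<close>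

lemma punctured_ring_lower:
  fixes a b :: real
  assumes ab: "0 \<le> a" "0 \<le> b" and r: "r \<ge> 1" and th: "\<bar>\<theta>\<bar> \<le> pi / real r"
  shows "real r / 2 * min a b ^ (r - 1)
    \<le> cmod (\<Sum>k<r. complex_of_real a ^ (r - 1 - k) * (complex_of_real b * cis \<theta>) ^ k)"
proof -
  let ?c = "\<lambda>k. (real k - (real r - 1) / 2)"
  have cos0: "0 \<le> cos (?c k * \<theta>)" if "k < r" for k
    using centred_angle_le[OF that th] by (intro cos_ge_zero) linarith+
  have "real r / 2 \<le> (\<Sum>k<r. cos (?c k * \<theta>))"
  proof -
    have "(\<Sum>k<r. 1 - (?c k * \<theta>)\<^sup>2 / 2) \<le> (\<Sum>k<r. cos (?c k * \<theta>))"
      by (intro sum_mono cos_ge_one_minus_square)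
    moreover have "(\<Sum>k<r. 1 - (?c k * \<theta>)\<^sup>2 / 2) = real r - \<theta>\<^sup>2 / 2 * (\<Sum>k<r. (?c k)\<^sup>2)"
      by (simp add: sum_subtractf sum_distrib_left power_mult_distrib mult_ac)
    moreover have "\<theta>\<^sup>2 / 2 * (\<Sum>k<r. (?c k)\<^sup>2) \<le> real r / 2"
    proof -
      have "\<theta>\<^sup>2 \<le> (pi / real r)\<^sup>2" using th by (metis abs_ge_zero power2_abs power_mono)
      also have "\<dots> \<le> 12 / (real r)\<^sup>2" using pi_squared_le by (simp add: power_divide divide_right_mono)
      finally have 1: "\<theta>\<^sup>2 \<le> 12 / (real r)\<^sup>2" .
      have "(\<Sum>k<r. (?c k)\<^sup>2) \<le> real r ^ 3 / 12"
        unfolding sum_square_deviations by (simp add: field_simps power3_eq_cube power2_eq_square)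
      then have "\<theta>\<^sup>2 / 2 * (\<Sum>k<r. (?c k)\<^sup>2) \<le> (12 / (real r)\<^sup>2) / 2 * (real r ^ 3 / 12)"
        using 1 by (intro mult_mono divide_right_mono) (auto intro: sum_nonneg)
      also have "\<dots> = real r / 2" using r by (simp add: field_simps power3_eq_cube power2_eq_square)
      finally show ?thesis .
    qed
    ultimately show ?thesis by linarith
  qed
  then have "real r / 2 * min a b ^ (r - 1) \<le> (\<Sum>k<r. cos (?c k * \<theta>)) * min a b ^ (r - 1)"
    using ab by (intro mult_right_mono) auto
  also have "\<dots> = (\<Sum>k<r. min a b ^ (r - 1) * cos (?c k * \<theta>))" by (subst mult.commute) (rule sum_distrib_left)
  also have "\<dots> \<le> (\<Sum>k<r. a ^ (r - 1 - k) * b ^ k * cos (?c k * \<theta>))"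
  proof (intro sum_mono mult_right_mono)
    fix k assume k: "k \<in> {..<r}"
    then have "min a b ^ (r - 1) = min a b ^ (r - 1 - k) * min a b ^ k"
      by (simp add: power_add[symmetric])
    also have "\<dots> \<le> a ^ (r - 1 - k) * b ^ k"
      using ab by (intro mult_mono power_mono) auto
    finally show "min a b ^ (r - 1) \<le> a ^ (r - 1 - k) * b ^ k" .
  qed (use cos0 in auto)
  also have "\<dots> \<le> cmod (\<Sum>k<r. complex_of_real a ^ (r - 1 - k) * (complex_of_real b * cis \<theta>) ^ k)"
    by (rule punctured_ring_ge_cos_sum) fact+
  finally show ?thesis .
qed

text \<open>Near the poles \<open>b\<close> may vanish and \<open>min a b\<close> is useless; there \<open>r \<le> 2\<close>, and the first term of
  the sum of cosines suffices.\<close>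

lemma punctured_ring_lower_small:
  fixes a b :: real
  assumes ab: "0 \<le> a" "0 \<le> b" and r: "r \<in> {1, 2}" and th: "\<bar>\<theta>\<bar> \<le> pi / real r"
  shows "a ^ (r - 1) / 2 
    \<le> cmod (\<Sum>k<r. complex_of_real a ^ (r - 1 - k) * (complex_of_real b * cis \<theta>) ^ k)"
proof -
  let ?c = "\<lambda>k. (real k - (real r - 1) / 2)"
  have r1: "r \<ge> 1" using r by auto
  have cos0: "0 \<le> cos (?c k * \<theta>)" if "k < r" for k
    using centred_angle_le[OF that th] by (intro cos_ge_zero) linarith+
  have "1 / 2 \<le> cos (?c 0 * \<theta>)"
  proof -
    have "\<bar>?c 0 * \<theta>\<bar> \<le> 1"
      using r th pi_less_4 by (auto simp: abs_mult)
    then have "(?c 0 * \<theta>)\<^sup>2 \<le> 1" by (simp add: abs_square_le_1)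
    then show ?thesis using cos_ge_one_minus_square[of "?c 0 * \<theta>"] by linarith
  qed
  then have "a ^ (r - 1) * (1 / 2) \<le> a ^ (r - 1) * cos (?c 0 * \<theta>)"
    using ab by (intro mult_left_mono) auto
  also have "\<dots> = (\<Sum>k\<in>{0}. a ^ (r - 1 - k) * b ^ k * cos (?c k * \<theta>))" by simp
  also have "\<dots> \<le> (\<Sum>k<r. a ^ (r - 1 - k) * b ^ k * cos (?c k * \<theta>))"
    using r1 ab cos0 by (intro sum_mono2) auto
  also have "\<dots> \<le> cmod (\<Sum>k<r. complex_of_real a ^ (r - 1 - k) * (complex_of_real b * cis \<theta>) ^ k)"
    by (rule punctured_ring_ge_cos_sum) fact+
  finally show ?thesis by simp
qed

text \<open>An angle of modulus at most \<open>\<pi> / r\<close> is the closest to \<open>0\<close> among all its translates by multiples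
  of \<open>2 \<pi> / r\<close>, even modulo \<open>2 \<pi>\<close>.\<close>

lemma cos_shift_le:
  fixes j :: int
  assumes th: "\<bar>\<theta>\<bar> \<le> pi / real r" and r: "r \<ge> 1"
  shows "cos (\<theta> + 2 * pi * of_int j / real r) \<le> cos \<theta>"
proof -
  let ?t = "\<theta> + 2 * pi * of_int j / real r"
  define n where "n = round (?t / (2 * pi))"
  define s where "s = ?t - 2 * pi * of_int n"
  define i where "i = j - n * int r"
  have s: "s = \<theta> + 2 * pi * of_int i / real r"
    using r by (simp add: s_def i_def field_simps)
  have cs: "cos s = cos ?t"
    unfolding s_def by (subst cos_diff) (simp add: sin_int_2pin cos_int_2pin)
  have "\<bar>of_int n - ?t / (2 * pi)\<bar> \<le> 1 / 2" unfolding n_def by (rule of_int_round_abs_le)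
  then have "\<bar>2 * pi * (of_int n - ?t / (2 * pi))\<bar> \<le> 2 * pi * (1 / 2)"
    unfolding abs_mult by (intro mult_mono) auto
  moreover have "2 * pi * (of_int n - ?t / (2 * pi)) = - s" by (simp add: s_def field_simps)
  ultimately have spi: "\<bar>s\<bar> \<le> pi" by simp
  show ?thesis
  proof (cases "i = 0")
    case True
    then show ?thesis using s cs by simp
  next
    case False
    then have "1 \<le> \<bar>real_of_int i\<bar>" by linarith
    then have "2 * pi / real r * 1 \<le> 2 * pi / real r * \<bar>real_of_int i\<bar>"
      by (intro mult_left_mono) auto
    then have "2 * (pi / real r) \<le> \<bar>2 * pi * of_int i / real r\<bar>" by (simp add: abs_mult)
    then have "\<bar>\<theta>\<bar> \<le> \<bar>s\<bar>" using th unfolding s by linarith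
    then have "cos \<bar>s\<bar> \<le> cos \<bar>\<theta>\<bar>" using spi by (intro cos_monotone_0_pi_le) auto
    then show ?thesis using cs by simp
  qed
qed

section \<open>Equally spaced points on a parallel\<close>

definition sphere_point :: "real \<Rightarrow> real \<Rightarrow> real^3" where
  "sphere_point t \<alpha> = vector [sqrt (1 - t\<^sup>2) * cos \<alpha>, sqrt (1 - t\<^sup>2) * sin \<alpha>, t]"

text \<open>This is half the product of the distances of a point at height \<open>h\<close> from the north pole and of a
  point at height \<open>t\<close> from the south pole. For two points of the sphere at heights \<open>t\<close> and \<open>h\<close>, the
  numbers \<open>chord h t\<close> and \<open>chord t h\<close> are the two sides \<open>a\<close> and \<open>b\<close> of a plane triangle whose third
  side is the distance of the points and whose angle is the difference of their longitudes.\<close>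

definition chord :: "real \<Rightarrow> real \<Rightarrow> real" where
  "chord h t = sqrt ((1 - h) * (1 + t))"

text \<open>Indexing by all integers, with repetitions, makes every point of the ring eligible as the
  starting point of an enumeration by \<open>{..<r}\<close>.\<close>

definition latitude_ring :: "real \<Rightarrow> nat \<Rightarrow> (real^3) set" where
  "latitude_ring h r = range (\<lambda>k::int. sphere_point h (2 * pi * of_int k / real r))"

lemma norm_vec3_squared: "(norm (x::real^3))\<^sup>2 = (x$1)\<^sup>2 + (x$2)\<^sup>2 + (x$3)\<^sup>2"
  by (simp add: norm_vec_def L2_set_def sum_3 real_sqrt_pow2)

lemma sphere_point_in_sphere:
  assumes "\<bar>t\<bar> \<le> 1"
  shows "sphere_point t \<alpha> \<in> sphere 0 1"
proof -
  have t: "t\<^sup>2 \<le> 1" using assms by (simp add: abs_square_le_1)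
  have "(norm (sphere_point t \<alpha>))\<^sup>2 = (1 - t\<^sup>2) * ((cos \<alpha>)\<^sup>2 + (sin \<alpha>)\<^sup>2) + t\<^sup>2"
    using t by (simp add: norm_vec3_squared sphere_point_def power_mult_distrib algebra_simps del: sin_cos_squared_add sin_cos_squared_add2 sin_cos_squared_add3)
  then have "(norm (sphere_point t \<alpha>))\<^sup>2 = 1" by simp
  then have "norm (sphere_point t \<alpha>) = 1" by (simp add: power2_eq_1_iff) (smt (verit) norm_ge_zero)
  then show ?thesis by simp
qed

lemma sphere_point_surj:
  assumes "x \<in> sphere (0::real^3) 1"
  obtains t \<alpha> where "\<bar>t\<bar> \<le> 1" "x = sphere_point t \<alpha>"
proof -
  have "(norm x)\<^sup>2 = 1" using assms by simp
  then have n: "(x$1)\<^sup>2 + (x$2)\<^sup>2 + (x$3)\<^sup>2 = 1" by (simp add: norm_vec3_squared)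
  then have t: "(x$3)\<^sup>2 \<le> 1" by (smt (verit) zero_le_power2)
  define z where "z = Complex (x$1) (x$2)"
  have "(cmod z)\<^sup>2 = 1 - (x$3)\<^sup>2" using n by (simp add: cmod_power2 z_def)
  then have c: "cmod z = sqrt (1 - (x$3)\<^sup>2)" by (metis norm_ge_zero real_sqrt_unique)
  obtain \<alpha> where "z = rcis (cmod z) \<alpha>" by (metis rcis_cmod_Arg)
  then have "x$1 = cmod z * cos \<alpha>" "x$2 = cmod z * sin \<alpha>"
    by (metis Re_rcis Im_rcis z_def complex.sel)+
  then have "x = sphere_point (x$3) \<alpha>"
    by (simp add: vec_eq_iff forall_3 sphere_point_def c)
  then show ?thesis using that t by (simp add: abs_square_le_1)
qed

lemma sphere_point_height [simp]: "sphere_point t \<alpha> $ 3 = t"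
  by (simp add: sphere_point_def)

lemma chord_squared:
  assumes "\<bar>t\<bar> \<le> 1" "\<bar>h\<bar> \<le> 1"
  shows "(chord h t)\<^sup>2 = (1 - h) * (1 + t)"
  using assms by (simp add: chord_def abs_le_iff)

lemma chord_nonneg [simp]: "\<bar>t\<bar> \<le> 1 \<Longrightarrow> \<bar>h\<bar> \<le> 1 \<Longrightarrow> 0 \<le> chord h t"
  by (simp add: chord_def abs_le_iff)

lemma chord_mult:
  "chord h t * chord t h = sqrt (1 - t\<^sup>2) * sqrt (1 - h\<^sup>2)"
  by (simp add: chord_def flip: real_sqrt_mult) (simp add: power2_eq_square algebra_simps)

lemma cmod_diff_cis_squared:
  "(cmod (of_real a - of_real b * cis \<theta>))\<^sup>2 = a\<^sup>2 + b\<^sup>2 - 2 * a * b * cos \<theta>"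
proof -
  have "(cmod (of_real a - of_real b * cis \<theta>))\<^sup>2 = a\<^sup>2 + b\<^sup>2 * ((cos \<theta>)\<^sup>2 + (sin \<theta>)\<^sup>2) - 2 * a * b * cos \<theta>"
    unfolding cmod_power2 by (simp add: power2_eq_square algebra_simps del: sin_cos_squared_add sin_cos_squared_add2 sin_cos_squared_add3)
  then show ?thesis by simp
qed

lemma norm_sphere_point_diff:
  assumes "\<bar>t\<bar> \<le> 1" "\<bar>h\<bar> \<le> 1"
  shows "norm (sphere_point t \<alpha> - sphere_point h \<beta>)
    = cmod (of_real (chord h t) - of_real (chord t h) * cis (\<alpha> - \<beta>))"
proof -
  have t: "t\<^sup>2 \<le> 1" "h\<^sup>2 \<le> 1" using assms by (simp_all add: abs_square_le_1)
  define A where "A = sqrt (1 - t\<^sup>2)"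
  define B where "B = sqrt (1 - h\<^sup>2)"
  have A: "A\<^sup>2 = 1 - t\<^sup>2" and B: "B\<^sup>2 = 1 - h\<^sup>2" using t by (simp_all add: A_def B_def)
  have "(norm (sphere_point t \<alpha> - sphere_point h \<beta>))\<^sup>2
    = (A * cos \<alpha> - B * cos \<beta>)\<^sup>2 + (A * sin \<alpha> - B * sin \<beta>)\<^sup>2 + (t - h)\<^sup>2"
    by (simp add: norm_vec3_squared sphere_point_def A_def B_def)
  also have "\<dots> = A\<^sup>2 * ((cos \<alpha>)\<^sup>2 + (sin \<alpha>)\<^sup>2) + B\<^sup>2 * ((cos \<beta>)\<^sup>2 + (sin \<beta>)\<^sup>2) + (t - h)\<^sup>2
      - 2 * (A * B) * cos (\<alpha> - \<beta>)"
    by (simp add: power2_eq_square cos_diff algebra_simps del: sin_cos_squared_add sin_cos_squared_add2 sin_cos_squared_add3)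
  also have "\<dots> = (1 - h) * (1 + t) + (1 - t) * (1 + h) - 2 * (A * B) * cos (\<alpha> - \<beta>)"
    unfolding A B by (simp add: power2_eq_square algebra_simps)
  also have "\<dots> = (chord h t)\<^sup>2 + (chord t h)\<^sup>2 - 2 * (chord h t * chord t h) * cos (\<alpha> - \<beta>)"
    using assms by (simp add: chord_squared chord_mult A_def B_def)
  also have "\<dots> = (cmod (of_real (chord h t) - of_real (chord t h) * cis (\<alpha> - \<beta>)))\<^sup>2"
    by (simp add: cmod_diff_cis_squared)
  finally show ?thesis by (simp add: power2_eq_iff_nonneg)
qed

lemma sphere_point_periodic:
  "sphere_point h (\<alpha> + 2 * pi * of_int n) = sphere_point h \<alpha>"
  by (simp add: sphere_point_def cos_add sin_add)

lemma latitude_ring_eq: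
  fixes k0 :: int
  assumes "r \<ge> 1"
  shows "latitude_ring h r = (\<lambda>k. sphere_point h (2 * pi * of_int k0 / real r + 2 * pi * real k / real r)) ` {..<r}"
    (is "_ = ?R")
proof
  show "?R \<subseteq> latitude_ring h r"
  proof
    fix x assume "x \<in> ?R"
    then obtain k where "x = sphere_point h (2 * pi * of_int k0 / real r + 2 * pi * real k / real r)" by auto
    then have "x = sphere_point h (2 * pi * of_int (k0 + int k) / real r)"
      by (simp add: distrib_left add_divide_distrib)
    then show "x \<in> latitude_ring h r" unfolding latitude_ring_def by blast
  qed
  show "latitude_ring h r \<subseteq> ?R"
  proof
    fix x assume "x \<in> latitude_ring h r"
    then obtain k where x: "x = sphere_point h (2 * pi * of_int k / real r)" by (auto simp: latitude_ring_def)
    define j where "j = nat ((k - k0) mod int r)"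
    have j: "j < r" "int j = (k - k0) mod int r" using assms by (simp_all add: j_def nat_less_iff)
    have "k = k0 + int j + int r * ((k - k0) div int r)" unfolding j by simp
    then have "real_of_int k = of_int k0 + real j + real r * of_int ((k - k0) div int r)"
      by (metis of_int_add of_int_mult of_int_of_nat_eq)
    then have "2 * pi * of_int k / real r
        = 2 * pi * of_int k0 / real r + 2 * pi * real j / real r + 2 * pi * of_int ((k - k0) div int r)"
      using assms by (simp add: field_simps)
    then have "x = sphere_point h (2 * pi * of_int k0 / real r + 2 * pi * real j / real r)"
      unfolding x by (simp only: sphere_point_periodic)
    then show "x \<in> ?R" using j by blast
  qed
qed

lemma latitude_ring_inj:
  fixes \<beta> :: real
  assumes r: "r \<ge> 1" and h: "\<bar>h\<bar> < 1"
  shows "inj_on (\<lambda>k. sphere_point h (\<beta> + 2 * pi * real k / real r)) {..<r}"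
proof (rule inj_onI)
  fix i j assume ij: "i \<in> {..<r}" "j \<in> {..<r}"
    and eq: "sphere_point h (\<beta> + 2 * pi * real i / real r) = sphere_point h (\<beta> + 2 * pi * real j / real r)"
  have "h\<^sup>2 < 1" using h by (simp add: abs_square_less_1)
  then have s: "sqrt (1 - h\<^sup>2) \<noteq> 0" by simp
  have "cis (\<beta> + 2 * pi * real i / real r) = cis (\<beta> + 2 * pi * real j / real r)"
    using eq s by (simp add: sphere_point_def vec_eq_iff forall_3 complex_eq_iff)
  then have "cis \<beta> * cis (2 * pi * real i / real r) = cis \<beta> * cis (2 * pi * real j / real r)"
    by (simp only: cis_mult)
  then have "cis (2 * pi * real i / real r) = cis (2 * pi * real j / real r)" by simp
  then show "i = j"
    using Complex.bij_betw_roots_unity[of r] r ij unfolding bij_betw_def inj_on_def by auto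
qed

lemma finite_latitude_ring: "r \<ge> 1 \<Longrightarrow> finite (latitude_ring h r)"
  by (subst latitude_ring_eq[of r h 0]) auto

lemma card_latitude_ring:
  assumes "r \<ge> 1" "\<bar>h\<bar> < 1"
  shows "card (latitude_ring h r) = r"
  unfolding latitude_ring_eq[OF assms(1), of h 0]
  by (subst card_image[OF latitude_ring_inj[OF assms]]) simp

lemma latitude_ring_height: "q \<in> latitude_ring h r \<Longrightarrow> q $ 3 = h"
  by (auto simp: latitude_ring_def)

text \<open>The points of the ring lie at the angles \<open>\<alpha> - 2 \<pi> k / r\<close>, whereas the product formula for roots
  of unity has a plus sign; the proof passes to complex conjugates.\<close>

lemma prod_latitude_ring:
  assumes r: "r \<ge> 1" and h: "\<bar>h\<bar> < 1" and t: "\<bar>t\<bar> \<le> 1"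
  shows "(\<Prod>q\<in>latitude_ring h r. norm (sphere_point t \<alpha> - q))
    = cmod (of_real (chord h t) ^ r - (of_real (chord t h) * cis \<alpha>) ^ r)"
proof -
  have "(\<Prod>q\<in>latitude_ring h r. norm (sphere_point t (-\<alpha>) - q))
    = cmod (of_real (chord h t) ^ r - (of_real (chord t h) * cis (-\<alpha>)) ^ r)" for \<alpha>
  proof -
    have "(\<Prod>q\<in>latitude_ring h r. norm (sphere_point t (-\<alpha>) - q))
      = (\<Prod>k<r. norm (sphere_point t (-\<alpha>) - sphere_point h (2 * pi * real k / real r)))"
      unfolding latitude_ring_eq[OF r, of h 0] using latitude_ring_inj[OF r h, of 0]
      by (subst prod.reindex) auto
    also have "\<dots> = (\<Prod>k<r. cmod (of_real (chord h t) - of_real (chord t h) * cis (\<alpha> + 2 * pi * real k / real r)))"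
    proof (rule prod.cong)
      fix k
      have "norm (sphere_point t (-\<alpha>) - sphere_point h (2 * pi * real k / real r))
        = cmod (cnj (of_real (chord h t) - of_real (chord t h) * cis (-\<alpha> - 2 * pi * real k / real r)))"
        using h t unfolding complex_mod_cnj by (subst norm_sphere_point_diff) auto
      also have "cnj (of_real (chord h t) - of_real (chord t h) * cis (-\<alpha> - 2 * pi * real k / real r))
        = of_real (chord h t) - of_real (chord t h) * cis (\<alpha> + 2 * pi * real k / real r)"
        by (simp add: cis_cnj add.commute)
      finally show "norm (sphere_point t (-\<alpha>) - sphere_point h (2 * pi * real k / real r))
        = cmod (of_real (chord h t) - of_real (chord t h) * cis (\<alpha> + 2 * pi * real k / real r))" .
    qed simp
    also have "\<dots> = cmod (\<Prod>k<r. of_real (chord h t) - (of_real (chord t h) * cis \<alpha>) * cis (2 * pi * real k / real r))"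
      by (simp add: prod_norm cis_mult mult.assoc)
    also have "\<dots> = cmod (of_real (chord h t) ^ r - (of_real (chord t h) * cis \<alpha>) ^ r)"
      by (simp add: prod_roots_of_unity[OF r])
    also have "\<dots> = cmod (cnj (of_real (chord h t) ^ r - (of_real (chord t h) * cis \<alpha>) ^ r))"
      by (simp only: complex_mod_cnj)
    also have "cnj (of_real (chord h t) ^ r - (of_real (chord t h) * cis \<alpha>) ^ r) 
      = of_real (chord h t) ^ r - (of_real (chord t h) * cis (-\<alpha>)) ^ r"
      by (simp add: cis_cnj)
    finally show ?thesis .
  qed
  from this[of "-\<alpha>"] show ?thesis by simp
qed

text \<open>The enumeration of the ring starts at the omitted point, so that the remaining points correspond
  to the nontrivial roots of unity.\<close>

lemma prod_punctured_latitude_ring: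
  fixes k0 :: int
  assumes r: "r \<ge> 1" and h: "\<bar>h\<bar> < 1" and t: "\<bar>t\<bar> \<le> 1"
  defines "q0 \<equiv> sphere_point h (2 * pi * of_int k0 / real r)"
  shows "(\<Prod>q\<in>latitude_ring h r - {q0}. norm (sphere_point t \<alpha> - q))
    = cmod (\<Sum>k<r. of_real (chord h t) ^ (r - 1 - k) * (of_real (chord t h) * cis (\<alpha> - 2 * pi * of_int k0 / real r)) ^ k)"
proof -
  let ?f = "\<lambda>k. sphere_point h (2 * pi * of_int k0 / real r + 2 * pi * real k / real r)"
  let ?\<theta> = "\<alpha> - 2 * pi * of_int k0 / real r"
  let ?a = "complex_of_real (chord h t)" and ?b = "complex_of_real (chord t h)"
  have q0: "q0 = ?f 0" by (simp add: q0_def)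
  have inj: "inj_on ?f {..<r}" by (rule latitude_ring_inj[OF r h])
  have "latitude_ring h r - {q0} = ?f ` {1..<r}"
  proof -
    have "latitude_ring h r - {q0} = ?f ` {..<r} - ?f ` {0}" 
      unfolding latitude_ring_eq[OF r, of h k0] q0 by simp
    also have "\<dots> = ?f ` ({..<r} - {0})" using inj r by (subst inj_on_image_set_diff[OF inj]) auto
    also have "{..<r} - {0} = {1..<r}" by auto
    finally show ?thesis .
  qed
  moreover have "inj_on ?f {1..<r}" using inj by (rule inj_on_subset) auto
  ultimately have "(\<Prod>q\<in>latitude_ring h r - {q0}. norm (sphere_point t \<alpha> - q))
    = (\<Prod>k\<in>{1..<r}. norm (sphere_point t \<alpha> - ?f k))"
    by (simp add: prod.reindex)
  also have "\<dots> = (\<Prod>k\<in>{1..<r}. cmod (?a - ?b * cis (- ?\<theta>) * cis (2 * pi * real k / real r)))"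
  proof (rule prod.cong)
    fix k
    have "norm (sphere_point t \<alpha> - ?f k) = cmod (cnj (?a - ?b * cis (?\<theta> - 2 * pi * real k / real r)))"
      using h t unfolding complex_mod_cnj by (subst norm_sphere_point_diff) (auto simp: algebra_simps)
    also have "cnj (?a - ?b * cis (?\<theta> - 2 * pi * real k / real r)) 
      = ?a - ?b * cis (- ?\<theta>) * cis (2 * pi * real k / real r)"
      by (simp add: cis_cnj cis_mult mult.assoc algebra_simps)
    finally show "norm (sphere_point t \<alpha> - ?f k) = cmod (?a - ?b * cis (- ?\<theta>) * cis (2 * pi * real k / real r))" .
  qed simp
  also have "\<dots> = cmod (\<Sum>k<r. ?a ^ (r - 1 - k) * (?b * cis (- ?\<theta>)) ^ k)"
    by (simp only: prod_norm prod_nontrivial_roots_of_unity[OF r])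
  also have "\<dots> = cmod (cnj (\<Sum>k<r. ?a ^ (r - 1 - k) * (?b * cis (- ?\<theta>)) ^ k))"
    by (simp only: complex_mod_cnj)
  also have "cnj (\<Sum>k<r. ?a ^ (r - 1 - k) * (?b * cis (- ?\<theta>)) ^ k)
     = (\<Sum>k<r. ?a ^ (r - 1 - k) * (?b * cis ?\<theta>) ^ k)"
    by (simp add: cis_cnj)
  finally show ?thesis .
qed

lemma latitude_ring_nearest:
  assumes r: "r \<ge> 1" and h: "\<bar>h\<bar> < 1" and t: "\<bar>t\<bar> \<le> 1"
  obtains k0 :: int where "\<bar>\<alpha> - 2 * pi * of_int k0 / real r\<bar> \<le> pi / real r"
    and "\<And>q. q \<in> latitude_ring h r \<Longrightarrow>
       norm (sphere_point t \<alpha> - sphere_point h (2 * pi * of_int k0 / real r)) \<le> norm (sphere_point t \<alpha> - q)"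
proof -
  define k0 where "k0 = round (\<alpha> * real r / (2 * pi))"
  let ?\<theta> = "\<alpha> - 2 * pi * of_int k0 / real r"
  have "\<bar>of_int k0 - \<alpha> * real r / (2 * pi)\<bar> \<le> 1 / 2" unfolding k0_def by (rule of_int_round_abs_le)
  then have "\<bar>of_int k0 - \<alpha> * real r / (2 * pi)\<bar> * (2 * pi / real r) \<le> 1 / 2 * (2 * pi / real r)"
    by (intro mult_right_mono) auto
  also have "\<bar>of_int k0 - \<alpha> * real r / (2 * pi)\<bar> * (2 * pi / real r)
     = \<bar>(of_int k0 - \<alpha> * real r / (2 * pi)) * (2 * pi / real r)\<bar>" by (simp add: abs_mult)
  also have "(of_int k0 - \<alpha> * real r / (2 * pi)) * (2 * pi / real r) = - ?\<theta>"
    using r by (simp add: field_simps)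
  finally have th: "\<bar>?\<theta>\<bar> \<le> pi / real r" by simp
  moreover have "norm (sphere_point t \<alpha> - sphere_point h (2 * pi * of_int k0 / real r)) \<le> norm (sphere_point t \<alpha> - q)"
    if "q \<in> latitude_ring h r" for q
  proof -
    obtain k :: int where q: "q = sphere_point h (2 * pi * of_int k / real r)"
      using \<open>q \<in> latitude_ring h r\<close> unfolding latitude_ring_def by blast
    have "cos (?\<theta> + 2 * pi * of_int (k0 - k) / real r) \<le> cos ?\<theta>" by (rule cos_shift_le[OF th r])
    moreover have "?\<theta> + 2 * pi * of_int (k0 - k) / real r = \<alpha> - 2 * pi * of_int k / real r"
      using r by (simp add: field_simps)
    ultimately have "cos (\<alpha> - 2 * pi * of_int k / real r) \<le> cos ?\<theta>" by (simp only:)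
    then have "2 * chord h t * chord t h * cos (\<alpha> - 2 * pi * of_int k / real r) \<le> 2 * chord h t * chord t h * cos ?\<theta>"
      using h t by (intro mult_left_mono) auto
    then have "(norm (sphere_point t \<alpha> - sphere_point h (2 * pi * of_int k0 / real r)))\<^sup>2 \<le> (norm (sphere_point t \<alpha> - q))\<^sup>2"
      using h t unfolding q by (simp add: norm_sphere_point_diff cmod_diff_cis_squared)
    then show ?thesis by simp
  qed
  ultimately show ?thesis using that by blast
qed

section \<open>Sums of logarithms over the parallels\<close>

lemma ln_one_minus_bounds:
  assumes "0 \<le> (s::real)" "s \<le> 1/2"
  shows "- s - 2 * s\<^sup>2 \<le> ln (1 - s)" "ln (1 - s) \<le> - s"
  using ln_one_minus_pos_lower_bound[OF assms] ln_add_one_self_le_self2[of "-s"] assms by auto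

text \<open>The left-hand side is the Taylor remainder after the cubic term: with the term \<open>y\<^sup>3 / 3\<close>
  included, the derivative is \<open>ln (1 - y\<^sup>2) + y\<^sup>2\<close>, which lies between \<open>- 2 y\<^sup>4\<close> and \<open>0\<close>.\<close>

lemma entropy_difference:
  assumes "0 \<le> (y::real)" "y\<^sup>2 \<le> 1/2"
  shows "\<bar>(1 + y) * ln (1 + y) - (1 - y) * ln (1 - y) - 2 * y + y ^ 3 / 3\<bar> \<le> y ^ 5"
proof -
  define f where "f x = (1 + x) * ln (1 + x) - (1 - x) * ln (1 - x) - 2 * x + x ^ 3 / 3" for x :: real
  have y1: "y < 1"
  proof (rule ccontr)
    assume "\<not> y < 1"
    then have "1 \<le> y\<^sup>2" by (simp add: power2_eq_square mult_ge1_I)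
    then show False using assms by simp
  qed
  have bnd: "- 2 * x ^ 4 \<le> ln (1 - x\<^sup>2) + x\<^sup>2 \<and> ln (1 - x\<^sup>2) + x\<^sup>2 \<le> 0" if "0 \<le> x" "x \<le> y" for x
  proof -
    have "x\<^sup>2 \<le> y\<^sup>2" using that by (intro power_mono) auto
    then show ?thesis using ln_one_minus_bounds[of "x\<^sup>2"] assms by simp
  qed
  have df: "(f has_real_derivative (ln (1 - x\<^sup>2) + x\<^sup>2)) (at x)" if "0 \<le> x" "x \<le> y" for x
  proof -
    have x: "0 < 1 + x" "0 < 1 - x" using that y1 by auto
    then have "ln (1 - x\<^sup>2) = ln (1 + x) + ln (1 - x)"
      by (subst ln_mult_pos[symmetric]) (auto simp: algebra_simps power2_eq_square)
    have "(f has_real_derivative (ln (1 + x) + (1 + x) * (1 / (1 + x))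
        - (- ln (1 - x) + (1 - x) * (- (1 / (1 - x)))) - 2 + x\<^sup>2)) (at x)"
      unfolding f_def using x by (auto intro!: derivative_eq_intros)
    then show ?thesis using x \<open>ln (1 - x\<^sup>2) = ln (1 + x) + ln (1 - x)\<close> by simp
  qed
  have "f y \<le> f 0"
    using assms bnd df by (intro DERIV_nonpos_imp_nonincreasing[of 0 y f]) blast+
  moreover have "f 0 + 2 / 5 * 0 ^ 5 \<le> f y + 2 / 5 * y ^ 5"
  proof (rule DERIV_nonneg_imp_nondecreasing[of 0 y "\<lambda>x. f x + 2 / 5 * x ^ 5"])
    fix x assume x: "0 \<le> x" "x \<le> y"
    have "((\<lambda>x. f x + 2 / 5 * x ^ 5) has_real_derivative (ln (1 - x\<^sup>2) + x\<^sup>2 + 2 * x ^ 4)) (at x)"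
      using df[OF x] by (auto intro!: derivative_eq_intros)
    then show "\<exists>d. ((\<lambda>x. f x + 2 / 5 * x ^ 5) has_real_derivative d) (at x) \<and> 0 \<le> d"
      using bnd[OF x] by force
  qed (use assms in auto)
  moreover have "0 \<le> y ^ 5" using assms by simp
  ultimately have "\<bar>f y\<bar> \<le> y ^ 5" by (simp add: f_def)
  then show ?thesis by (simp add: f_def)
qed

text \<open>The integral of \<open>ln\<close> over \<open>[W - j, W + j]\<close> is compared with the value at the midpoint \<open>W\<close>,
  including the second-order correction \<open>- j\<^sup>3 / (6 W\<^sup>2)\<close>. For \<open>W = j\<^sup>2\<close>, the band of the \<open>j\<close>-th
  parallel, the correction is \<open>- 1 / (6 j)\<close>, and the sum over \<open>j\<close> would diverge without it.\<close>

lemma entropy_increment: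
  fixes W j :: real
  assumes "0 < W" "0 \<le> j" "j\<^sup>2 \<le> W\<^sup>2 / 2"
  shows "\<bar>((W + j) * ln (W + j) - (W - j) * ln (W - j) - 2 * j) / 2 - j * ln W + j ^ 3 / (6 * W\<^sup>2)\<bar>
    \<le> j ^ 5 / (2 * W ^ 4)"
proof -
  define y where "y = j / W"
  have j: "j = W * y" using assms by (simp add: y_def)
  have y: "0 \<le> y" "y\<^sup>2 \<le> 1/2" using assms by (simp_all add: y_def power_divide field_simps)
  have y1: "y < 1"
  proof (rule ccontr)
    assume "\<not> y < 1"
    then have "1 \<le> y\<^sup>2" by (simp add: power2_eq_square mult_ge1_I)
    then show False using y by simp
  qed
  have l: "ln (W + j) = ln W + ln (1 + y)" "ln (W - j) = ln W + ln (1 - y)"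
  proof -
    have "W + j = W * (1 + y)" "W - j = W * (1 - y)" by (simp_all add: j algebra_simps)
    then show "ln (W + j) = ln W + ln (1 + y)" "ln (W - j) = ln W + ln (1 - y)"
      using assms y y1 by (simp_all add: ln_mult)
  qed
  have "((W + j) * ln (W + j) - (W - j) * ln (W - j) - 2 * j) / 2 - j * ln W + j ^ 3 / (6 * W\<^sup>2)
    = W / 2 * ((1 + y) * ln (1 + y) - (1 - y) * ln (1 - y) - 2 * y + y ^ 3 / 3)"
    unfolding l using assms by (simp add: j field_simps power3_eq_cube power2_eq_square)
  also have "\<bar>\<dots>\<bar> \<le> W / 2 * y ^ 5"
    unfolding abs_mult using entropy_difference[OF y] assms by (intro mult_mono) auto
  also have "\<dots> = j ^ 5 / (2 * W ^ 4)" using assms by (simp add: y_def power_divide field_simps eval_nat_numeral)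
  finally show ?thesis .
qed

text \<open>The comparison term is half the integral of \<open>ln\<close> from \<open>0\<close> to \<open>J (J + 1)\<close>. The shift \<open>1/6\<close>
  reproduces the correction term of \<open>entropy_increment\<close>, and the error of the \<open>j\<close>-th step is at most
  \<open>1 / j\<^sup>3\<close>; it is bounded by \<open>1 / (j - 1) - 1 / j\<close> in order to telescope.\<close>

lemma sum_ln_north:
  "\<bar>(\<Sum>j=1..J. real j * ln ((real j)\<^sup>2 - 1/6)) - (real (J * (J + 1)) * ln (real (J * (J + 1))) - real (J * (J + 1))) / 2\<bar>
   \<le> 5"
proof -
  define G where "G v = (v * ln v - v) / 2" for v :: real
  define D where "D J = (\<Sum>j=1..J. real j * ln ((real j)\<^sup>2 - 1/6)) - G (real (J * (J + 1)))" for J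
  have step: "\<bar>D j - D (j - 1)\<bar> \<le> 1 / real (j - 1) - 1 / real j" if "j \<ge> 2" for j
  proof -
    define x where "x = real j"
    have x: "x \<ge> 2" "real (j - 1) = x - 1" using that by (auto simp: x_def)
    have j1: "{1..j} = insert j {1..j-1}" using that by auto
    have "D j - D (j - 1) = x * ln (x\<^sup>2 - 1/6) - (G (x\<^sup>2 + x) - G (x\<^sup>2 - x))"
      using that x unfolding D_def j1 by (simp add: x_def power2_eq_square algebra_simps of_nat_diff)
    also have "G (x\<^sup>2 + x) - G (x\<^sup>2 - x) = ((x\<^sup>2 + x) * ln (x\<^sup>2 + x) - (x\<^sup>2 - x) * ln (x\<^sup>2 - x) - 2 * x) / 2"
      by (simp add: G_def field_simps)
    finally have d: "D j - D (j - 1) = x * ln (x\<^sup>2 - 1/6) - ((x\<^sup>2 + x) * ln (x\<^sup>2 + x) - (x\<^sup>2 - x) * ln (x\<^sup>2 - x) - 2 * x) / 2" .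
    have W: "x\<^sup>2 \<le> (x\<^sup>2)\<^sup>2 / 2"
    proof -
      have "4 \<le> x\<^sup>2" using x power_mono[of 2 x 2] by simp
      then have "x\<^sup>2 * 2 \<le> x\<^sup>2 * x\<^sup>2" by (intro mult_left_mono) auto
      then show ?thesis by (simp add: power2_eq_square)
    qed
    have e: "\<bar>((x\<^sup>2 + x) * ln (x\<^sup>2 + x) - (x\<^sup>2 - x) * ln (x\<^sup>2 - x) - 2 * x) / 2 - x * ln (x\<^sup>2) + x ^ 3 / (6 * (x\<^sup>2)\<^sup>2)\<bar>
       \<le> x ^ 5 / (2 * (x\<^sup>2) ^ 4)"
      using x W by (intro entropy_increment) auto
    have e1: "x ^ 3 / (6 * (x\<^sup>2)\<^sup>2) = 1 / (6 * x)" "x ^ 5 / (2 * (x\<^sup>2) ^ 4) = 1 / (2 * x ^ 3)"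
      using x by (simp_all add: field_simps eval_nat_numeral)
    define s where "s = 1 / (6 * x\<^sup>2)"
    have "4 \<le> x\<^sup>2" using x power_mono[of 2 x 2] by simp
    then have "1 / (6 * x\<^sup>2) \<le> 1/2" by (subst pos_divide_le_eq) auto
    then have s: "0 \<le> s" "s \<le> 1/2" by (simp_all only: s_def) simp
    have "x\<^sup>2 - 1/6 = x\<^sup>2 * (1 - s)" using x by (simp add: s_def field_simps)
    then have l: "ln (x\<^sup>2 - 1/6) = ln (x\<^sup>2) + ln (1 - s)" using x s by (simp add: ln_mult)
    have "\<bar>ln (1 - s) + s\<bar> \<le> 2 * s\<^sup>2" using ln_one_minus_bounds[OF s] s by auto
    then have "x * \<bar>ln (1 - s) + s\<bar> \<le> x * (2 * s\<^sup>2)" using x by (intro mult_left_mono) auto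
    then have "\<bar>x * (ln (1 - s) + s)\<bar> \<le> x * (2 * s\<^sup>2)" using x by (simp add: abs_mult)
    moreover have "x * s = 1 / (6 * x)" "x * (2 * s\<^sup>2) = 1 / (18 * x ^ 3)"
      using x by (simp_all add: s_def field_simps eval_nat_numeral)
    ultimately have "\<bar>x * ln (x\<^sup>2 - 1/6) - x * ln (x\<^sup>2) + 1 / (6 * x)\<bar> \<le> 1 / (18 * x ^ 3)"
      unfolding l by (simp add: algebra_simps)
    then have "\<bar>D j - D (j - 1)\<bar> \<le> 1 / (18 * x ^ 3) + 1 / (2 * x ^ 3)"
      using e unfolding d e1 by linarith
    also have "\<dots> \<le> 1 / x ^ 3" using x by (simp add: field_simps)
    also have "\<dots> \<le> 1 / ((x - 1) * x)"
    proof (rule divide_left_mono)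
      have "(x - 1) * x \<le> x * x" using x by (intro mult_right_mono) auto
      also have "\<dots> \<le> x * x * x" using x by simp
      finally show "(x - 1) * x \<le> x ^ 3" by (simp add: power3_eq_cube)
    qed (use x in auto)
    also have "\<dots> = 1 / (x - 1) - 1 / x" using x by (simp add: field_simps)
    finally show ?thesis unfolding x(2) unfolding x_def .
  qed
  have D1: "\<bar>D 1\<bar> \<le> 3"
  proof -
    have D: "D 1 = ln (5/6) - ln 2 + 1" by (simp add: D_def G_def field_simps)
    have "ln (5/6 :: real) = - ln (6/5)" by (simp add: ln_div)
    then have "ln (5/6 :: real) \<ge> - 1" using ln_le_minus_one[of "6/5::real"] by simp
    moreover have "ln (5/6 :: real) \<le> 0" by simp
    moreover have "0 \<le> ln (2::real)" "ln (2::real) \<le> 1" using ln_le_minus_one[of 2] by auto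
    ultimately show ?thesis unfolding D by linarith
  qed
  have bd: "\<bar>D J\<bar> \<le> 4 - 1 / real J" if "J \<ge> 1" for J
    using that
  proof (induction J rule: nat_induct_at_least)
    case base
    then show ?case using D1 by simp
  next
    case (Suc n)
    then show ?case using step[of "Suc n"] by simp
  qed
  have "\<bar>D J\<bar> \<le> 5"
  proof (cases "J = 0")
    case True
    then show ?thesis by (simp add: D_def G_def)
  next
    case False
    moreover have "0 \<le> 1 / real J" by simp
    ultimately show ?thesis using bd[of J] by linarith
  qed
  then show ?thesis by (simp add: D_def G_def)
qed

text \<open>Here the logarithm is taken of the distance to the far pole, and each step costs only \<open>j / N\<close>. The
  comparison term is \<open>N / 2\<close> times the integral of \<open>ln (2 - u)\<close> from \<open>0\<close> to \<open>J (J + 1) / N\<close>.\<close>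

lemma sum_ln_far:
  assumes N: "real (K * (K + 1)) \<le> N" and N0: "0 < N" and J: "J \<le> K"
  shows "\<bar>(\<Sum>j=1..J. real j * ln (2 - ((real j)\<^sup>2 - 1/6) / N))
     - (2 * N * ln 2 - (2 * N - real (J * (J + 1))) * ln (2 - real (J * (J + 1)) / N) - real (J * (J + 1))) / 2\<bar> \<le> 1"
proof -
  define G where "G v = (2 * N * ln 2 - (2 * N - v) * ln (2 - v / N) - v) / 2" for v :: real
  define D where "D J = (\<Sum>j=1..J. real j * ln (2 - ((real j)\<^sup>2 - 1/6) / N)) - G (real (J * (J + 1)))" for J
  have step: "\<bar>D j - D (j - 1)\<bar> \<le> real j / N" if "1 \<le> j" "j \<le> K" for j
  proof -
    define x where "x = real j"
    define W where "W = 2 * N - x\<^sup>2"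
    have x1: "x \<ge> 1" using that by (simp add: x_def)
    have "j * (j + 1) \<le> K * (K + 1)" using that by (intro mult_mono) auto
    then have "real (j * (j + 1)) \<le> N" using N by linarith
    then have xN: "x\<^sup>2 + x \<le> N" by (simp add: x_def power2_eq_square algebra_simps)
    have x2: "x\<^sup>2 \<ge> x" using x1 by (simp add: power2_eq_square)
    have W: "N \<le> W" "x < W" "2 * x \<le> W" using xN x1 x2 by (auto simp: W_def)
    have "(2 * x)\<^sup>2 \<le> W\<^sup>2" using W x1 by (intro power_mono) auto
    then have "4 * x\<^sup>2 \<le> W\<^sup>2" by (simp add: power_mult_distrib)
    then have "x\<^sup>2 \<le> W\<^sup>2 / 2" using zero_le_power2[of x] by linarith
    then have e: "\<bar>((W + x) * ln (W + x) - (W - x) * ln (W - x) - 2 * x) / 2 - x * ln W + x ^ 3 / (6 * W\<^sup>2)\<bar>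
       \<le> x ^ 5 / (2 * W ^ 4)"
      using x1 W N0 by (intro entropy_increment) auto
    have j1: "{1..j} = insert j {1..j-1}" using that by auto
    have "D j - D (j - 1) = x * ln (2 - (x\<^sup>2 - 1/6) / N) - (G (x\<^sup>2 + x) - G (x\<^sup>2 - x))"
      using that unfolding D_def j1 by (simp add: x_def power2_eq_square algebra_simps of_nat_diff)
    also have "G (x\<^sup>2 + x) - G (x\<^sup>2 - x)
      = ((W + x) * ln (W + x) - (W - x) * ln (W - x) - 2 * x) / 2 - x * ln N"
    proof -
      have "2 - (x\<^sup>2 - x) / N = (W + x) / N" "2 - (x\<^sup>2 + x) / N = (W - x) / N"
        using N0 by (simp_all add: W_def field_simps)
      then have l: "ln (2 - (x\<^sup>2 - x) / N) = ln (W + x) - ln N" "ln (2 - (x\<^sup>2 + x) / N) = ln (W - x) - ln N"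
        using W N0 x1 by (simp_all add: ln_div)
      have w: "2 * N - (x\<^sup>2 - x) = W + x" "2 * N - (x\<^sup>2 + x) = W - x" by (simp_all add: W_def)
      show ?thesis unfolding G_def l w by (simp add: field_simps)
    qed
    also have "x * ln (2 - (x\<^sup>2 - 1/6) / N) = x * ln W + x * ln (1 + 1 / (6 * W)) - x * ln N"
    proof -
      have "2 - (x\<^sup>2 - 1/6) / N = W * (1 + 1 / (6 * W)) / N"
        using N0 W by (simp add: W_def field_simps)
      moreover have "0 < 1 + 1 / (6 * W)" using W N0 by (intro add_pos_nonneg) auto
      ultimately have "ln (2 - (x\<^sup>2 - 1/6) / N) = ln W + ln (1 + 1 / (6 * W)) - ln N"
        using W N0 by (simp only:) (subst ln_divide_pos, simp_all add: ln_mult_pos)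
      then show ?thesis by (simp only: right_diff_distrib distrib_left)
    qed
    finally have d: "D j - D (j - 1) = x * ln (1 + 1 / (6 * W)) - 
       (((W + x) * ln (W + x) - (W - x) * ln (W - x) - 2 * x) / 2 - x * ln W)" by simp
    have l0: "0 \<le> x * ln (1 + 1 / (6 * W))" using x1 W N0 by simp
    have "x * ln (1 + 1 / (6 * W)) \<le> x * (1 / (6 * W))"
      using x1 W N0 by (intro mult_left_mono ln_add_one_self_le_self) auto
    also have "\<dots> \<le> x / (6 * N)" using x1 W N0 by (simp add: frac_le)
    finally have l1: "x * ln (1 + 1 / (6 * W)) \<le> x / (6 * N)" .
    have "x\<^sup>2 \<le> N" using xN x1 by simp
    then have xW: "x\<^sup>2 \<le> W" using W by simp
    have "x ^ 3 / (6 * W\<^sup>2) = x / (6 * W) * (x\<^sup>2 / W)" by (simp add: eval_nat_numeral)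
    also have "\<dots> \<le> x / (6 * W) * 1" using xW W N0 x1 by (intro mult_left_mono) auto
    also have "\<dots> \<le> x / (6 * N)" using x1 W N0 by (simp add: frac_le)
    finally have c1: "x ^ 3 / (6 * W\<^sup>2) \<le> x / (6 * N)" .
    have "x ^ 5 / (2 * W ^ 4) = x / (2 * W) * (x\<^sup>2 / W) * (x\<^sup>2 / W) * (1 / W)" by (simp add: eval_nat_numeral)
    also have "\<dots> \<le> x / (2 * W) * 1 * 1 * 1" using xW W N0 x1 by (intro mult_mono) auto
    also have "\<dots> \<le> x / (2 * N)" using x1 W N0 by (simp add: frac_le)
    finally have c2: "x ^ 5 / (2 * W ^ 4) \<le> x / (2 * N)" .
    have c3: "0 \<le> x ^ 3 / (6 * W\<^sup>2)" using x1 by simp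
    have "\<bar>D j - D (j - 1)\<bar> \<le> x / (6 * N) + x / (6 * N) + x / (2 * N)"
      using e c1 c2 c3 l0 l1 unfolding d by linarith
    also have "\<dots> \<le> x / N" using N0 x1 by (simp add: field_simps)
    finally show ?thesis unfolding x_def .
  qed
  have "J \<le> K \<Longrightarrow> \<bar>D J\<bar> \<le> real (J * (J + 1)) / N"
  proof (induction J)
    case 0
    show ?case by (simp add: D_def G_def)
  next
    case (Suc n)
    have "\<bar>D (Suc n)\<bar> \<le> \<bar>D n\<bar> + \<bar>D (Suc n) - D n\<bar>" by simp
    also have "\<dots> \<le> real (n * (n + 1)) / N + real (Suc n) / N" using Suc step[of "Suc n"] by (intro add_mono) auto
    also have "\<dots> \<le> real (Suc n * (Suc n + 1)) / N"
      unfolding add_divide_distrib[symmetric] using N0 by (intro divide_right_mono) (auto simp: algebra_simps)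
    finally show ?case .
  qed
  also have "real (J * (J + 1)) / N \<le> 1"
  proof -
    have "J * (J + 1) \<le> K * (K + 1)" using J by (intro mult_mono) auto
    then have "real (J * (J + 1)) \<le> N" using N by linarith
    then show ?thesis using N0 by simp
  qed
  finally show ?thesis using J by (simp add: D_def G_def)
qed

lemma sum_real_interval: "(\<Sum>j=1..J. real j) = real (J * (J + 1)) / 2"
  by (induction J) (auto simp: field_simps)

text \<open>When \<open>p\<close> moves inside its band, the dependence on its height is through the concave function
  \<open>V / 2 ln u + (N - V / 2) ln (2 - u)\<close>, whose maximum is at the upper edge \<open>u = V / N\<close> of the band.
  Its second derivative there has the order of \<open>N\<^sup>2 / V\<close>, and the band has width \<open>2 r / N\<close>, so the
  function varies by \<open>O(r\<^sup>2 / V) = O(1)\<close>. Tangent-line bounds for \<open>ln\<close> replace second derivatives.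
  In the topmost band \<open>V = 0\<close>, and the function is just \<open>N ln (2 - u)\<close> with \<open>N u \<le> 6\<close>.\<close>

lemma split_potential_near_max:
  fixes N V u r :: real
  assumes N: "0 < N" and V: "0 \<le> V" "V / N \<le> u" "u \<le> (V + 2 * r) / N" "u \<le> 1"
    and r: "0 \<le> r" "V = 0 \<Longrightarrow> r \<le> 3" "r\<^sup>2 \<le> 18 * V \<or> V = 0"
  shows "\<bar>(V / 2 * ln u + (N - V / 2) * ln (2 - u)) - (V / 2 * ln (V / N) + (N - V / 2) * ln (2 - V / N))\<bar> \<le> 72"
proof (cases "V = 0")
  case True
  have u: "0 \<le> u" "N * u \<le> 6" using V r True N by (auto simp: field_simps)
  have "ln (1 + u / (2 - u)) \<le> u / (2 - u)" using u V by (intro ln_add_one_self_le_self) auto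
  also have "\<dots> \<le> u / 1" using u V by (intro divide_left_mono) auto
  also have "1 + u / (2 - u) = 2 / (2 - u)" using V by (simp add: field_simps)
  finally have "ln 2 - ln (2 - u) \<le> u" using V by (simp add: ln_div)
  then have "N * (ln 2 - ln (2 - u)) \<le> N * u" using N by (intro mult_left_mono) auto
  moreover have "0 \<le> N * (ln 2 - ln (2 - u))" using N u V by (intro mult_nonneg_nonneg) auto
  moreover have "N * (ln 2 - ln (2 - u)) = N * ln 2 - N * ln (2 - u)" by (simp add: algebra_simps)
  ultimately show ?thesis using u True by simp
next
  case False
  define v where "v = V / N"
  have V0: "0 < V" using False V by simp
  have v: "0 < v" "v \<le> u" using V0 N V by (auto simp: v_def)
  have VN: "V = v * N" using N by (simp add: v_def)
  have lnle: "a * (ln y - ln x) \<le> a * ((y - x) / x)" if "0 < x" "0 < y" "0 \<le> a" for a x y :: real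
  proof -
    have "ln (y / x) \<le> y / x - 1" using that by (intro ln_le_minus_one) auto
    then show ?thesis using that by (intro mult_left_mono) (auto simp: ln_div diff_divide_distrib)
  qed
  define f where "f x = V / 2 * ln x + (N - V / 2) * ln (2 - x)" for x
  have c: "0 \<le> V / 2" "0 \<le> N - V / 2" using V N by (auto simp: VN)
  have "f u - f v = V / 2 * (ln u - ln v) + (N - V / 2) * (ln (2 - u) - ln (2 - v))"
    by (simp add: f_def field_simps)
  also have "\<dots> \<le> V / 2 * ((u - v) / v) + (N - V / 2) * (((2 - u) - (2 - v)) / (2 - v))"
    using c v V by (intro add_mono lnle) auto
  also have "\<dots> = 0" using v V unfolding VN by (simp add: field_simps)
  finally have up: "f u - f v \<le> 0" .
  have "f v - f u = V / 2 * (ln v - ln u) + (N - V / 2) * (ln (2 - v) - ln (2 - u))"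
    by (simp add: f_def field_simps)
  also have "\<dots> \<le> V / 2 * ((v - u) / u) + (N - V / 2) * (((2 - v) - (2 - u)) / (2 - u))"
    using c v V by (intro add_mono lnle) auto
  also have "\<dots> = N * (u - v)\<^sup>2 / (u * (2 - u))"
    using v V unfolding VN by (simp add: field_simps power2_eq_square)
  also have "\<dots> \<le> N * (2 * r / N)\<^sup>2 / (v * 1)"
  proof (rule frac_le)
    have "u - v \<le> 2 * r / N" using V by (simp add: v_def add_divide_distrib)
    then show "N * (u - v)\<^sup>2 \<le> N * (2 * r / N)\<^sup>2" using v N by (intro mult_left_mono power_mono) auto
    show "v * 1 \<le> u * (2 - u)" using v V by (intro mult_mono) auto
  qed (use v N in auto)
  also have "\<dots> = 4 * r\<^sup>2 / V" using N v by (simp add: VN field_simps power2_eq_square)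
  also have "\<dots> \<le> 72" using r False V0 by (simp add: field_simps)
  finally have "\<bar>f u - f v\<bar> \<le> 72" using up by simp
  then show ?thesis by (simp add: f_def v_def)
qed

lemma mult_ln_bounds:
  assumes "0 < (x::real)"
  shows "x - 1 \<le> x * ln x" "x * ln x \<le> x * (x - 1)"
proof -
  have "ln (1 / x) \<le> 1 / x - 1" using assms by (intro ln_le_minus_one) auto
  then have "x * (1 - 1 / x) \<le> x * ln x" using assms by (intro mult_left_mono) (auto simp: ln_div)
  then show "x - 1 \<le> x * ln x" using assms by (simp add: right_diff_distrib)
  show "x * ln x \<le> x * (x - 1)" using assms by (intro mult_left_mono ln_le_minus_one) auto
qed

text \<open>The polar parallels occupy the depths up to \<open>1 - d\<close> from either pole, where \<open>d = m / N\<close>. The terms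
  of first order in \<open>d\<close> cancel, and those of second order contribute \<open>O(m\<^sup>2 / N)\<close>. So it is precise
  enough to place the \<open>m\<close> points of the equatorial band at \<open>h = 0\<close>, where \<open>ln (1 - h) = 0\<close>.\<close>

lemma equatorial_gap:
  fixes N m :: real
  assumes N: "0 < N" and m: "0 \<le> m" "m \<le> N" "m\<^sup>2 \<le> 13 * N"
  shows "\<bar>((N - m) * ln ((N - m) / N) - 2 * (N - m) - (N + m) * ln (2 - (N - m) / N)) / 2 + N\<bar> \<le> 7"
proof -
  define d where "d = m / N"
  have d: "0 \<le> d" "d \<le> 1" using m N by (auto simp: d_def)
  have md: "m = d * N" using N by (simp add: d_def)
  have x: "(N - m) / N = 1 - d" "2 - (N - m) / N = 1 + d" using N by (auto simp: md field_simps)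
  have "- d \<le> (1 - d) * ln (1 - d) \<and> (1 - d) * ln (1 - d) \<le> - d + d\<^sup>2"
  proof (cases "d = 1")
    case False
    then show ?thesis using mult_ln_bounds[of "1 - d"] d by (auto simp: algebra_simps power2_eq_square)
  qed auto
  moreover have "d \<le> (1 + d) * ln (1 + d) \<and> (1 + d) * ln (1 + d) \<le> d + d\<^sup>2"
    using mult_ln_bounds[of "1 + d"] d by (auto simp: algebra_simps power2_eq_square)
  ultimately have b: "\<bar>(1 - d) * ln (1 - d) - (1 + d) * ln (1 + d) + 2 * d\<bar> \<le> d\<^sup>2" by (auto simp: abs_le_iff)
  have "((N - m) * ln ((N - m) / N) - 2 * (N - m) - (N + m) * ln (2 - (N - m) / N)) / 2 + N
     = N / 2 * ((1 - d) * ln (1 - d) - (1 + d) * ln (1 + d) + 2 * d)"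
    unfolding x by (simp add: md field_simps)
  also have "\<bar>\<dots>\<bar> \<le> N / 2 * d\<^sup>2" unfolding abs_mult using b N by (intro mult_mono) auto
  also have "\<dots> = m\<^sup>2 / (2 * N)" using N by (simp add: d_def power2_eq_square)
  also have "\<dots> \<le> 7" using m N by (simp add: field_simps)
  finally show ?thesis .
qed

text \<open>Twice the sum of the principal terms of all parallels, for a point at height \<open>1 - u\<close> with \<open>I\<close>
  parallels above its band. The three sums belong to the northern parallels above the
  point, the remaining northern ones and the southern ones; the other terms carry the height of the
  point. After each is replaced by its comparison term, everything that depends on \<open>I\<close> cancels.\<close>

lemma ring_energy:
  fixes K m I N :: nat and u :: real
  defines "n \<equiv> real N" and "V \<equiv> real (I * (I + 1))"
  assumes N: "N = K * (K + 1) + m" and m: "1 \<le> m" "K \<le> m" "m \<le> 3 * K + 2" and I: "I \<le> K"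
    and u: "V / n \<le> u" "u \<le> (V + 2 * real (if I < K then I + 1 else m)) / n" "u \<le> 1"
  shows "\<bar>(\<Sum>j=1..I. real j * ln (2 - ((real j)\<^sup>2 - 1/6) / n)) + V / 2 * ln u
     + (\<Sum>j=I+1..K. real j * ln (((real j)\<^sup>2 - 1/6) / n))
     + (\<Sum>j=1..K. real j * ln (2 - ((real j)\<^sup>2 - 1/6) / n)) + (n - V / 2) * ln (2 - u)
     - (2 * ln 2 - 1) * n\<bar> \<le> 100"
proof -
  define VK where "VK = real (K * (K + 1))"
  define r where "r = (if I < K then I + 1 else m)"
  have "1 \<le> N" using N m by simp
  then have n0: "0 < n" by (simp add: n_def)
  have VKn: "VK \<le> n" "VK = n - real m" by (simp_all add: VK_def n_def N)
  have V0: "0 \<le> V" by (simp add: V_def)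
  have r: "real r \<le> 3 * (real I + 1)" using m I by (auto simp: r_def)
  have b1: "\<bar>(\<Sum>j=1..I. real j * ln (2 - ((real j)\<^sup>2 - 1/6) / n)) - (2 * n * ln 2 - (2 * n - V) * ln (2 - V / n) - V) / 2\<bar> \<le> 1"
    unfolding V_def using sum_ln_far[of K n I] VKn I n0 by (simp add: VK_def)
  have b2: "\<bar>(\<Sum>j=1..K. real j * ln (2 - ((real j)\<^sup>2 - 1/6) / n)) - (2 * n * ln 2 - (2 * n - VK) * ln (2 - VK / n) - VK) / 2\<bar> \<le> 1"
    unfolding VK_def using sum_ln_far[of K n K] VKn n0 by (simp add: VK_def)
  have b3: "(\<Sum>j=I+1..K. real j * ln (((real j)\<^sup>2 - 1/6) / n))
     = (\<Sum>j=1..K. real j * ln ((real j)\<^sup>2 - 1/6)) - (\<Sum>j=1..I. real j * ln ((real j)\<^sup>2 - 1/6)) - (VK - V) / 2 * ln n"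
  proof -
    have s: "{1..K} = {1..I} \<union> {I+1..K}" "{1..I} \<inter> {I+1..K} = {}" using I by auto
    have sp: "(\<Sum>j=1..K. g j) = (\<Sum>j=1..I. g j) + (\<Sum>j=I+1..K. g j)" for g :: "nat \<Rightarrow> real"
      unfolding s(1) using s(2) by (intro sum.union_disjoint) auto
    have "(\<Sum>j=I+1..K. real j * ln (((real j)\<^sup>2 - 1/6) / n))
      = (\<Sum>j=I+1..K. real j * ln ((real j)\<^sup>2 - 1/6) - real j * ln n)"
    proof (rule sum.cong)
      fix j assume "j \<in> {I+1..K}"
      then have "1 \<le> (real j)\<^sup>2" by simp
      then show "real j * ln (((real j)\<^sup>2 - 1/6) / n) = real j * ln ((real j)\<^sup>2 - 1/6) - real j * ln n"
        using n0 by (subst ln_div) (auto simp: algebra_simps)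
    qed simp
    also have "\<dots> = (\<Sum>j=I+1..K. real j * ln ((real j)\<^sup>2 - 1/6)) - (\<Sum>j=I+1..K. real j) * ln n"
      by (simp add: sum_subtractf sum_distrib_right)
    also have "(\<Sum>j=I+1..K. real j) = (VK - V) / 2"
      using sp[of real] unfolding sum_real_interval V_def VK_def by (simp add: field_simps)
    finally show ?thesis using sp[of "\<lambda>j. real j * ln ((real j)\<^sup>2 - 1/6)"] by simp
  qed
  have b4: "\<bar>(\<Sum>j=1..I. real j * ln ((real j)\<^sup>2 - 1/6)) - (V * ln V - V) / 2\<bar> \<le> 5"
    unfolding V_def by (rule sum_ln_north)
  have b5: "\<bar>(\<Sum>j=1..K. real j * ln ((real j)\<^sup>2 - 1/6)) - (VK * ln VK - VK) / 2\<bar> \<le> 5"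
    unfolding VK_def by (rule sum_ln_north)
  have b6: "\<bar>(V / 2 * ln u + (n - V / 2) * ln (2 - u)) - (V / 2 * ln (V / n) + (n - V / 2) * ln (2 - V / n))\<bar> \<le> 72"
  proof (rule split_potential_near_max[where r = "real r"])
    show "u \<le> (V + 2 * real r) / n" using u by (simp add: r_def)
    show "real r \<le> 3" if "V = 0"
    proof -
      have "I = 0" using that unfolding V_def of_nat_eq_0_iff by simp
      then show ?thesis using r by simp
    qed
    show "(real r)\<^sup>2 \<le> 18 * V \<or> V = 0"
    proof (cases "I = 0")
      case False
      then have I1: "1 \<le> real I" by simp
      have "(real r)\<^sup>2 \<le> (3 * (real I + 1))\<^sup>2" using r by (intro power_mono) auto
      also have "\<dots> = 9 * (real I + 1) * (real I + 1)" by (simp add: power2_eq_square algebra_simps)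
      also have "\<dots> \<le> 9 * (real I + 1) * (2 * real I)" using I1 by (intro mult_left_mono) auto
      finally show ?thesis by (simp add: V_def algebra_simps)
    qed (simp add: V_def)
  qed (use n0 V0 u in auto)
  have m2: "(real m)\<^sup>2 \<le> 13 * n"
  proof -
    have "m\<^sup>2 \<le> (3 * K + 2)\<^sup>2" using m by (intro power_mono) auto
    also have "\<dots> \<le> 13 * N" using m unfolding N by (simp add: power2_eq_square algebra_simps)
    finally show ?thesis unfolding n_def by (metis of_nat_le_iff of_nat_mult of_nat_numeral of_nat_power)
  qed
  have b7: "\<bar>(VK * ln (VK / n) - 2 * VK - (2 * n - VK) * ln (2 - VK / n)) / 2 + n\<bar> \<le> 7"
  proof -
    have e: "n - real m = VK" "n + real m = 2 * n - VK" "real m \<le> n" using VKn by (auto simp: n_def N)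
    show ?thesis using equatorial_gap[of n "real m"] n0 m2 unfolding e(1,2) using e(3) by simp
  qed
  have lV: "V * ln (V / n) = V * ln V - V * ln n"
    using V0 n0 by (cases "V = 0") (auto simp: ln_div algebra_simps)
  have lVK: "VK * ln (VK / n) = VK * ln VK - VK * ln n"
    using n0 by (cases "VK = 0") (auto simp: ln_div algebra_simps VK_def simp del: of_nat_mult)
  have tri: "\<bar>a + b - c + d + e + f\<bar> \<le> 100"
    if "\<bar>a\<bar> \<le> 1" "\<bar>b\<bar> \<le> 1" "\<bar>c\<bar> \<le> 5" "\<bar>d\<bar> \<le> 5" "\<bar>e\<bar> \<le> 72" "\<bar>f\<bar> \<le> 7"
    for a b c d e f :: real
    using that by linarith
  have "(\<Sum>j=1..I. real j * ln (2 - ((real j)\<^sup>2 - 1/6) / n)) + V / 2 * ln u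
     + (\<Sum>j=I+1..K. real j * ln (((real j)\<^sup>2 - 1/6) / n))
     + (\<Sum>j=1..K. real j * ln (2 - ((real j)\<^sup>2 - 1/6) / n)) + (n - V / 2) * ln (2 - u)
     - (2 * ln 2 - 1) * n
    = ((\<Sum>j=1..I. real j * ln (2 - ((real j)\<^sup>2 - 1/6) / n)) - (2 * n * ln 2 - (2 * n - V) * ln (2 - V / n) - V) / 2)
    + ((\<Sum>j=1..K. real j * ln (2 - ((real j)\<^sup>2 - 1/6) / n)) - (2 * n * ln 2 - (2 * n - VK) * ln (2 - VK / n) - VK) / 2)
    - ((\<Sum>j=1..I. real j * ln ((real j)\<^sup>2 - 1/6)) - (V * ln V - V) / 2)
    + ((\<Sum>j=1..K. real j * ln ((real j)\<^sup>2 - 1/6)) - (VK * ln VK - VK) / 2)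
    + ((V / 2 * ln u + (n - V / 2) * ln (2 - u)) - (V / 2 * ln (V / n) + (n - V / 2) * ln (2 - V / n)))
    + ((VK * ln (VK / n) - 2 * VK - (2 * n - VK) * ln (2 - VK / n)) / 2 + n)"
    unfolding b3 using lV lVK by (simp add: field_simps)
  then show ?thesis
    using tri[OF b1 b2 b4 b5 b6 b7] by (simp only:)
qed

section \<open>The configuration\<close>

text \<open>With \<open>\<epsilon> = (lo / hi)\<^sup>r\<close> the product lies between \<open>(1 - \<epsilon>) hi\<^sup>r\<close> and \<open>(1 + \<epsilon>) hi\<^sup>r\<close>, and
  \<open>\<epsilon> \<le> exp (- r s / 2)\<close>. The hypothesis \<open>r s \<ge> 1/3\<close> keeps \<open>\<epsilon>\<close> below \<open>9/10\<close>.\<close>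

lemma ring_product_estimate:
  fixes a b lo hi s \<alpha> :: real
  assumes ab: "(a = lo \<and> b = hi) \<or> (a = hi \<and> b = lo)" and lo: "0 \<le> lo" and hi: "0 < hi"
    and le: "lo\<^sup>2 \<le> (1 - s) * hi\<^sup>2" and rs: "1 / 3 \<le> real r * s"
  defines "L \<equiv> cmod (of_real a ^ r - (of_real b * cis \<alpha>) ^ r)"
  shows "\<bar>ln L - real r * ln hi\<bar> \<le> 10 * exp (- (real r * s) / 2)" "hi ^ r / 10 \<le> L"
proof -
  define \<epsilon> where "\<epsilon> = (lo / hi) ^ r"
  have hr: "0 < hi ^ r" using hi by simp
  have e0: "0 \<le> \<epsilon>" using lo hi by (simp add: \<epsilon>_def)
  have "(lo / hi)\<^sup>2 \<le> 1 - s" using le hi by (simp add: power_divide pos_divide_le_eq)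
  also have "\<dots> \<le> exp (- s)" using exp_ge_add_one_self[of "- s"] by simp
  finally have "((lo / hi)\<^sup>2) ^ r \<le> exp (- s) ^ r" by (intro power_mono) auto
  also have "((lo / hi)\<^sup>2) ^ r = \<epsilon>\<^sup>2" by (simp add: \<epsilon>_def flip: power_mult) (simp add: mult.commute)
  also have "exp (- s) ^ r = (exp (- (real r * s) / 2))\<^sup>2" by (simp flip: exp_of_nat_mult exp_double)
  finally have e1: "\<epsilon> \<le> exp (- (real r * s) / 2)" by (rule power2_le_imp_le) simp
  have "exp (- (real r * s) / 2) \<le> exp (- (1/6))" using rs by simp
  also have "\<dots> \<le> 9 / 10"
  proof -
    have "10 / 9 \<le> exp (1 / 6 :: real)" using exp_ge_add_one_self[of "1/6::real"] by linarith
    then show ?thesis by (simp add: exp_minus field_simps)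
  qed
  finally have e2: "\<epsilon> \<le> 9 / 10" using e1 by linarith
  have loe: "lo ^ r = \<epsilon> * hi ^ r" using hi by (simp add: \<epsilon>_def power_divide)
  have na: "cmod (of_real a ^ r) = a ^ r" "cmod ((of_real b * cis \<alpha>) ^ r) = b ^ r"
    using ab lo hi by (auto simp: norm_power norm_mult)
  have "\<bar>a ^ r - b ^ r\<bar> \<le> L"
    unfolding L_def using norm_triangle_ineq3[of "complex_of_real a ^ r" "(of_real b * cis \<alpha>) ^ r"] unfolding na .
  then have L1: "(1 - \<epsilon>) * hi ^ r \<le> L" using ab loe by (auto simp: algebra_simps)
  have "L \<le> a ^ r + b ^ r"
    unfolding L_def using norm_triangle_ineq4[of "complex_of_real a ^ r" "(of_real b * cis \<alpha>) ^ r"] unfolding na .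
  then have L2: "L \<le> (1 + \<epsilon>) * hi ^ r" using ab loe by (auto simp: algebra_simps)
  have "1 / 10 * hi ^ r \<le> (1 - \<epsilon>) * hi ^ r" using e2 hr by (intro mult_right_mono) auto
  then show L3: "hi ^ r / 10 \<le> L" using L1 by simp
  then have L0: "0 < L" using hr by (smt (verit) divide_pos_pos)
  have lnr: "ln (hi ^ r) = real r * ln hi" by (rule ln_realpow)
  have "ln L \<le> ln ((1 + \<epsilon>) * hi ^ r)" using L0 L2 by (intro ln_mono) auto
  also have "\<dots> = ln (1 + \<epsilon>) + real r * ln hi" using e0 hr by (subst ln_mult_pos) (auto simp: lnr)
  also have "ln (1 + \<epsilon>) \<le> \<epsilon>" using e0 by (rule ln_add_one_self_le_self)
  finally have u: "ln L - real r * ln hi \<le> \<epsilon>" by simp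
  have "ln ((1 - \<epsilon>) * hi ^ r) \<le> ln L" using L1 e2 hr by (intro ln_mono mult_pos_pos) auto
  moreover have "ln ((1 - \<epsilon>) * hi ^ r) = ln (1 - \<epsilon>) + real r * ln hi" using e2 hr by (subst ln_mult_pos) (auto simp: lnr)
  moreover have "- (10 * \<epsilon>) \<le> ln (1 - \<epsilon>)"
  proof -
    have "- ln (1 - \<epsilon>) = ln (1 / (1 - \<epsilon>))" using e2 by (simp add: ln_div)
    also have "\<dots> \<le> 1 / (1 - \<epsilon>) - 1" using e2 by (intro ln_le_minus_one) auto
    also have "\<dots> = \<epsilon> / (1 - \<epsilon>)" using e2 by (simp add: field_simps)
    also have "\<dots> \<le> \<epsilon> / (1 / 10)" using e0 e2 by (intro divide_left_mono) auto
    finally show ?thesis by simp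
  qed
  ultimately have "\<bar>ln L - real r * ln hi\<bar> \<le> 10 * \<epsilon>" using u e0 by linarith
  then show "\<bar>ln L - real r * ln hi\<bar> \<le> 10 * exp (- (real r * s) / 2)" using e1 by linarith
qed

lemma exp_quarter_le: "exp (- real k / 4) \<le> (4 / 5) ^ k"
proof -
  have "5 / 4 \<le> exp (1 / 4 :: real)" using exp_ge_add_one_self[of "1/4::real"] by linarith
  then have "exp (- (1/4) :: real) \<le> 4 / 5" by (simp add: exp_minus field_simps)
  then have "exp (- (1/4) :: real) ^ k \<le> (4 / 5) ^ k" by (intro power_mono) auto
  then show ?thesis by (simp flip: exp_of_nat_mult)
qed

lemma exp_half_le_exp_quarter: "x * (1 / 2) \<le> y \<Longrightarrow> exp (- y / 2) \<le> exp (- x / 4)" for x y :: real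
  by simp

lemma sum_four_fifths: "finite S \<Longrightarrow> 0 \<notin> S \<Longrightarrow> (\<Sum>k\<in>S. (4 / 5 :: real) ^ k) \<le> 4"
proof -
  assume "finite S" "0 \<notin> S"
  then have "(\<Sum>k\<in>insert 0 S. (4 / 5 :: real) ^ k) < 1 / (1 - 4 / 5)"
    by (intro geometric_sum_less) auto
  then show ?thesis using \<open>finite S\<close> \<open>0 \<notin> S\<close> by simp
qed

text \<open>The exponent \<open>j (I + 1 - j) / (I + 1)\<close> is at least half of the smaller of \<open>j\<close> and \<open>I + 1 - j\<close>, so
  geometric series from both ends bound the sum uniformly in \<open>I\<close>.\<close>

lemma sum_exp_tent:
  "(\<Sum>j=1..I. exp (- (real j * (real (I + 1 - j) / real (I + 1))) / 2)) \<le> 8"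
proof -
  have "(\<Sum>j=1..I. exp (- (real j * (real (I + 1 - j) / real (I + 1))) / 2))
    \<le> (\<Sum>j=1..I. (4 / 5) ^ j + (4 / 5) ^ (I + 1 - j))"
  proof (rule sum_mono)
    fix j assume j: "j \<in> {1..I}"
    define k where "k = I + 1 - j"
    have jk: "real j + real k = real (I + 1)" using j by (simp add: k_def of_nat_diff)
    have I0: "0 < real (I + 1)" by simp
    consider "j \<le> k" | "k \<le> j" by linarith
    then show "exp (- (real j * (real (I + 1 - j) / real (I + 1))) / 2) \<le> (4 / 5) ^ j + (4 / 5) ^ (I + 1 - j)"
    proof cases
      case 1
      then have "1 / 2 \<le> real k / real (I + 1)" using jk I0 by (simp add: field_simps)
      then have "real j * (1 / 2) \<le> real j * (real k / real (I + 1))" by (intro mult_left_mono) auto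
      then have "exp (- (real j * (real k / real (I + 1))) / 2) \<le> exp (- real j / 4)"
        by (rule exp_half_le_exp_quarter)
      also have "\<dots> \<le> (4 / 5) ^ j" by (rule exp_quarter_le)
      finally show ?thesis unfolding k_def by (rule order_trans) simp
    next
      case 2
      then have "1 / 2 \<le> real j / real (I + 1)" using jk I0 by (simp add: field_simps)
      then have "real k * (1 / 2) \<le> real k * (real j / real (I + 1))" by (intro mult_left_mono) auto
      moreover have "real k * (real j / real (I + 1)) = real j * (real k / real (I + 1))" by simp
      ultimately have "exp (- (real j * (real k / real (I + 1))) / 2) \<le> exp (- real k / 4)"
        by (intro exp_half_le_exp_quarter) (simp only:)
      also have "\<dots> \<le> (4 / 5) ^ k" by (rule exp_quarter_le)
      finally show ?thesis unfolding k_def by (rule order_trans) simp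
    qed
  qed
  also have "\<dots> = (\<Sum>j=1..I. (4 / 5) ^ j) + (\<Sum>j=1..I. (4 / 5 :: real) ^ (I + 1 - j))"
    by (rule sum.distrib)
  also have "(\<Sum>j=1..I. (4 / 5 :: real) ^ (I + 1 - j)) = (\<Sum>j=1..I. (4 / 5) ^ j)"
    by (rule sum.reindex_bij_witness[of _ "\<lambda>j. I + 1 - j" "\<lambda>j. I + 1 - j"]) auto
  finally show ?thesis using sum_four_fifths[of "{1..I}"] by simp
qed

lemma sum_exp_tail:
  "(\<Sum>j=J+1..K. exp (- (real j * (5 / 6 * (real (j - J) / real j))) / 2)) \<le> 4"
proof -
  have "(\<Sum>j=J+1..K. exp (- (real j * (5 / 6 * (real (j - J) / real j))) / 2)) \<le> (\<Sum>j=J+1..K. (4 / 5) ^ (j - J))"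
  proof (rule sum_mono)
    fix j assume "j \<in> {J+1..K}"
    then have "exp (- (real j * (5 / 6 * (real (j - J) / real j))) / 2) \<le> exp (- real (j - J) / 4)"
      by (intro exp_half_le_exp_quarter) simp
    also have "\<dots> \<le> (4 / 5) ^ (j - J)" by (rule exp_quarter_le)
    finally show "exp (- (real j * (5 / 6 * (real (j - J) / real j))) / 2) \<le> (4 / 5) ^ (j - J)" .
  qed
  also have "\<dots> = (\<Sum>k=1..K-J. (4 / 5) ^ k)"
    by (rule sum.reindex_bij_witness[of _ "\<lambda>k. k + J" "\<lambda>j. j - J"]) auto
  also have "\<dots> \<le> 4" by (rule sum_four_fifths) auto
  finally show ?thesis .
qed

lemma sum_symmetric_int_interval:
  fixes g :: "int \<Rightarrow> 'a::comm_monoid_add"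
  shows "(\<Sum>i\<in>{- int K..int K}. g i) = g 0 + (\<Sum>j=1..K. g (int j)) + (\<Sum>j=1..K. g (- int j))"
proof (induction K)
  case (Suc K)
  have "{- int (Suc K)..int (Suc K)} = insert (int (Suc K)) (insert (- int (Suc K)) {- int K..int K})" by auto
  then show ?case using Suc by (simp add: algebra_simps)
qed simp

text \<open>The equatorial ring takes up the points left over by the polar ones; the bounds on \<open>m\<close> make its
  size comparable to \<open>K + 1\<close>, so that its band has the same shape as the others.\<close>

locale ring_parameters =
  fixes K m N :: nat
  assumes N_eq: "N = K * (K + 1) + m" and m1: "1 \<le> m" and Km: "K \<le> m" and mK: "m \<le> 3 * K + 2"
begin

abbreviation n :: real where "n \<equiv> real N"

text \<open>Height of the pole above the \<open>j\<close>-th parallel. It corrects the midpoint \<open>j\<^sup>2 / N\<close> of the band from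
  \<open>j (j - 1) / N\<close> to \<open>j (j + 1) / N\<close> so that \<open>ln\<close> takes nearly its mean value over the band.\<close>

definition depth :: "nat \<Rightarrow> real" where
  "depth j = ((real j)\<^sup>2 - 1/6) / n"

text \<open>The parallels are indexed by \<open>{- K..K}\<close>: positive indices count from the north pole, negative
  ones from the south pole, and \<open>0\<close> is the equator. So the index is \<^emph>\<open>not\<close> monotone in the height, but
  reflection in the equator is negation.\<close>

definition height :: "int \<Rightarrow> real" where
  "height i = (if i = 0 then 0 else if 0 < i then 1 - depth (nat i) else depth (nat (- i)) - 1)"

definition ring_size :: "int \<Rightarrow> nat" where
  "ring_size i = (if i = 0 then m else nat \<bar>i\<bar>)"

definition points :: "(real^3) set" where
  "points = (\<Union>i\<in>{- int K..int K}. latitude_ring (height i) (ring_size i))"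

lemma N1: "1 \<le> N"
  using N_eq m1 by auto

lemma n_pos: "0 < n"
  using N1 by simp

lemma n_ge: "real K * (real K + 2) \<le> n"
proof -
  have "K * (K + 2) \<le> N" using N_eq Km by (simp add: algebra_simps)
  then have "real (K * (K + 2)) \<le> n" by (simp only: of_nat_le_iff)
  then show ?thesis by (simp add: distrib_left)
qed

lemma m_squared_le: "(real m)\<^sup>2 \<le> 13 * n"
proof -
  have "m\<^sup>2 \<le> (3 * K + 2)\<^sup>2" using mK by (intro power_mono) auto
  also have "\<dots> \<le> 13 * N" using m1 Km unfolding N_eq by (simp add: power2_eq_square algebra_simps)
  finally show ?thesis by (metis of_nat_le_iff of_nat_mult of_nat_numeral of_nat_power)
qed

lemma n_le_m_squared: "n \<le> 3 * (real m)\<^sup>2"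
proof -
  have "K * (K + 1) \<le> m * (m + 1)" using Km by (intro mult_mono) auto
  moreover have "m \<le> m * m" using m1 by simp
  moreover have "m * (m + 1) = m * m + m" by simp
  ultimately have "N \<le> 3 * m\<^sup>2" unfolding N_eq power2_eq_square by linarith
  then show ?thesis by (metis of_nat_le_iff of_nat_mult of_nat_numeral of_nat_power)
qed

lemma n_depth: "n * depth j = (real j)\<^sup>2 - 1/6"
  using n_pos by (simp add: depth_def)

lemma depth_bounds:
  assumes "1 \<le> j" "j \<le> K"
  shows "0 < depth j" "depth j < 1"
proof -
  have j: "1 \<le> (real j)\<^sup>2" "(real j)\<^sup>2 \<le> (real K)\<^sup>2" using assms by (auto intro: power_mono)
  have "(real K)\<^sup>2 \<le> n" using n_ge by (simp add: power2_eq_square algebra_simps)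
  then have "(real j)\<^sup>2 - 1/6 < n" using j by linarith
  then show "0 < depth j" "depth j < 1" using j n_pos by (auto simp: depth_def)
qed

lemma depth_strict_mono: "i < j \<Longrightarrow> depth i < depth j"
  using n_pos by (auto simp: depth_def intro!: divide_strict_right_mono power_strict_mono)

lemma height_bound: "i \<in> {- int K..int K} \<Longrightarrow> \<bar>height i\<bar> < 1"
proof -
  assume i: "i \<in> {- int K..int K}"
  have "\<bar>height i\<bar> < 1" if "0 < i"
  proof -
    have "1 \<le> nat i" "nat i \<le> K" using that i by auto
    from depth_bounds[OF this] show ?thesis using that by (simp add: height_def)
  qed
  moreover have "\<bar>height i\<bar> < 1" if "i < 0"
  proof -
    have "1 \<le> nat (- i)" "nat (- i) \<le> K" using that i by auto
    from depth_bounds[OF this] show ?thesis using that by (simp add: height_def)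
  qed
  ultimately show ?thesis by (cases i "0::int" rule: linorder_cases) (auto simp: height_def)
qed

lemma height_minus: "height (- i) = - height i"
  by (auto simp: height_def)

lemma height_pos: "i \<in> {- int K..int K} \<Longrightarrow> 0 < i \<Longrightarrow> 0 < height i"
  using depth_bounds[of "nat i"] by (auto simp: height_def)

lemma height_inj: "inj_on height {- int K..int K}"
proof -
  have pos: "height i \<noteq> height j" if "0 < i" "i < j" for i j
    using that depth_strict_mono[of "nat i" "nat j"] by (auto simp: height_def)
  have sign: "(0 < height i) = (0 < i)" "(height i < 0) = (i < 0)" if "i \<in> {- int K..int K}" for i
    using that height_pos[of i] height_pos[of "- i"] height_minus[of i] 
    by (cases "i = 0"; cases "0 < i"; force simp: height_def)+
  show ?thesis
  proof (rule inj_onI)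
    fix i j assume ij: "i \<in> {- int K..int K}" "j \<in> {- int K..int K}" and h: "height i = height j"
    consider "i = 0" | "0 < i" | "i < 0" by linarith
    then show "i = j"
    proof cases
      case 1
      then show ?thesis using sign[OF ij(1)] sign[OF ij(2)] h by auto
    next
      case 2
      then have "0 < j" using sign[OF ij(1)] sign[OF ij(2)] h by auto
      then show ?thesis using pos[of i j] pos[of j i] h 2 by (cases i j rule: linorder_cases) auto
    next
      case 3
      then have "j < 0" using sign[OF ij(1)] sign[OF ij(2)] h by auto
      then show ?thesis using pos[of "- i" "- j"] pos[of "- j" "- i"] h 3 
        by (cases i j rule: linorder_cases) (auto simp: height_minus)
    qed
  qed
qed

lemma ring_size_pos: "1 \<le> ring_size i"
  using m1 by (auto simp: ring_size_def)

lemma rings_disjoint: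
  assumes "i \<in> {- int K..int K}" "j \<in> {- int K..int K}" "i \<noteq> j"
  shows "latitude_ring (height i) (ring_size i) \<inter> latitude_ring (height j) (ring_size j) = {}"
proof -
  have "height i \<noteq> height j" using assms height_inj unfolding inj_on_def by blast
  then show ?thesis by (metis disjoint_iff latitude_ring_height)
qed

lemma finite_points: "finite points"
  unfolding points_def using ring_size_pos by (auto intro!: finite_latitude_ring)

lemma prod_points: "(\<Prod>q\<in>points. f q) = (\<Prod>i\<in>{- int K..int K}. \<Prod>q\<in>latitude_ring (height i) (ring_size i). f q)"
  unfolding points_def using ring_size_pos rings_disjoint
  by (intro prod.UNION_disjoint) (auto intro!: finite_latitude_ring)

lemma card_points: "card points = N"
proof -
  have "card points = (\<Sum>i\<in>{- int K..int K}. card (latitude_ring (height i) (ring_size i)))"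
    unfolding points_def using ring_size_pos rings_disjoint
    by (intro card_UN_disjoint) (auto intro!: finite_latitude_ring)
  also have "\<dots> = (\<Sum>i\<in>{- int K..int K}. ring_size i)"
    using ring_size_pos height_bound by (intro sum.cong card_latitude_ring) auto
  also have "\<dots> = m + 2 * (\<Sum>j=1..K. j)"
    unfolding sum_symmetric_int_interval by (simp add: ring_size_def)
  also have "2 * (\<Sum>j=1..K. j) = K * (K + 1)" by (induction K) auto
  finally show ?thesis by (simp add: N_eq)
qed

lemma points_subset_sphere: "points \<subseteq> sphere 0 1"
proof
  fix x assume "x \<in> points"
  then obtain i \<alpha> where "i \<in> {- int K..int K}" "x = sphere_point (height i) \<alpha>"
    unfolding points_def latitude_ring_def by blast
  then show "x \<in> sphere 0 1" using height_bound[of i] sphere_point_in_sphere[of "height i" \<alpha>] by simp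
qed

end

lemma pos_if_square_pos: "0 \<le> x \<Longrightarrow> 0 < x\<^sup>2 \<Longrightarrow> 0 < x" for x :: real
  by (cases "x = 0") auto

section \<open>The parallels away from a given point\<close>

text \<open>A point of the northern hemisphere below exactly \<open>I\<close> complete bands. For \<open>I = K\<close> it lies in the
  northern half of the equatorial band.\<close>

locale northern_point = ring_parameters +
  fixes I :: nat and t \<alpha> :: real
  assumes I_le: "I \<le> K" and t0: "0 \<le> t" and t1: "t \<le> 1"
    and band_lower: "real (I * (I + 1)) / n \<le> 1 - t"
    and band_upper: "1 - t \<le> (real (I * (I + 1)) + 2 * real (if I < K then I + 1 else m)) / n"
begin

text \<open>The parallel whose band contains the point.\<close>

definition active :: int where
  "active = (if I < K then int (I + 1) else 0)"

text \<open>For \<open>i \<noteq> active\<close> this is the larger of the two chords, hence the exponential of the mean of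
  \<open>ln \<bar>p - q\<bar>\<close> over the whole parallel. For the active parallel it is the chord that
  does not vanish when the point is the pole.\<close>

definition potential :: "int \<Rightarrow> real" where
  "potential i = (if 0 < i \<and> i \<le> int I then chord t (height i) else chord (height i) t)"

text \<open>A lower bound for \<open>1 - (min a b / max a b)\<^sup>2\<close> on an inactive parallel. The product with the size
  of the ring is what enters the estimates. For northern rings below the point it is proportional to
  the number of bands in between; for the rings above the point it has the order of the number of
  steps to the pole or to the point, whichever is smaller, and likewise for the southern rings with
  the equator in place of the point.\<close>

definition decay :: "int \<Rightarrow> real" where
  "decay i = (if i = 0 then 1 / (real K + 2)
     else if i < 0 then real (K + 1 - nat (- i)) / real (K + 1)
     else if i \<le> int I then real (I + 1 - nat i) / real (I + 1)
     else 5 / 6 * (real (nat i - (I + 1)) / real (nat i)))"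

abbreviation ring :: "int \<Rightarrow> (real^3) set" where
  "ring i \<equiv> latitude_ring (height i) (ring_size i)"

abbreviation p :: "real^3" where
  "p \<equiv> sphere_point t \<alpha>"

lemma t_abs: "\<bar>t\<bar> \<le> 1" using t0 t1 by simp

lemma chord_squares:
  assumes "i \<in> {- int K..int K}"
  shows "(chord (height i) t)\<^sup>2 = (1 - height i) * (1 + t)" "(chord t (height i))\<^sup>2 = (1 - t) * (1 + height i)"
  using height_bound[OF assms] t_abs by (simp_all add: chord_squared)

lemma chords_nonneg:
  assumes "i \<in> {- int K..int K}"
  shows "0 \<le> chord (height i) t" "0 \<le> chord t (height i)"
  using height_bound[OF assms] t_abs by simp_all

lemma above_le:
  assumes "1 \<le> j" "j \<le> I"
  shows "depth j \<le> real j / real (I + 1) * (1 - t)"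
proof -
  have "real (I * (I + 1)) \<le> n * (1 - t)" using band_lower n_pos by (simp add: pos_divide_le_eq mult.commute)
  then have "real j / real (I + 1) * real (I * (I + 1)) \<le> real j / real (I + 1) * (n * (1 - t))"
    by (intro mult_left_mono) auto
  moreover have "real j / real (I + 1) * real (I * (I + 1)) = real j * real I" by (simp add: field_simps)
  moreover have "real j * real j \<le> real j * real I" using assms by (intro mult_left_mono) auto
  ultimately have "n * depth j \<le> n * (real j / real (I + 1) * (1 - t))"
    unfolding n_depth power2_eq_square by (simp only: mult_ac)
  then show ?thesis using n_pos by (simp only: mult_le_cancel_left_pos)
qed

lemma below_le:
  assumes "I + 2 \<le> j" "j \<le> K"
  shows "1 - t \<le> (1 - 5 / 6 * (real (j - (I + 1)) / real j)) * depth j"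
proof -
  define J where "J = real (I + 1)"
  define x where "x = real j"
  have x: "1 \<le> J" "J + 1 \<le> x" "real (j - (I + 1)) = x - J" using assms by (auto simp: J_def x_def of_nat_diff)
  have "I < K" using assms by simp
  then have "n * (1 - t) \<le> J * (J + 1)" using band_upper n_pos by (simp add: J_def field_simps)
  moreover have "6 * x * (J * (J + 1)) \<le> (x + 5 * J) * (x\<^sup>2 - 1/6)"
  proof -
    have "6 * x * (J * (J + 1)) \<le> 6 * x * (J * x)" using x by (intro mult_left_mono) auto
    moreover have "x\<^sup>2 * 1 \<le> x\<^sup>2 * (x - J)" using x by (intro mult_left_mono) auto
    moreover have "x * 1 \<le> x * x" using x by (intro mult_left_mono) auto
    moreover have "6 * x * (J * x) = 6 * (J * (x * x))" "x\<^sup>2 * (x - J) = x * (x * x) - J * (x * x)"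
      "(x + 5 * J) * (x\<^sup>2 - 1/6) = x * (x * x) + 5 * (J * (x * x)) - x / 6 - 5 * J / 6"
      by (simp_all add: field_simps power2_eq_square)
    ultimately show ?thesis using x by (simp only: power2_eq_square)
  qed
  then have "J * (J + 1) \<le> (1 - 5 / 6 * ((x - J) / x)) * (x\<^sup>2 - 1/6)"
    using x by (simp add: field_simps)
  moreover have "(1 - 5 / 6 * ((x - J) / x)) * (x\<^sup>2 - 1/6) = n * ((1 - 5 / 6 * ((x - J) / x)) * depth j)"
    using n_depth[of j] unfolding x_def by (metis mult.left_commute)
  ultimately have "n * (1 - t) \<le> n * ((1 - 5 / 6 * ((x - J) / x)) * depth j)" by linarith
  then have "1 - t \<le> (1 - 5 / 6 * ((x - J) / x)) * depth j" using n_pos by (simp only: mult_le_cancel_left_pos)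
  then show ?thesis unfolding x(3)[symmetric] by (simp only: x_def)
qed

lemma equator_le:
  assumes "I < K"
  shows "1 - t \<le> 1 - 1 / (real K + 2)"
proof -
  have "n * (1 - t) \<le> real ((I + 1) * (I + 2))" using band_upper n_pos assms by (simp add: field_simps)
  also have "(I + 1) * (I + 2) \<le> K * (K + 1)" using assms by (intro mult_mono) auto
  then have "real ((I + 1) * (I + 2)) \<le> real (K * (K + 1))" by (simp only: of_nat_le_iff)
  also have "\<dots> = (1 - 1 / (real K + 2)) * (real K * (real K + 2))" by (simp add: field_simps)
  also have "\<dots> \<le> (1 - 1 / (real K + 2)) * n" using n_ge by (intro mult_left_mono) (auto simp: field_simps)
  finally show ?thesis using n_pos by (simp add: mult.commute)
qed

lemma south_le:
  assumes "1 \<le> j" "j \<le> K"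
  shows "depth j \<le> 1 - real (K + 1 - j) / real (K + 1)"
proof -
  have e: "1 - real (K + 1 - j) / real (K + 1) = real j / real (K + 1)" using assms by (simp add: of_nat_diff field_simps)
  have "real j * real j \<le> real j * real K" using assms by (intro mult_left_mono) auto
  also have "\<dots> \<le> real j * (real K * (real K + 2) / real (K + 1))"
    by (intro mult_left_mono) (auto simp: field_simps)
  also have "\<dots> = real j / real (K + 1) * (real K * (real K + 2))" by simp
  also have "\<dots> \<le> real j / real (K + 1) * n" using n_ge by (intro mult_left_mono) auto
  finally have "n * depth j \<le> n * (real j / real (K + 1))" unfolding n_depth power2_eq_square by (simp add: mult.commute)
  then show ?thesis unfolding e using n_pos by (simp only: mult_le_cancel_left_pos)
qed

lemma tent_ge: "1 \<le> j \<Longrightarrow> j \<le> L \<Longrightarrow> 1 / 3 \<le> real j * (real (L + 1 - j) / real (L + 1))" for j L :: nat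
proof -
  assume j: "1 \<le> j" "j \<le> L"
  have "0 \<le> (real j - 1) * (real L - real j)" using j by (intro mult_nonneg_nonneg) auto
  then have "real L \<le> real j * real (L + 1 - j)" using j by (simp add: of_nat_diff algebra_simps)
  then have "real L / real (L + 1) \<le> real j * (real (L + 1 - j) / real (L + 1))" 
    unfolding times_divide_eq_right by (intro divide_right_mono) auto
  moreover have "1 / 3 \<le> real L / real (L + 1)" using j by (simp add: field_simps)
  ultimately show ?thesis by linarith
qed

text \<open>The squared ratio of the chords is \<open>v (2 - u) / ((2 - v) u)\<close> or its inverse, where \<open>u\<close> and \<open>v\<close>
  are the depths below the north pole of the point and of the ring. It is at most \<open>v / u\<close> for rings
  above the point and \<open>u / v\<close> for northern rings below it and the equator, and at most the height above the south pole
  for southern rings; these quantities are bounded by the preceding lemmas.\<close>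

lemma inactive_chords:
  assumes i: "i \<in> {- int K..int K}" "i \<noteq> active"
  obtains lo where "(chord (height i) t = lo \<and> chord t (height i) = potential i)
      \<or> (chord (height i) t = potential i \<and> chord t (height i) = lo)"
    "0 \<le> lo" "0 < potential i" "lo\<^sup>2 \<le> (1 - decay i) * (potential i)\<^sup>2" "1 / 3 \<le> real (ring_size i) * decay i"
proof -
  consider (above) "0 < i" "i \<le> int I" | (below) "int I + 2 \<le> i" | (equator) "i = 0" "I < K" | (south) "i < 0"
  proof -
    have A: "I < K \<longrightarrow> i \<noteq> int I + 1" "\<not> I < K \<longrightarrow> i \<noteq> 0" using i(2) by (auto simp: active_def split: if_splits)
    show ?thesis
    proof (cases i "0::int" rule: linorder_cases)
      case less
      then show ?thesis by (rule that(4))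
    next
      case equal
      then show ?thesis using A by (intro that(3)) auto
    next
      case greater
      show ?thesis
      proof (cases "i \<le> int I")
        case True
        then show ?thesis using greater by (intro that(1))
      next
        case False
        then have "I < K" using i(1) by simp
        then show ?thesis using False A by (intro that(2)) linarith
      qed
    qed
  qed
  then show ?thesis
  proof cases
    case above
    define j where "j = nat i"
    have j: "i = int j" "1 \<le> j" "j \<le> I" using above by (auto simp: j_def)
    have jK: "j \<le> K" using j I_le by simp
    have h: "height i = 1 - depth j" using j by (simp add: height_def)
    have wj: "0 < depth j" "depth j < 1" using depth_bounds[of j] j jK by auto
    have d: "1 - decay i = real j / real (I + 1)" using j by (simp add: decay_def of_nat_diff field_simps)
    have le: "depth j \<le> real j / real (I + 1) * (1 - t)" using above_le j by simp
    also have "\<dots> \<le> 1 * (1 - t)" using j t1 by (intro mult_right_mono) auto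
    finally have wu: "depth j \<le> 1 - t" by simp
    have u: "0 < 1 - t" using wu wj by simp
    have pot: "potential i = chord t (height i)" using above by (simp add: potential_def)
    have "(chord (height i) t)\<^sup>2 = depth j * (1 + t)" using chord_squares[OF i(1)] by (simp add: h)
    also have "\<dots> \<le> (real j / real (I + 1) * (1 - t)) * (2 - depth j)"
      using le wu wj t0 t1 by (intro mult_mono) auto
    also have "\<dots> = (1 - decay i) * (potential i)\<^sup>2" using chord_squares[OF i(1)] by (simp add: pot d h)
    finally have q: "(chord (height i) t)\<^sup>2 \<le> (1 - decay i) * (potential i)\<^sup>2" .
    have "0 < (potential i)\<^sup>2" unfolding pot chord_squares[OF i(1)] unfolding h using u wj by (intro mult_pos_pos) auto
    then have "0 < potential i" using chords_nonneg[OF i(1)] pos_if_square_pos unfolding pot by simp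
    moreover have "1 / 3 \<le> real (ring_size i) * decay i"
      using tent_ge[of j I] j by (simp add: ring_size_def decay_def)
    ultimately show ?thesis
      by (rule that[OF disjI1[OF conjI[OF refl pot[symmetric]]] chords_nonneg(1)[OF i(1)] _ q])
  next
    case below
    define j where "j = nat i"
    have j: "i = int j" "I + 2 \<le> j" "j \<le> K" using below i by (auto simp: j_def)
    have h: "height i = 1 - depth j" using j by (simp add: height_def)
    have wj: "0 < depth j" "depth j < 1" using depth_bounds[of j] j by auto
    have d: "decay i = 5 / 6 * (real (j - (I + 1)) / real j)" using j by (simp add: decay_def)
    have d0: "0 \<le> decay i" "decay i \<le> 1" unfolding d using j by (auto simp: of_nat_diff field_simps)
    have le: "1 - t \<le> (1 - decay i) * depth j" unfolding d by (rule below_le[OF j(2,3)])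
    also have "\<dots> \<le> 1 * depth j" using d0 wj by (intro mult_right_mono) auto
    finally have wu: "1 - t \<le> depth j" by simp
    have pot: "potential i = chord (height i) t" using j by (simp add: potential_def)
    have "(chord t (height i))\<^sup>2 = (1 - t) * (2 - depth j)" using chord_squares[OF i(1)] by (simp add: h)
    also have "\<dots> \<le> ((1 - decay i) * depth j) * (1 + t)" using le wu wj t0 t1 d0 by (intro mult_mono) auto
    also have "\<dots> = (1 - decay i) * (potential i)\<^sup>2" using chord_squares[OF i(1)] by (simp add: pot h)
    finally have q: "(chord t (height i))\<^sup>2 \<le> (1 - decay i) * (potential i)\<^sup>2" .
    have "0 < (potential i)\<^sup>2" unfolding pot chord_squares[OF i(1)] unfolding h using t0 wj by (intro mult_pos_pos) auto
    then have "0 < potential i" using chords_nonneg[OF i(1)] pos_if_square_pos unfolding pot by simp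
    moreover have "1 / 3 \<le> real (ring_size i) * decay i"
      unfolding d using j by (simp add: ring_size_def of_nat_diff)
    ultimately show ?thesis
      by (rule that[OF disjI2[OF conjI[OF pot[symmetric] refl]] chords_nonneg(2)[OF i(1)] _ q])
  next
    case equator
    have h: "height i = 0" using equator by (simp add: height_def)
    have pot: "potential i = chord (height i) t" using equator by (simp add: potential_def)
    have d: "decay i = 1 / (real K + 2)" using equator by (simp add: decay_def)
    have d1: "0 \<le> 1 - decay i" by (simp add: d)
    have "(chord t (height i))\<^sup>2 = 1 - t" using chord_squares[OF i(1)] by (simp add: h)
    also have "\<dots> \<le> (1 - decay i) * 1" using equator_le equator d by simp
    also have "\<dots> \<le> (1 - decay i) * (1 + t)" using t0 d1 by (intro mult_left_mono) auto
    also have "\<dots> = (1 - decay i) * (potential i)\<^sup>2" using chord_squares[OF i(1)] by (simp add: pot h)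
    finally have q: "(chord t (height i))\<^sup>2 \<le> (1 - decay i) * (potential i)\<^sup>2" .
    have "0 < (potential i)\<^sup>2" unfolding pot chord_squares[OF i(1)] unfolding h using t0 by simp
    then have "0 < potential i" using chords_nonneg[OF i(1)] pos_if_square_pos unfolding pot by simp
    moreover have "1 / 3 \<le> real (ring_size i) * decay i"
      unfolding d using equator m1 Km by (simp add: ring_size_def field_simps)
    ultimately show ?thesis
      by (rule that[OF disjI2[OF conjI[OF pot[symmetric] refl]] chords_nonneg(2)[OF i(1)] _ q])
  next
    case south
    define j where "j = nat (- i)"
    have j: "i = - int j" "1 \<le> j" "j \<le> K" using south i by (auto simp: j_def)
    have h: "height i = depth j - 1" using j by (simp add: height_def)
    have wj: "0 < depth j" "depth j < 1" using depth_bounds[of j] j by auto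
    have pot: "potential i = chord (height i) t" using j by (simp add: potential_def)
    have d: "decay i = real (K + 1 - j) / real (K + 1)" using j by (simp add: decay_def)
    have le: "depth j \<le> 1 - decay i" unfolding d by (rule south_le[OF j(2,3)])
    have "(chord t (height i))\<^sup>2 = (1 - t) * depth j" using chord_squares[OF i(1)] by (simp add: h)
    also have "\<dots> \<le> 1 * (1 - decay i)" using le wj t0 by (intro mult_mono) auto
    also have "\<dots> \<le> (1 - decay i) * ((2 - depth j) * (1 + t))"
    proof -
      have "1 * 1 \<le> (2 - depth j) * (1 + t)" using wj t0 by (intro mult_mono) auto
      then have "(1 - decay i) * 1 \<le> (1 - decay i) * ((2 - depth j) * (1 + t))"
        using le wj by (intro mult_left_mono) auto
      then show ?thesis by simp
    qed
    also have "\<dots> = (1 - decay i) * (potential i)\<^sup>2" using chord_squares[OF i(1)] by (simp add: pot h)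
    finally have q: "(chord t (height i))\<^sup>2 \<le> (1 - decay i) * (potential i)\<^sup>2" .
    have "0 < (potential i)\<^sup>2" unfolding pot chord_squares[OF i(1)] unfolding h using t0 wj by (intro mult_pos_pos) auto
    then have "0 < potential i" using chords_nonneg[OF i(1)] pos_if_square_pos unfolding pot by simp
    moreover have "1 / 3 \<le> real (ring_size i) * decay i"
      unfolding d using tent_ge[of j K] j by (simp add: ring_size_def)
    ultimately show ?thesis
      by (rule that[OF disjI2[OF conjI[OF pot[symmetric] refl]] chords_nonneg(2)[OF i(1)] _ q])
  qed
qed

lemma inactive_ring:
  assumes i: "i \<in> {- int K..int K}" "i \<noteq> active"
  defines "L \<equiv> \<Prod>q\<in>ring i. norm (p - q)"
  shows "0 < potential i"
    "\<bar>ln L - real (ring_size i) * ln (potential i)\<bar> \<le> 10 * exp (- (real (ring_size i) * decay i) / 2)"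
    "potential i ^ ring_size i / 10 \<le> L"
    "max (chord (height i) t) (chord t (height i)) = potential i"
proof -
  obtain lo where lo: "(chord (height i) t = lo \<and> chord t (height i) = potential i)
      \<or> (chord (height i) t = potential i \<and> chord t (height i) = lo)"
    "0 \<le> lo" "0 < potential i" "lo\<^sup>2 \<le> (1 - decay i) * (potential i)\<^sup>2" "1 / 3 \<le> real (ring_size i) * decay i"
    using inactive_chords[OF i] .
  have L: "L = cmod (of_real (chord (height i) t) ^ ring_size i - (of_real (chord t (height i)) * cis \<alpha>) ^ ring_size i)"
    unfolding L_def by (rule prod_latitude_ring[OF ring_size_pos height_bound[OF i(1)] t_abs])
  show "0 < potential i" by fact
  show "\<bar>ln L - real (ring_size i) * ln (potential i)\<bar> \<le> 10 * exp (- (real (ring_size i) * decay i) / 2)"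
    "potential i ^ ring_size i / 10 \<le> L"
    unfolding L using ring_product_estimate[OF lo] by auto
  have "0 < real (ring_size i) * decay i" using lo(5) by linarith
  then have "0 < decay i" by (simp add: zero_less_mult_iff)
  then have "(1 - decay i) * (potential i)\<^sup>2 \<le> 1 * (potential i)\<^sup>2" by (intro mult_right_mono) auto
  then have "lo\<^sup>2 \<le> (potential i)\<^sup>2" using lo(4) by linarith
  then have "lo \<le> potential i" by (rule power2_le_imp_le) (use lo(3) in simp)
  then show "max (chord (height i) t) (chord t (height i)) = potential i" using lo(1) by auto
qed

lemma sum_decay:
  "(\<Sum>i\<in>{- int K..int K} - {active}. exp (- (real (ring_size i) * decay i) / 2)) \<le> 21"
proof -
  define g where "g i = (if i = active then 0 else exp (- (real (ring_size i) * decay i) / 2))" for i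
  have g0: "0 \<le> g i" for i by (simp add: g_def)
  have "(\<Sum>i\<in>{- int K..int K} - {active}. exp (- (real (ring_size i) * decay i) / 2)) = (\<Sum>i\<in>{- int K..int K} - {active}. g i)"
    by (intro sum.cong) (auto simp: g_def)
  also have "\<dots> \<le> (\<Sum>i\<in>{- int K..int K}. g i)" using g0 by (intro sum_mono2) auto
  also have "\<dots> = g 0 + (\<Sum>j=1..K. g (int j)) + (\<Sum>j=1..K. g (- int j))" by (rule sum_symmetric_int_interval)
  also have "g 0 \<le> 1" by (simp add: g_def decay_def)
  also have "(\<Sum>j=1..K. g (- int j)) \<le> (\<Sum>j=1..K. exp (- (real j * (real (K + 1 - j) / real (K + 1))) / 2))"
    by (intro sum_mono) (auto simp: g_def ring_size_def decay_def)
  also have "\<dots> \<le> 8" by (rule sum_exp_tent)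
  also have "(\<Sum>j=1..K. g (int j)) \<le> 12"
  proof -
    have "(\<Sum>j=1..K. g (int j)) \<le> (\<Sum>j=1..I. g (int j)) + (\<Sum>j=I+2..K. g (int j))"
    proof -
      have "(\<Sum>j=1..K. g (int j)) = (\<Sum>j\<in>{1..K} - {I + 1}. g (int j))"
        by (rule sum.mono_neutral_right) (auto simp: g_def active_def)
      also have "{1..K} - {I + 1} = {1..I} \<union> {I+2..K}" using I_le by auto
      also have "(\<Sum>j\<in>{1..I} \<union> {I+2..K}. g (int j)) = (\<Sum>j=1..I. g (int j)) + (\<Sum>j=I+2..K. g (int j))"
        by (rule sum.union_disjoint) auto
      finally show ?thesis by simp
    qed
    also have "(\<Sum>j=1..I. g (int j)) \<le> (\<Sum>j=1..I. exp (- (real j * (real (I + 1 - j) / real (I + 1))) / 2))"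
      by (intro sum_mono) (auto simp: g_def ring_size_def decay_def)
    also have "\<dots> \<le> 8" by (rule sum_exp_tent)
    also have "(\<Sum>j=I+2..K. g (int j)) \<le> (\<Sum>j=(I+1)+1..K. exp (- (real j * (5 / 6 * (real (j - (I+1)) / real j))) / 2))"
      by (intro sum_mono2[THEN order_trans, OF _ _ _ sum_mono]) (auto simp: g_def ring_size_def decay_def)
    also have "\<dots> \<le> 4" by (rule sum_exp_tail)
    finally show ?thesis by simp
  qed
  finally show ?thesis by simp
qed

lemma two_ln_chord:
  assumes "0 < 1 - h" "0 < 1 + s"
  shows "2 * ln (chord h s) = ln (1 - h) + ln (1 + s)"
  using assms by (simp add: chord_def ln_sqrt ln_mult_pos)

text \<open>Twice the sum is the expression in \<open>ring_energy\<close>, as \<open>2 ln (chord h t) = ln (1 - h) + ln (1 + t)\<close>.\<close>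

lemma sum_potential:
  "\<bar>(\<Sum>i\<in>{- int K..int K}. real (ring_size i) * ln (potential i)) + kappa * n\<bar> \<le> 50"
proof -
  define V where "V = real (I * (I + 1))"
  define E where "E = (\<Sum>j=1..I. real j * ln (2 - depth j)) + V / 2 * ln (1 - t)
     + (\<Sum>j=I+1..K. real j * ln (depth j)) + (\<Sum>j=1..K. real j * ln (2 - depth j)) + (n - V / 2) * ln (2 - (1 - t))"
  have E: "\<bar>E - (2 * ln 2 - 1) * n\<bar> \<le> 100"
    unfolding E_def depth_def V_def using N_eq m1 Km mK I_le band_lower band_upper t0 by (intro ring_energy) auto
  have "2 * (\<Sum>i\<in>{- int K..int K}. real (ring_size i) * ln (potential i))
     = (\<Sum>i\<in>{- int K..int K}. real (ring_size i) * (2 * ln (potential i)))"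
    by (simp add: sum_distrib_left mult_ac)
  also have "\<dots> = real m * (2 * ln (potential 0)) + (\<Sum>j=1..K. real j * (2 * ln (potential (int j))))
     + (\<Sum>j=1..K. real j * (2 * ln (potential (- int j))))"
    unfolding sum_symmetric_int_interval by (simp add: ring_size_def)
  also have "real m * (2 * ln (potential 0)) = real m * ln (1 + t)"
    using t0 by (simp add: potential_def height_def two_ln_chord)
  also have "(\<Sum>j=1..K. real j * (2 * ln (potential (- int j)))) = (\<Sum>j=1..K. real j * ln (2 - depth j) + real j * ln (1 + t))"
  proof (rule sum.cong)
    fix j assume j: "j \<in> {1..K}"
    then have "depth j < 1" using depth_bounds[of j] by simp
    moreover have "height (- int j) = depth j - 1" using j by (simp add: height_def)
    ultimately have "2 * ln (potential (- int j)) = ln (2 - depth j) + ln (1 + t)"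
      using t0 by (simp add: potential_def two_ln_chord)
    then show "real j * (2 * ln (potential (- int j))) = real j * ln (2 - depth j) + real j * ln (1 + t)"
      by (simp only: distrib_left)
  qed simp
  also have "\<dots> = (\<Sum>j=1..K. real j * ln (2 - depth j)) + real (K * (K + 1)) / 2 * ln (1 + t)"
    by (simp only: sum.distrib sum_distrib_right[symmetric] sum_real_interval)
  also have "(\<Sum>j=1..K. real j * (2 * ln (potential (int j))))
    = (\<Sum>j=1..I. real j * (2 * ln (potential (int j)))) + (\<Sum>j=I+1..K. real j * (2 * ln (potential (int j))))"
  proof -
    have s: "{1..K} = {1..I} \<union> {I+1..K}" using I_le by auto
    show ?thesis unfolding s by (rule sum.union_disjoint) auto
  qed
  also have "(\<Sum>j=1..I. real j * (2 * ln (potential (int j)))) = (\<Sum>j=1..I. real j * ln (2 - depth j) + real j * ln (1 - t))"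
  proof (rule sum.cong)
    fix j assume j: "j \<in> {1..I}"
    then have depth: "0 < depth j" "depth j < 1" using depth_bounds[of j] I_le by auto
    have "0 < I * (I + 1)" using j by simp
    then have "0 < real (I * (I + 1)) / n" using n_pos by (intro divide_pos_pos) (simp_all only: of_nat_0_less_iff)
    then have "0 < 1 - t" using band_lower by linarith
    moreover have "height (int j) = 1 - depth j" using j by (simp add: height_def)
    ultimately have "2 * ln (potential (int j)) = ln (2 - depth j) + ln (1 - t)"
      using depth j by (simp add: potential_def two_ln_chord)
    then show "real j * (2 * ln (potential (int j))) = real j * ln (2 - depth j) + real j * ln (1 - t)"
      by (simp only: distrib_left)
  qed simp
  also have "\<dots> = (\<Sum>j=1..I. real j * ln (2 - depth j)) + V / 2 * ln (1 - t)"
    unfolding V_def by (simp only: sum.distrib sum_distrib_right[symmetric] sum_real_interval)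
  also have "(\<Sum>j=I+1..K. real j * (2 * ln (potential (int j)))) = (\<Sum>j=I+1..K. real j * ln (depth j) + real j * ln (1 + t))"
  proof (rule sum.cong)
    fix j assume j: "j \<in> {I+1..K}"
    then have depth: "0 < depth j" "depth j < 1" using depth_bounds[of j] I_le by auto
    moreover have "height (int j) = 1 - depth j" using j by (simp add: height_def)
    ultimately have "2 * ln (potential (int j)) = ln (depth j) + ln (1 + t)"
      using t0 j by (simp add: potential_def two_ln_chord)
    then show "real j * (2 * ln (potential (int j))) = real j * ln (depth j) + real j * ln (1 + t)"
      by (simp only: distrib_left)
  qed simp
  also have "\<dots> = (\<Sum>j=I+1..K. real j * ln (depth j)) + (real (K * (K + 1)) / 2 - V / 2) * ln (1 + t)"
  proof -
    have s: "{1..K} = {1..I} \<union> {I+1..K}" using I_le by auto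
    have "(\<Sum>j=1..K. real j) = (\<Sum>j=1..I. real j) + (\<Sum>j=I+1..K. real j)"
      unfolding s by (rule sum.union_disjoint) auto
    then have "(\<Sum>j=I+1..K. real j) = real (K * (K + 1)) / 2 - V / 2"
      unfolding sum_real_interval V_def by linarith
    then show ?thesis by (simp only: sum.distrib sum_distrib_right[symmetric])
  qed
  finally have S: "2 * (\<Sum>i\<in>{- int K..int K}. real (ring_size i) * ln (potential i))
     = real m * ln (1 + t) + ((\<Sum>j=1..I. real j * ln (2 - depth j)) + V / 2 * ln (1 - t)
      + ((\<Sum>j=I+1..K. real j * ln (depth j)) + (real (K * (K + 1)) / 2 - V / 2) * ln (1 + t)))
      + ((\<Sum>j=1..K. real j * ln (2 - depth j)) + real (K * (K + 1)) / 2 * ln (1 + t))" .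
  have nK: "n = real (K * (K + 1)) + real m" unfolding N_eq by simp
  have "2 * (\<Sum>i\<in>{- int K..int K}. real (ring_size i) * ln (potential i)) = E"
    unfolding S E_def nK by (simp add: algebra_simps)
  moreover have "kappa * n = - ((2 * ln 2 - 1) * n) / 2" by (simp add: kappa_def algebra_simps)
  ultimately show ?thesis using E by linarith
qed

section \<open>The parallel next to a given point\<close>

lemma active_in: "active \<in> {- int K..int K}"
  using I_le by (auto simp: active_def)

lemma active_size: "ring_size active = (if I < K then I + 1 else m)"
  by (simp add: active_def ring_size_def nat_add_distrib)

lemma active_potential: "potential active = chord (height active) t"
  by (simp add: potential_def active_def)

text \<open>The depth \<open>v\<close> of the active parallel below the north pole is of order \<open>r\<^sup>2 / N\<close>, and the depth
  \<open>1 - t\<close> of the point differs from it by at most \<open>2 r / N\<close>. These bounds hold for the polar and the equatorial parallels alike, so that the two cases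
  need not be distinguished later on.\<close>

lemma active_ring_facts:
  defines "r \<equiv> real (ring_size active)" and "v \<equiv> 1 - height active"
  shows "n * \<bar>v - (1 - t)\<bar> \<le> 2 * r" "r\<^sup>2 \<le> 13 * (n * v)" "n * v \<le> 3 * r\<^sup>2" "0 < v" "v \<le> 1"
    "r \<le> 3 * (real I + 1)" "real (I * (I + 1)) \<le> n * v" "real (I * (I + 1)) \<le> n * (1 - t)"
proof -
  have lower: "real (I * (I + 1)) \<le> n * (1 - t)"
    using band_lower n_pos by (simp add: pos_divide_le_eq mult.commute)
  show "real (I * (I + 1)) \<le> n * (1 - t)" by fact
  have abs_n: "n * \<bar>x\<bar> = \<bar>n * x\<bar>" for x using n_pos by (simp add: abs_mult)
  have "n * \<bar>v - (1 - t)\<bar> \<le> 2 * r \<and> r\<^sup>2 \<le> 13 * (n * v) \<and> n * v \<le> 3 * r\<^sup>2 \<and> 0 < v \<and> v \<le> 1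
    \<and> r \<le> 3 * (real I + 1) \<and> real (I * (I + 1)) \<le> n * v"
  proof (cases "I < K")
    case True
    define J where "J = real I + 1"
    have J: "1 \<le> J" "J \<le> J * J" by (auto simp: J_def mult_ge1_I)
    have r: "r = J" using True by (simp add: r_def J_def active_size)
    have v: "v = depth (I + 1)" using True by (simp add: v_def active_def height_def nat_add_distrib)
    have nv: "n * v = J * J - 1/6" unfolding v n_depth by (simp add: J_def power2_eq_square add.commute)
    have II: "real (I * (I + 1)) = J * J - J" by (simp add: J_def algebra_simps)
    have up: "n * (1 - t) \<le> J * J - J + 2 * J"
      using band_upper n_pos True unfolding II by (simp add: pos_le_divide_eq mult.commute J_def)
    have "\<bar>n * (v - (1 - t))\<bar> \<le> 2 * J"
      using up lower J unfolding II right_diff_distrib[of n v] nv by linarith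
    moreover have "0 < v" "v \<le> 1" unfolding v using depth_bounds[of "I + 1"] True by simp_all
    moreover have "x \<le> 13 * (x - 1/6) \<and> x - 1/6 \<le> 3 * x" if "1 \<le> x" for x :: real using that by simp
    then have "J * J \<le> 13 * (J * J - 1/6)" "J * J - 1/6 \<le> 3 * (J * J)" using J by (meson order_trans)+
    moreover have "J * J - J \<le> J * J - 1/6" using J(1) by simp
    moreover have "J \<le> 3 * (real I + 1)" by (simp add: J_def)
    ultimately show ?thesis unfolding r abs_n power2_eq_square II nv by blast
  next
    case False
    then have I: "I = K" using I_le by simp
    have r: "r = real m" and v: "v = 1" using False by (simp_all add: r_def v_def active_def height_def ring_size_def)
    have nI: "n = real (I * (I + 1)) + real m" unfolding N_eq I by simp
    have "\<bar>n * (v - (1 - t))\<bar> = n * t" using t0 n_pos by (simp add: v)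
    also have "\<dots> \<le> real m" using lower nI by (simp add: right_diff_distrib)
    finally have "\<bar>n * (v - (1 - t))\<bar> \<le> 2 * real m" by simp
    moreover have "real m \<le> 3 * (real I + 1)" using mK I by simp
    moreover have "real (I * (I + 1)) \<le> n" using nI by simp
    ultimately show ?thesis unfolding r abs_n v
      using m_squared_le n_le_m_squared by simp
  qed
  then show "n * \<bar>v - (1 - t)\<bar> \<le> 2 * r" "r\<^sup>2 \<le> 13 * (n * v)" "n * v \<le> 3 * r\<^sup>2" "0 < v" "v \<le> 1"
    "r \<le> 3 * (real I + 1)" "real (I * (I + 1)) \<le> n * v" by auto
qed

lemma active_chords:
  defines "a \<equiv> chord (height active) t" and "b \<equiv> chord t (height active)" and "v \<equiv> 1 - height active"
  shows "a\<^sup>2 = v * (1 + t)" "b\<^sup>2 = (1 - t) * (2 - v)" "0 < a" "0 \<le> b" "v \<le> a\<^sup>2" "1 - t \<le> b\<^sup>2"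
    "a\<^sup>2 \<le> 2 * v"
proof -
  have v: "0 < v" "v \<le> 1" using active_ring_facts unfolding v_def by auto
  show a: "a\<^sup>2 = v * (1 + t)" and b: "b\<^sup>2 = (1 - t) * (2 - v)"
    using chord_squares[OF active_in] unfolding a_def b_def v_def by (simp_all add: mult.commute)
  show b0: "0 \<le> b" using chords_nonneg[OF active_in] by (simp add: b_def)
  have "v * 1 \<le> v * (1 + t)" using v t0 by (intro mult_left_mono) auto
  then show va: "v \<le> a\<^sup>2" using a by simp
  have "0 < a\<^sup>2" using va v by linarith
  then show "0 < a" by (rule pos_if_square_pos[OF chords_nonneg(1)[OF active_in, folded a_def]])
  have "(1 - t) * 1 \<le> (1 - t) * (2 - v)" using v t1 by (intro mult_left_mono) auto
  then show "1 - t \<le> b\<^sup>2" using b by simp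
  have "v * (1 + t) \<le> v * 2" using v t1 by (intro mult_left_mono) auto
  then show "a\<^sup>2 \<le> 2 * v" using a by simp
qed

text \<open>Since \<open>a\<^sup>2 - b\<^sup>2\<close> is twice the difference of the depths, the ratio of the chords is \<open>1 + O(1 / r)\<close>.
  The topmost band has to be excluded, as \<open>b = 0\<close> when the point is the pole.\<close>

lemma active_chords_comparable:
  assumes I: "1 \<le> I"
  defines "a \<equiv> chord (height active) t" and "b \<equiv> chord t (height active)" and "r \<equiv> real (ring_size active)"
  shows "0 < b" "r * \<bar>ln a - ln b\<bar> \<le> 36"
proof -
  define v where "v = 1 - height active"
  define y where "y = 4 * r / real (I * (I + 1))"
  note f = active_ring_facts[folded r_def v_def]
  note c = active_chords[folded a_def b_def v_def]
  have II: "0 < real (I * (I + 1))" using I by (simp only: of_nat_0_less_iff) simp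
  have "0 < n * (1 - t)" using f(8) II by linarith
  then have "0 < 1 - t" using n_pos by (simp add: zero_less_mult_iff)
  then have "0 < b\<^sup>2" using c(6) by linarith
  then show b0: "0 < b" by (rule pos_if_square_pos[OF c(4)])
  have r0: "0 \<le> r" by (simp add: r_def)
  have d: "2 * \<bar>v - (1 - t)\<bar> \<le> y * x" if "real (I * (I + 1)) \<le> n * x" for x
  proof -
    have "n * (2 * \<bar>v - (1 - t)\<bar>) \<le> 4 * r" using f(1) by simp
    also have "\<dots> = y * real (I * (I + 1))" using II by (simp add: y_def del: of_nat_mult)
    also have "\<dots> \<le> y * (n * x)" using that r0 by (intro mult_left_mono) (simp_all add: y_def)
    finally have "n * (2 * \<bar>v - (1 - t)\<bar>) \<le> n * (y * x)" by (simp add: mult_ac)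
    then show ?thesis using n_pos by (simp only: mult_le_cancel_left_pos)
  qed
  have y0: "0 \<le> y" using r0 by (simp add: y_def)
  have ab: "a\<^sup>2 - b\<^sup>2 = 2 * (v - (1 - t))" unfolding c(1,2) by (simp add: algebra_simps)
  have abs2: "x \<le> 2 * \<bar>z\<bar> \<and> - x \<le> 2 * \<bar>z\<bar>" if "x = 2 * z" for x z :: real using that by auto
  have lnc: "2 * ln x - 2 * ln z \<le> y" if "0 < x" "0 < z" "x\<^sup>2 - z\<^sup>2 \<le> y * z\<^sup>2" for x z
  proof -
    have "x\<^sup>2 / z\<^sup>2 \<le> 1 + y" using that by (simp add: pos_divide_le_eq algebra_simps)
    also have "\<dots> \<le> exp y" by (rule exp_ge_add_one_self)
    finally have "ln (x\<^sup>2 / z\<^sup>2) \<le> ln (exp y)" using that by (intro ln_mono) auto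
    then show ?thesis using that by (simp add: ln_div ln_realpow)
  qed
  have "y * (1 - t) \<le> y * b\<^sup>2" using c(6) y0 by (intro mult_left_mono) auto
  then have "2 * \<bar>v - (1 - t)\<bar> \<le> y * b\<^sup>2" using d[OF f(8)] by (rule order_trans[rotated])
  moreover have "a\<^sup>2 - b\<^sup>2 \<le> 2 * \<bar>v - (1 - t)\<bar>" using abs2[OF ab] by simp
  ultimately have "a\<^sup>2 - b\<^sup>2 \<le> y * b\<^sup>2" by (rule order_trans[rotated])
  then have l1: "2 * ln a - 2 * ln b \<le> y" by (intro lnc c(3) b0)
  have "y * v \<le> y * a\<^sup>2" using c(5) y0 by (intro mult_left_mono) auto
  then have "2 * \<bar>v - (1 - t)\<bar> \<le> y * a\<^sup>2" using d[OF f(7)] by (rule order_trans[rotated])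
  moreover have "b\<^sup>2 - a\<^sup>2 \<le> 2 * \<bar>v - (1 - t)\<bar>" using abs2[OF ab] by simp
  ultimately have "b\<^sup>2 - a\<^sup>2 \<le> y * a\<^sup>2" by (rule order_trans[rotated])
  then have "2 * ln b - 2 * ln a \<le> y" by (intro lnc c(3) b0)
  with l1 have "\<bar>ln a - ln b\<bar> \<le> y / 2" by linarith
  then have "r * \<bar>ln a - ln b\<bar> \<le> r * (y / 2)" using r0 by (intro mult_left_mono) auto
  also have "r * (4 * r / D / 2) = 2 * r\<^sup>2 / D" for D by (simp add: power2_eq_square)
  then have "r * (y / 2) = 2 * r\<^sup>2 / real (I * (I + 1))" unfolding y_def .
  also have "\<dots> \<le> 36"
  proof -
    have "r\<^sup>2 \<le> (3 * (real I + 1))\<^sup>2" using f(6) r0 by (intro power_mono) auto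
    also have "\<dots> = 9 * (real I + 1) * (real I + 1)" by (simp add: power2_eq_square algebra_simps)
    also have "\<dots> \<le> 9 * (real I + 1) * (2 * real I)" using I by (intro mult_left_mono) auto
    also have "\<dots> = 18 * real (I * (I + 1))" by (simp add: algebra_simps)
    finally show ?thesis by (subst pos_divide_le_eq[OF II]) linarith
  qed
  finally show "r * \<bar>ln a - ln b\<bar> \<le> 36" .
qed

text \<open>The squared distance is at most \<open>(a - b)\<^sup>2 + a b \<theta>\<^sup>2\<close>, the contributions of the latitude and of the
  longitude. As \<open>\<bar>\<theta>\<bar> \<le> \<pi> / r\<close>, each is \<open>O(1 / N)\<close>.\<close>

lemma active_ring_nearest_distance:
  assumes th: "\<bar>\<alpha> - \<beta>\<bar> \<le> pi / real (ring_size active)"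
  shows "norm (p - sphere_point (height active) \<beta>) \<le> 19 / sqrt n"
proof -
  define r where "r = real (ring_size active)"
  define v where "v = 1 - height active"
  define a where "a = chord (height active) t"
  define b where "b = chord t (height active)"
  define \<theta> where "\<theta> = \<alpha> - \<beta>"
  note f = active_ring_facts[folded r_def v_def]
  note c = active_chords[folded a_def b_def v_def]
  have r1: "1 \<le> r" using ring_size_pos[of active] by (simp add: r_def)
  have nv: "0 < n * v" using f(4) n_pos by simp
  have "(norm (p - sphere_point (height active) \<beta>))\<^sup>2 = a\<^sup>2 + b\<^sup>2 - 2 * a * b * cos \<theta>"
    using height_bound[OF active_in] t_abs
    by (simp add: norm_sphere_point_diff cmod_diff_cis_squared a_def b_def \<theta>_def)
  also have "\<dots> \<le> a\<^sup>2 + b\<^sup>2 - 2 * a * b * (1 - \<theta>\<^sup>2 / 2)"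
    using c(3,4) cos_ge_one_minus_square[of \<theta>] by (intro diff_left_mono mult_left_mono) auto
  also have "\<dots> = (a - b)\<^sup>2 + a * b * \<theta>\<^sup>2" by (simp add: power2_eq_square algebra_simps)
  finally have N1: "(norm (p - sphere_point (height active) \<beta>))\<^sup>2 \<le> (a - b)\<^sup>2 + a * b * \<theta>\<^sup>2" .
  have "(a - b)\<^sup>2 * v \<le> (a - b)\<^sup>2 * (a + b)\<^sup>2"
  proof (rule mult_left_mono)
    have "v \<le> a\<^sup>2" by (rule c(5))
    also have "\<dots> \<le> (a + b)\<^sup>2" using c(3,4) by (intro power_mono) auto
    finally show "v \<le> (a + b)\<^sup>2" .
  qed simp
  also have "\<dots> = (a\<^sup>2 - b\<^sup>2)\<^sup>2" by (simp add: power2_eq_square algebra_simps)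
  also have "a\<^sup>2 - b\<^sup>2 = 2 * (v - (1 - t))" unfolding c(1,2) by (simp add: algebra_simps)
  finally have "(a - b)\<^sup>2 * v \<le> 4 * (v - (1 - t))\<^sup>2" by (simp only: power_mult_distrib) simp
  then have "n\<^sup>2 * ((a - b)\<^sup>2 * v) \<le> n\<^sup>2 * (4 * (v - (1 - t))\<^sup>2)" by (intro mult_left_mono) auto
  also have "\<dots> = 4 * (n * \<bar>v - (1 - t)\<bar>)\<^sup>2" by (simp add: power_mult_distrib)
  also have "\<dots> \<le> 4 * (2 * r)\<^sup>2" using f(1) n_pos by (intro mult_left_mono power_mono) auto
  also have "\<dots> = 16 * r\<^sup>2" by (simp add: power_mult_distrib)
  also have "\<dots> \<le> 16 * (13 * (n * v))" using f(2) by linarith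
  finally have "(n * v) * (n * (a - b)\<^sup>2) \<le> (n * v) * 208" by (simp add: power2_eq_square mult_ac)
  then have p1: "n * (a - b)\<^sup>2 \<le> 208" using nv by (simp only: mult_le_cancel_left_pos)
  have "2 * (a * b) \<le> a\<^sup>2 + b\<^sup>2" using zero_le_power2[of "a - b"] by (simp add: power2_eq_square algebra_simps)
  also have "\<dots> \<le> 2 * v + 2 * (1 - t)"
  proof -
    have "(1 - t) * (2 - v) \<le> (1 - t) * 2" using f(4) t1 by (intro mult_left_mono) auto
    then show ?thesis using c(7) unfolding c(2) by simp
  qed
  finally have "a * b \<le> v + (1 - t)" by simp
  then have "n * (a * b) \<le> n * (v + (1 - t))" using n_pos by (intro mult_left_mono) auto
  also have "\<dots> = 2 * (n * v) - n * (v - (1 - t))" by (simp add: algebra_simps)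
  also have "\<dots> \<le> 2 * (n * v) + n * \<bar>v - (1 - t)\<bar>"
  proof -
    have "n * - (v - (1 - t)) \<le> n * \<bar>v - (1 - t)\<bar>" using n_pos by (intro mult_left_mono abs_ge_minus_self) auto
    moreover have "c - x \<le> c + z" if "- x \<le> z" for c x z :: real using that by simp
    ultimately show ?thesis by (simp only: mult_minus_right)
  qed
  also have "\<dots> \<le> 2 * (3 * r\<^sup>2) + 2 * r" using f(1,3) by linarith
  also have "\<dots> \<le> 8 * r\<^sup>2" using r1 by (simp add: power2_eq_square)
  finally have nab: "n * (a * b) \<le> 8 * r\<^sup>2" .
  have "\<theta>\<^sup>2 \<le> (pi / r)\<^sup>2" using th power_mono[of "\<bar>\<theta>\<bar>" "pi / r" 2] by (simp add: \<theta>_def r_def)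
  also have "\<dots> \<le> 12 / r\<^sup>2" using pi_squared_le by (simp add: power_divide divide_right_mono)
  finally have "(n * (a * b)) * \<theta>\<^sup>2 \<le> (8 * r\<^sup>2) * (12 / r\<^sup>2)" by (rule mult_mono[OF nab]) auto
  also have "\<dots> = 96" using r1 by simp
  finally have "n * (a * b * \<theta>\<^sup>2) \<le> 96" by (simp add: mult_ac)
  then have "n * ((a - b)\<^sup>2 + a * b * \<theta>\<^sup>2) \<le> 361" using p1 by (simp only: distrib_left)
  moreover have "n * (norm (p - sphere_point (height active) \<beta>))\<^sup>2 \<le> n * ((a - b)\<^sup>2 + a * b * \<theta>\<^sup>2)"
    using N1 n_pos by (intro mult_left_mono) auto
  ultimately have "n * (norm (p - sphere_point (height active) \<beta>))\<^sup>2 \<le> 361" by (rule order_trans[rotated])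
  then have "(norm (p - sphere_point (height active) \<beta>))\<^sup>2 \<le> 361 / n"
    by (subst pos_le_divide_eq[OF n_pos]) (simp only: mult.commute)
  also have "\<dots> = (19 / sqrt n)\<^sup>2" using n_pos by (simp add: power_divide)
  finally show ?thesis by (rule power2_le_imp_le) simp
qed

lemma active_punctured_ring:
  fixes k0 :: int
  defines "\<beta> \<equiv> 2 * pi * of_int k0 / real (ring_size active)" and "r \<equiv> ring_size active"
  assumes th: "\<bar>\<alpha> - \<beta>\<bar> \<le> pi / real r"
  defines "Q \<equiv> \<Prod>q\<in>ring active - {sphere_point (height active) \<beta>}. norm (p - q)"
  shows "0 < Q" "\<bar>ln Q - ln (real r) - (real r - 1) * ln (potential active)\<bar> \<le> 37"
proof -
  define a where "a = chord (height active) t"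
  define b where "b = chord t (height active)"
  note c = active_chords[folded a_def b_def]
  have r1: "1 \<le> r" unfolding r_def by (rule ring_size_pos)
  have r1r: "1 \<le> real r" using r1 by simp
  have Q: "Q = cmod (\<Sum>k<r. of_real a ^ (r - 1 - k) * (of_real b * cis (\<alpha> - \<beta>)) ^ k)"
    unfolding Q_def \<beta>_def a_def b_def r_def
    by (rule prod_punctured_latitude_ring[OF ring_size_pos height_bound[OF active_in] t_abs])
  have up: "Q \<le> real r * max a b ^ (r - 1)"
    unfolding Q using c(3,4) r1 by (intro punctured_ring_upper) auto
  have ln2: "ln (2::real) \<le> 1" using ln_le_minus_one[of "2::real"] by simp
  have ln20: "0 \<le> ln (2::real)" by simp
  have pot: "potential active = a" by (simp add: active_potential a_def)
  have lnp: "ln (x ^ (r - 1)) = (real r - 1) * ln x" for x :: real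
    using r1 by (simp add: ln_realpow of_nat_diff)
  note lnp = lnp lnp[unfolded One_nat_def]
  have "0 < Q \<and> \<bar>ln Q - ln (real r) - (real r - 1) * ln a\<bar> \<le> 37"
  proof (cases "I = 0")
    case True
    have r12: "r \<in> {1, 2}" unfolding r_def active_size using True m1 mK by auto
    have low: "a ^ (r - 1) / 2 \<le> Q"
      unfolding Q using c(3,4) r12 th by (intro punctured_ring_lower_small) auto
    have "r = 1 \<or> b \<le> a"
    proof (cases "K = 0")
      case True
      then have "active = 0" unfolding active_def by simp
      then have "height active = 0" by (simp add: height_def)
      then have "b\<^sup>2 \<le> a\<^sup>2" using c(1,2) t0 by simp
      then have "b \<le> a" using c(3) by (simp add: power2_le_iff_abs_le)
      then show ?thesis by simp
    next
      case False
      then show ?thesis unfolding r_def active_size using \<open>I = 0\<close> by simp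
    qed
    then have "max a b ^ (r - 1) = a ^ (r - 1)" by (auto simp: max_def)
    then have up': "Q \<le> real r * a ^ (r - 1)" using up by simp
    have Q0: "0 < Q" using low c(3) by (intro less_le_trans[OF _ low]) auto
    have "ln Q \<le> ln (real r) + (real r - 1) * ln a"
      using ln_mono[OF up' Q0] r1 c(3) by (simp add: ln_mult_pos lnp)
    moreover have "ln (a ^ (r - 1) / 2) \<le> ln Q" using low c(3) by (intro ln_mono) auto
    then have "(real r - 1) * ln a - ln 2 \<le> ln Q" using c(3) by (simp add: ln_divide_pos lnp)
    moreover have "ln (real r) \<le> ln 2" using r12 by auto
    ultimately show ?thesis using Q0 ln2 ln20 by simp
  next
    case False
    then have I1: "1 \<le> I" by simp
    note cmp = active_chords_comparable[OF I1, folded a_def b_def r_def]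
    have low: "real r / 2 * min a b ^ (r - 1) \<le> Q"
      unfolding Q using c(3,4) r1 th by (intro punctured_ring_lower) auto
    have mm: "0 < min a b" "0 < max a b" using c(3) cmp(1) by auto
    have Q0: "0 < Q" using low mm r1 by (intro less_le_trans[OF _ low]) auto
    have u: "ln Q \<le> ln (real r) + (real r - 1) * ln (max a b)"
      using ln_mono[OF up Q0] r1 mm(2) by (simp add: ln_mult_pos lnp)
    have "ln (real r / 2 * min a b ^ (r - 1)) \<le> ln Q" using low mm r1 by (intro ln_mono mult_pos_pos) auto
    moreover have "ln (real r / 2 * min a b ^ (r - 1)) = ln (real r) - ln 2 + (real r - 1) * ln (min a b)"
      using mm(1) r1 by (subst ln_mult_pos) (auto simp: ln_divide_pos lnp simp del: ln_mult)
    ultimately have l: "ln (real r) - ln 2 + (real r - 1) * ln (min a b) \<le> ln Q" by simp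
    have d: "\<bar>(real r - 1) * (x - ln a)\<bar> \<le> 36" if "\<bar>x - ln a\<bar> \<le> \<bar>ln a - ln b\<bar>" for x
    proof -
      have "(real r - 1) * \<bar>x - ln a\<bar> \<le> real r * \<bar>ln a - ln b\<bar>"
        using that r1 by (intro mult_mono) auto
      then show ?thesis using cmp(2) r1r by (simp add: abs_mult)
    qed
    have "\<bar>(real r - 1) * (ln (max a b) - ln a)\<bar> \<le> 36" "\<bar>(real r - 1) * (ln (min a b) - ln a)\<bar> \<le> 36"
      by (rule d, simp add: max_def min_def abs_minus_commute)+
    then show ?thesis using u l Q0 ln2 unfolding right_diff_distrib by linarith
  qed
  then show "0 < Q" "\<bar>ln Q - ln (real r) - (real r - 1) * ln (potential active)\<bar> \<le> 37"
    by (simp_all add: pot)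
qed

text \<open>The spacing \<open>a / r\<close> on the active parallel is of order \<open>1 / sqrt N\<close>. Omitting one point from its
  ring therefore produces the factor \<open>sqrt N\<close> of the final estimate.\<close>

lemma active_normalisation:
  "\<bar>ln (real (ring_size active)) - ln (potential active) - ln n / 2\<bar> \<le> 6"
proof -
  define r where "r = real (ring_size active)"
  define v where "v = 1 - height active"
  define a where "a = chord (height active) t"
  note f = active_ring_facts[folded r_def v_def]
  note c = active_chords[folded a_def v_def]
  have r1: "1 \<le> r" using ring_size_pos[of active] by (simp add: r_def)
  have r0: "0 < r" "0 < r\<^sup>2" using r1 by auto
  have na: "0 < n * a\<^sup>2" using n_pos c(3) by simp
  have lnr: "ln (r\<^sup>2) = 2 * ln r" "ln (n * a\<^sup>2) = ln n + 2 * ln a"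
    using r0 n_pos c(3) by (simp_all add: ln_realpow ln_mult_pos)
  have nva: "n * v \<le> n * a\<^sup>2" "n * a\<^sup>2 \<le> 2 * (n * v)" using c(5,7) n_pos by simp_all
  have "r\<^sup>2 / (n * a\<^sup>2) \<le> 13" using f(2) nva by (subst pos_divide_le_eq[OF na]) linarith
  then have "ln (r\<^sup>2 / (n * a\<^sup>2)) \<le> 12"
    using ln_le_minus_one[of "r\<^sup>2 / (n * a\<^sup>2)"] r0 na by simp
  then have 1: "ln (r\<^sup>2) - ln (n * a\<^sup>2) \<le> 12" using r0 na by (simp only: ln_divide_pos)
  have "n * a\<^sup>2 / r\<^sup>2 \<le> 6" using f(3) nva by (subst pos_divide_le_eq[OF r0(2)]) linarith
  then have "ln (n * a\<^sup>2 / r\<^sup>2) \<le> 5"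
    using ln_le_minus_one[of "n * a\<^sup>2 / r\<^sup>2"] r0 na by simp
  then have 2: "ln (n * a\<^sup>2) - ln (r\<^sup>2) \<le> 5" using r0 na by (simp only: ln_divide_pos)
  show ?thesis using 1 2 unfolding lnr active_potential r_def[symmetric] a_def[symmetric] by linarith
qed

text \<open>The product over an inactive ring is at least a constant times \<open>(max a b)\<^sup>r\<close>, while the product
  over all its points but \<open>q\<close> is at most \<open>r (max a b)\<^sup>r\<^sup>-\<^sup>1\<close>. So \<open>\<bar>p - q\<bar>\<close> is at least a constant times
  \<open>max a b / r\<close>, which is at least of order \<open>1 / sqrt N\<close>.\<close>

lemma inactive_ring_far:
  assumes i: "i \<in> {- int K..int K}" "i \<noteq> active" and q: "q \<in> ring i"
  shows "1 / (40 * sqrt n) \<le> norm (p - q)"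
proof -
  define r where "r = ring_size i"
  note ir = inactive_ring[OF i]
  have r1: "1 \<le> r" unfolding r_def by (rule ring_size_pos)
  obtain k0 :: int where k0: "q = sphere_point (height i) (2 * pi * of_int k0 / real r)"
    using q unfolding latitude_ring_def r_def by blast
  define M where "M = (\<Prod>q'\<in>ring i - {q}. norm (p - q'))"
  have M: "M \<le> real r * potential i ^ (r - 1)"
  proof -
    have "M \<le> real r * max (chord (height i) t) (chord t (height i)) ^ (r - 1)"
      unfolding M_def k0 r_def prod_punctured_latitude_ring[OF ring_size_pos height_bound[OF i(1)] t_abs]
      by (intro punctured_ring_upper chords_nonneg i(1) ring_size_pos)
    then show ?thesis unfolding ir(4) .
  qed
  have "(\<Prod>q'\<in>ring i. norm (p - q')) = norm (p - q) * M"
    unfolding M_def by (rule prod.remove[OF finite_latitude_ring[OF ring_size_pos] q])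
  then have "potential i ^ r / 10 \<le> norm (p - q) * M" using ir(3) by (simp add: r_def)
  also have "\<dots> \<le> norm (p - q) * (real r * potential i ^ (r - 1))" using M by (intro mult_left_mono) auto
  also have "potential i ^ r = potential i * potential i ^ (r - 1)" using r1 by (metis power_eq_if not_one_le_zero)
  finally have "potential i ^ (r - 1) * (potential i / 10) \<le> potential i ^ (r - 1) * (norm (p - q) * real r)"
    by (simp add: mult_ac)
  then have A: "potential i / 10 \<le> norm (p - q) * real r"
    using ir(1) by (simp only: mult_le_cancel_left_pos zero_less_power)
  define v where "v = 1 - height i"
  have v0: "0 < v" using height_bound[OF i(1)] by (auto simp: v_def abs_less_iff)
  have "v \<le> (chord (height i) t)\<^sup>2"
    unfolding chord_squares[OF i(1)] using v0 t0 by (simp add: v_def)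
  also have "\<dots> \<le> (potential i)\<^sup>2"
    unfolding ir(4)[symmetric] by (intro power_mono) (auto intro: chords_nonneg[OF i(1)])
  finally have pv: "v \<le> (potential i)\<^sup>2" .
  have rv: "(real r)\<^sup>2 \<le> 13 * (n * v)"
  proof (cases i "0::int" rule: linorder_cases)
    case less
    define j where "j = nat (- i)"
    have j: "i = - int j" "1 \<le> j" "j \<le> K" using less i by (auto simp: j_def)
    have "1 \<le> v" using j depth_bounds[of j] by (simp add: v_def height_def)
    then have "n * 1 \<le> n * v" using n_pos by (intro mult_left_mono) auto
    moreover have "(real j)\<^sup>2 \<le> (real K)\<^sup>2" using j by (intro power_mono) auto
    moreover have "(real K)\<^sup>2 \<le> n" using n_ge by (simp add: power2_eq_square algebra_simps)
    moreover have "r = j" using j by (simp add: r_def ring_size_def)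
    ultimately show ?thesis using n_pos by (simp only:)
  next
    case equal
    then show ?thesis using m_squared_le by (simp add: r_def ring_size_def v_def height_def)
  next
    case greater
    define j where "j = nat i"
    have j: "i = int j" "1 \<le> j" using greater by (auto simp: j_def)
    have "v = depth j" "r = j" using j by (simp_all add: v_def height_def r_def ring_size_def)
    moreover have "1 \<le> (real j)\<^sup>2" using j by simp
    ultimately show ?thesis by (simp add: n_depth)
  qed
  have "13 * (n * v) \<le> 13 * (n * (potential i)\<^sup>2)" using pv n_pos by simp
  then have "(real r)\<^sup>2 \<le> 13 * (n * (potential i)\<^sup>2)" by (rule order_trans[OF rv])
  also have "\<dots> \<le> 16 * (n * (potential i)\<^sup>2)" using n_pos by (intro mult_right_mono) auto
  also have "\<dots> = (4 * (sqrt n * potential i))\<^sup>2" using n_pos by (simp add: power_mult_distrib)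
  finally have "(real r)\<^sup>2 \<le> (4 * (sqrt n * potential i))\<^sup>2" .
  then have "real r \<le> 4 * (sqrt n * potential i)"
    by (rule power2_le_imp_le) (use ir(1) in simp)
  also have "\<dots> = 40 * sqrt n * (potential i / 10)" by simp
  also have "\<dots> \<le> 40 * sqrt n * (norm (p - q) * real r)" using A by (intro mult_left_mono) auto
  finally have "real r * 1 \<le> real r * (40 * sqrt n * norm (p - q))" by (simp add: mult_ac)
  then have "1 \<le> 40 * sqrt n * norm (p - q)" using r1 by simp
  then show ?thesis using n_pos by (simp add: field_simps)
qed

text \<open>The point \<open>q\<close> is nearest to \<open>p\<close> on the active parallel. It need not be nearest in the whole
  configuration, but by \<open>inactive_ring_far\<close> it is so up to the factor \<open>760 = 19 * 40\<close>.\<close>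

lemma nearest_point_estimate:
  obtains q where "q \<in> points" "norm (p - q) \<le> 19 / sqrt n"
    "\<And>q'. q' \<in> points \<Longrightarrow> norm (p - q) \<le> 760 * norm (p - q')"
    "0 < (\<Prod>q'\<in>points - {q}. norm (p - q'))"
    "\<bar>ln (\<Prod>q'\<in>points - {q}. norm (p - q')) + kappa * n - ln n / 2\<bar> \<le> 310"
proof -
  define A where "A = {- int K..int K}"
  obtain k0 :: int where th: "\<bar>\<alpha> - 2 * pi * of_int k0 / real (ring_size active)\<bar> \<le> pi / real (ring_size active)"
    and nearest: "\<And>q. q \<in> ring active \<Longrightarrow>
       norm (p - sphere_point (height active) (2 * pi * of_int k0 / real (ring_size active))) \<le> norm (p - q)"
    using latitude_ring_nearest[OF ring_size_pos height_bound[OF active_in] t_abs] by metis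
  define q where "q = sphere_point (height active) (2 * pi * of_int k0 / real (ring_size active))"
  define Q where "Q = (\<Prod>q'\<in>ring active - {q}. norm (p - q'))"
  define L where "L i = (\<Prod>q'\<in>ring i. norm (p - q'))" for i
  have q_ring: "q \<in> ring active" unfolding q_def latitude_ring_def by blast
  then have q_in: "q \<in> points" using active_in unfolding points_def by blast
  have dist: "norm (p - q) \<le> 19 / sqrt n" unfolding q_def by (rule active_ring_nearest_distance[OF th])
  have Q: "0 < Q" "\<bar>ln Q - ln (real (ring_size active)) - (real (ring_size active) - 1) * ln (potential active)\<bar> \<le> 37"
    using active_punctured_ring[OF th] unfolding Q_def q_def by auto
  have sq: "0 < sqrt n" using n_pos by simp
  have near: "norm (p - q) \<le> 760 * norm (p - q')" if q': "q' \<in> points" for q'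
  proof -
    obtain i where i: "i \<in> {- int K..int K}" "q' \<in> ring i" using q' unfolding points_def by blast
    show ?thesis
    proof (cases "i = active")
      case True
      then have "norm (p - q) \<le> norm (p - q')" using nearest i unfolding q_def by blast
      then show ?thesis using norm_ge_zero[of "p - q'"] by linarith
    next
      case False
      have "760 * (1 / (40 * sqrt n)) \<le> 760 * norm (p - q')"
        using inactive_ring_far[OF i(1) False i(2)] by (intro mult_left_mono) auto
      then show ?thesis using dist by simp
    qed
  qed
  have fA: "finite A" "active \<in> A" using active_in by (auto simp: A_def)
  have prod: "(\<Prod>q'\<in>points - {q}. norm (p - q')) = (\<Prod>i\<in>A - {active}. L i) * Q"
  proof -
    define f where "f q' = (if q' = q then 1 else norm (p - q'))" for q'
    have "(\<Prod>q'\<in>points - {q}. norm (p - q')) = (\<Prod>q'\<in>points. f q')"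
      using finite_points q_in by (subst prod.remove[of points q f]) (auto simp: f_def intro!: prod.cong)
    also have "\<dots> = (\<Prod>i\<in>A. \<Prod>q'\<in>ring i. f q')" unfolding A_def by (rule prod_points)
    also have "\<dots> = (\<Prod>q'\<in>ring active. f q') * (\<Prod>i\<in>A - {active}. \<Prod>q'\<in>ring i. f q')"
      by (rule prod.remove[OF fA])
    also have "(\<Prod>q'\<in>ring active. f q') = Q"
      unfolding Q_def using q_ring finite_latitude_ring[OF ring_size_pos]
      by (subst prod.remove[of _ q f]) (auto simp: f_def intro!: prod.cong)
    also have "(\<Prod>i\<in>A - {active}. \<Prod>q'\<in>ring i. f q') = (\<Prod>i\<in>A - {active}. L i)"
    proof (rule prod.cong)
      fix i assume "i \<in> A - {active}"
      then have "q \<notin> ring i" using rings_disjoint[of i active] active_in q_ring unfolding A_def by blast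
      then show "(\<Prod>q'\<in>ring i. f q') = L i" unfolding L_def f_def by (intro prod.cong) auto
    qed simp
    finally show ?thesis by (simp add: mult.commute)
  qed
  have Lpos: "0 < L i" if "i \<in> A - {active}" for i
  proof -
    have i: "i \<in> {- int K..int K}" "i \<noteq> active" using that by (auto simp: A_def)
    have "0 < potential i ^ ring_size i / 10" using inactive_ring(1)[OF i] by simp
    also have "\<dots> \<le> L i" unfolding L_def by (rule inactive_ring(3)[OF i])
    finally show ?thesis .
  qed
  have pos: "0 < (\<Prod>i\<in>A - {active}. L i)" using Lpos by (intro prod_pos) auto
  have lnprod: "ln (\<Prod>q'\<in>points - {q}. norm (p - q')) = (\<Sum>i\<in>A - {active}. ln (L i)) + ln Q"
  proof -
    have "ln (\<Prod>i\<in>A - {active}. L i) = (\<Sum>i\<in>A - {active}. ln (L i))"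
      using Lpos by (intro ln_prod) (auto simp: fA less_imp_neq[symmetric])
    then show ?thesis unfolding prod using pos Q(1) by (subst ln_mult_pos) auto
  qed
  define S where "S = (\<Sum>i\<in>A - {active}. real (ring_size i) * ln (potential i))"
  have "\<bar>(\<Sum>i\<in>A - {active}. ln (L i)) - S\<bar> = \<bar>\<Sum>i\<in>A - {active}. ln (L i) - real (ring_size i) * ln (potential i)\<bar>"
    by (simp add: S_def sum_subtractf)
  also have "\<dots> \<le> (\<Sum>i\<in>A - {active}. \<bar>ln (L i) - real (ring_size i) * ln (potential i)\<bar>)" by (rule sum_abs)
  also have "\<dots> \<le> (\<Sum>i\<in>A - {active}. 10 * exp (- (real (ring_size i) * decay i) / 2))"
    unfolding L_def by (intro sum_mono inactive_ring(2)) (auto simp: A_def)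
  also have "\<dots> = 10 * (\<Sum>i\<in>A - {active}. exp (- (real (ring_size i) * decay i) / 2))" by (simp only: sum_distrib_left)
  also have "\<dots> \<le> 10 * 21" using sum_decay unfolding A_def by (intro mult_left_mono) auto
  finally have e1: "\<bar>(\<Sum>i\<in>A - {active}. ln (L i)) - S\<bar> \<le> 210" by simp
  have "(\<Sum>i\<in>A. real (ring_size i) * ln (potential i)) = real (ring_size active) * ln (potential active) + S"
    unfolding S_def by (rule sum.remove[OF fA])
  then have e2: "\<bar>real (ring_size active) * ln (potential active) + S + kappa * n\<bar> \<le> 50"
    using sum_potential unfolding A_def by simp
  have e3: "(real (ring_size active) - 1) * ln (potential active)
    = real (ring_size active) * ln (potential active) - ln (potential active)" by (simp add: algebra_simps)
  \<comment> \<open>The errors add up to \<open>210 + 50 + 37 + 6\<close>.\<close>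
  have "\<bar>ln (\<Prod>q'\<in>points - {q}. norm (p - q')) + kappa * n - ln n / 2\<bar> \<le> 310"
    using e1 e2 Q(2) active_normalisation unfolding lnprod e3 by linarith
  moreover have "0 < (\<Prod>q'\<in>points - {q}. norm (p - q'))" unfolding prod using pos Q(1) by simp
  ultimately show ?thesis using that q_in dist near by blast
qed

end

section \<open>From the parallels to the sphere\<close>

text \<open>If \<open>p \<in> P\<close>, then the nearest point is \<open>p\<close> itself and the formula is the convention; otherwise the
  squared distance cancels the factor of \<open>q\<close>.\<close>

lemma product_quotient_nearest:
  assumes P: "finite P" "q \<in> P" and q: "infdist p P = norm (p - q)"
  shows "product_quotient P p
    = (\<Prod>q'\<in>P - {q}. norm (p - q'))\<^sup>2 / (exp (- 2 * kappa * real (card P)) * real (card P))"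
proof (cases "p \<in> P")
  case True
  then have "q = p" using q by simp
  then show ?thesis using True by (simp add: product_quotient_def prod_power_distrib)
next
  case False
  then have "norm (p - q) \<noteq> 0" using P by auto
  moreover have "(\<Prod>q'\<in>P. (norm (p - q'))\<^sup>2) = (norm (p - q))\<^sup>2 * (\<Prod>q'\<in>P - {q}. norm (p - q'))\<^sup>2"
    using P by (simp add: prod.remove[of P q] prod_power_distrib)
  ultimately show ?thesis using False q by (simp add: product_quotient_def)
qed

lemma nearest_exists:
  fixes P :: "(real^3) set"
  assumes "finite P" "P \<noteq> {}"
  obtains q where "q \<in> P" "infdist p P = norm (p - q)"
  using infdist_attains_inf[of P p] assms finite_imp_closed by (metis dist_norm)

lemma product_quotient_pos:
  assumes "finite P" "P \<noteq> {}"
  shows "0 < product_quotient P p"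
proof -
  obtain q where q: "q \<in> P" "infdist p P = norm (p - q)" using nearest_exists[OF assms] .
  have "norm (p - q') \<noteq> 0" if "q' \<in> P - {q}" for q'
  proof
    assume "norm (p - q') = 0"
    then have "p \<in> P" "p = q'" using that by auto
    then show False using q that by simp
  qed
  then have "0 < (\<Prod>q'\<in>P - {q}. norm (p - q'))" by (intro prod_pos) (metis norm_ge_zero order_less_le)
  moreover have "0 < card P" using assms by (simp add: card_gt_0_iff)
  ultimately show ?thesis unfolding product_quotient_nearest[OF assms(1) q] by simp
qed

lemma log_expression_eq:
  assumes "finite P" "P \<noteq> {}"
  shows "log_expression P p = ln (product_quotient P p) / 2"
proof (cases "p \<in> P")
  case False
  have n: "0 < real (card P)" using assms by (simp add: card_gt_0_iff)
  have d: "0 < infdist p P" using False assms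
    by (metis finite_imp_closed infdist_pos_not_in_closed)
  have pos: "0 < norm (p - q)" if "q \<in> P" for q using False that by auto
  have "ln (\<Prod>q\<in>P. (norm (p - q))\<^sup>2) = (\<Sum>q\<in>P. ln ((norm (p - q))\<^sup>2))"
    using assms pos by (intro ln_prod) force+
  also have "\<dots> = 2 * (\<Sum>q\<in>P. ln (norm (p - q)))"
    using pos by (simp add: ln_realpow sum_distrib_left)
  finally have A: "ln (\<Prod>q\<in>P. (norm (p - q))\<^sup>2) = 2 * (\<Sum>q\<in>P. ln (norm (p - q)))" .
  have A0: "0 < (\<Prod>q\<in>P. (norm (p - q))\<^sup>2)" using pos by (intro prod_pos) auto
  have B: "ln (exp (- 2 * kappa * real (card P)) * real (card P) * (infdist p P)\<^sup>2)
     = - 2 * kappa * real (card P) + ln (real (card P)) + 2 * ln (infdist p P)"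
    using n d by (simp add: ln_mult_pos ln_realpow)
  have B0: "0 < exp (- 2 * kappa * real (card P)) * real (card P) * (infdist p P)\<^sup>2" using n d by simp
  have "ln (product_quotient P p) = ln (\<Prod>q\<in>P. (norm (p - q))\<^sup>2)
     - ln (exp (- 2 * kappa * real (card P)) * real (card P) * (infdist p P)\<^sup>2)"
    using False unfolding product_quotient_def by (simp only: if_False ln_divide_pos[OF A0 B0])
  moreover have "ln (sqrt (real (card P)) * infdist p P) = ln (real (card P)) / 2 + ln (infdist p P)"
    using n d by (simp add: ln_mult_pos ln_sqrt)
  ultimately show ?thesis using False unfolding log_expression_def A B by simp
qed (simp add: log_expression_def)

text \<open>Both products contain the factors of all points other than \<open>q\<close> and \<open>q0\<close>. Comparing them without
  dividing by \<open>\<bar>p - q0\<bar>\<close> includes the case \<open>p = q0\<close>.\<close>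

lemma prod_omit_comparable:
  fixes p :: "'a::real_normed_vector"
  assumes "finite P" "q \<in> P" "q0 \<in> P" and "norm (p - q0) \<le> norm (p - q)" "norm (p - q) \<le> c * norm (p - q0)" and c: "1 \<le> c"
  defines "F \<equiv> \<lambda>q. \<Prod>q'\<in>P - {q}. norm (p - q')"
  shows "F q \<le> F q0" "F q0 \<le> c * F q"
proof -
  have nonneg: "0 \<le> F q" for q by (auto simp: F_def intro: prod_nonneg)
  have "F q \<le> F q0 \<and> F q0 \<le> c * F q"
  proof (cases "q = q0")
    case True
    have "1 * F q0 \<le> c * F q0" using c nonneg by (intro mult_right_mono) auto
    then show ?thesis using True by simp
  next
    case False
    define R where "R = (\<Prod>q'\<in>P - {q} - {q0}. norm (p - q'))"
    have R0: "0 \<le> R" by (auto simp: R_def intro: prod_nonneg)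
    have "F q = norm (p - q0) * R"
      unfolding F_def R_def using assms(1,3) False by (intro prod.remove) auto
    moreover have "P - {q0} - {q} = P - {q} - {q0}" by blast
    then have "F q0 = norm (p - q) * R"
      unfolding F_def R_def using assms(1,2) False prod.remove[of "P - {q0}" q "\<lambda>q'. norm (p - q')"] by simp
    ultimately show ?thesis
      using mult_right_mono[OF assms(4) R0] mult_right_mono[OF assms(5) R0] by (simp add: mult.assoc)
  qed
  then show "F q \<le> F q0" "F q0 \<le> c * F q" by auto
qed

text \<open>Reflection in the plane of the equator carries the estimates over to the southern hemisphere.\<close>

definition reflect :: "real^3 \<Rightarrow> real^3" where
  "reflect x = vector [x$1, x$2, - x$3]"

lemma reflect_reflect [simp]: "reflect (reflect x) = x"
  by (simp add: reflect_def vec_eq_iff forall_3)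

lemma reflect_eq_iff [simp]: "reflect x = reflect y \<longleftrightarrow> x = y"
  by (metis reflect_reflect)

lemma norm_reflect_diff: "norm (reflect x - reflect y) = norm (x - y)"
proof -
  have "(norm (reflect x - reflect y))\<^sup>2 = (norm (x - y))\<^sup>2"
    unfolding norm_vec3_squared by (simp add: reflect_def power2_eq_square algebra_simps)
  then show ?thesis by (simp add: power2_eq_iff_nonneg)
qed

lemma norm_reflect_left: "norm (reflect x - y) = norm (x - reflect y)"
  using norm_reflect_diff[of "x" "reflect y"] by simp

lemma reflect_sphere_point: "reflect (sphere_point t \<alpha>) = sphere_point (- t) \<alpha>"
  by (simp add: reflect_def sphere_point_def vec_eq_iff forall_3)

context ring_parameters
begin

lemma reflect_points: "reflect ` points = points"
proof -
  have sub: "reflect ` points \<subseteq> points"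
  proof
    fix y assume "y \<in> reflect ` points"
    then obtain i k where i: "i \<in> {- int K..int K}"
      "y = reflect (sphere_point (height i) (2 * pi * of_int k / real (ring_size i)))"
      unfolding points_def latitude_ring_def by blast
    have "y \<in> latitude_ring (height (- i)) (ring_size (- i))"
      unfolding i(2) reflect_sphere_point height_minus latitude_ring_def by (simp add: ring_size_def)
    moreover have "- i \<in> {- int K..int K}" using i(1) by simp
    ultimately show "y \<in> points" unfolding points_def by blast
  qed
  then have "reflect ` reflect ` points \<subseteq> reflect ` points" by blast
  then show ?thesis using sub by (simp add: image_image)
qed

lemma band_exists:
  assumes "0 \<le> u" "u \<le> 1"
  obtains I where "I \<le> K" "real (I * (I + 1)) / n \<le> u"
    "u \<le> (real (I * (I + 1)) + 2 * real (if I < K then I + 1 else m)) / n"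
proof (cases "real (K * (K + 1)) \<le> n * u")
  case True
  have "n * u \<le> n" using assms n_pos by simp
  also have "n = real (K * (K + 1)) + real m" unfolding N_eq by simp
  finally have "n * u \<le> real (K * (K + 1)) + 2 * real m" by simp
  then have "u \<le> (real (K * (K + 1)) + 2 * real m) / n" by (subst pos_le_divide_eq[OF n_pos]) (simp only: mult.commute)
  moreover have "real (K * (K + 1)) / n \<le> u" using True by (subst pos_divide_le_eq[OF n_pos]) (simp only: mult.commute)
  ultimately show ?thesis using that[of K] by simp
next
  case False
  define I where "I = (LEAST I. n * u \<le> real ((I + 1) * (I + 2)))"
  have "0 < K" using False assms n_pos by (cases K) auto
  then have "n * u \<le> real ((K - 1 + 1) * (K - 1 + 2))" using False by simp
  then have I: "n * u \<le> real ((I + 1) * (I + 2))" "I \<le> K - 1"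
    unfolding I_def by (rule LeastI, rule Least_le)
  have "real (I * (I + 1)) \<le> n * u"
  proof (cases I)
    case 0
    then show ?thesis using assms n_pos by simp
  next
    case (Suc i)
    then have "i < I" by simp
    then have "\<not> n * u \<le> real ((i + 1) * (i + 2))" unfolding I_def by (rule not_less_Least)
    then show ?thesis unfolding Suc by simp
  qed
  then have "real (I * (I + 1)) / n \<le> u" by (subst pos_divide_le_eq[OF n_pos]) (simp only: mult.commute)
  moreover have "real ((I + 1) * (I + 2)) = real (I * (I + 1)) + 2 * real (I + 1)" by simp
  then have "u \<le> (real (I * (I + 1)) + 2 * real (I + 1)) / n"
    using I(1) by (subst pos_le_divide_eq[OF n_pos]) (simp only: mult.commute)
  moreover have "I < K" using I(2) \<open>0 < K\<close> by simp
  ultimately show ?thesis using that[of I] by simp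
qed

lemma points_estimate:
  assumes p: "p \<in> sphere 0 1"
  obtains q where "q \<in> points" "norm (p - q) \<le> 19 / sqrt n"
    "\<And>q'. q' \<in> points \<Longrightarrow> norm (p - q) \<le> 760 * norm (p - q')"
    "0 < (\<Prod>q'\<in>points - {q}. norm (p - q'))"
    "\<bar>ln (\<Prod>q'\<in>points - {q}. norm (p - q')) + kappa * n - ln n / 2\<bar> \<le> 310"
proof -
  have north: "\<exists>q\<in>points. norm (x - q) \<le> 19 / sqrt n
    \<and> (\<forall>q'\<in>points. norm (x - q) \<le> 760 * norm (x - q'))
    \<and> 0 < (\<Prod>q'\<in>points - {q}. norm (x - q'))
    \<and> \<bar>ln (\<Prod>q'\<in>points - {q}. norm (x - q')) + kappa * n - ln n / 2\<bar> \<le> 310"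
    if x: "x = sphere_point t \<alpha>" "0 \<le> t" "t \<le> 1" for x t \<alpha>
  proof -
    obtain I where I: "I \<le> K" "real (I * (I + 1)) / n \<le> 1 - t"
      "1 - t \<le> (real (I * (I + 1)) + 2 * real (if I < K then I + 1 else m)) / n"
      using band_exists[of "1 - t"] x by auto
    interpret northern_point K m N I t \<alpha>
      using I x by unfold_locales auto
    show ?thesis unfolding x(1) by (rule nearest_point_estimate) blast
  qed
  obtain t \<alpha> where t: "\<bar>t\<bar> \<le> 1" "p = sphere_point t \<alpha>" using sphere_point_surj[OF p] .
  show ?thesis
  proof (cases "0 \<le> t")
    case True
    then show ?thesis using north[OF t(2)] t(1) that by fastforce
  next
    case False
    have "reflect p = sphere_point (- t) \<alpha>" by (simp add: t(2) reflect_sphere_point)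
    then obtain q where q: "q \<in> points" "norm (reflect p - q) \<le> 19 / sqrt n"
      "\<And>q'. q' \<in> points \<Longrightarrow> norm (reflect p - q) \<le> 760 * norm (reflect p - q')"
      "0 < (\<Prod>q'\<in>points - {q}. norm (reflect p - q'))"
      "\<bar>ln (\<Prod>q'\<in>points - {q}. norm (reflect p - q')) + kappa * n - ln n / 2\<bar> \<le> 310"
      using north[of "reflect p" "- t" \<alpha>] t(1) False by fastforce
    have "(\<Prod>q'\<in>points - {q}. norm (reflect p - q')) = (\<Prod>q'\<in>points - {reflect q}. norm (p - q'))"
      using reflect_points
      by (intro prod.reindex_bij_witness[of _ reflect reflect]) (auto simp: norm_reflect_left)
    moreover have "reflect q \<in> points" using q(1) reflect_points by blast
    moreover have "norm (p - reflect q) \<le> 760 * norm (p - q')" if "q' \<in> points" for q'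
      using q(3)[of "reflect q'"] that reflect_points by (auto simp: norm_reflect_left)
    ultimately show ?thesis using that[of "reflect q"] q by (simp add: norm_reflect_left)
  qed
qed

lemma points_well_distributed:
  assumes p: "p \<in> sphere 0 1"
  shows "sqrt n * infdist p points \<le> 19"
    "exp (- 620) \<le> product_quotient points p" "product_quotient points p \<le> 760\<^sup>2 * exp 620"
proof -
  have ne: "points \<noteq> {}" using card_points N1 by auto
  obtain q where q: "q \<in> points" "norm (p - q) \<le> 19 / sqrt n"
    "\<And>q'. q' \<in> points \<Longrightarrow> norm (p - q) \<le> 760 * norm (p - q')"
    "0 < (\<Prod>q'\<in>points - {q}. norm (p - q'))"
    "\<bar>ln (\<Prod>q'\<in>points - {q}. norm (p - q')) + kappa * n - ln n / 2\<bar> \<le> 310"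
    using points_estimate[OF p] by blast
  obtain q0 where q0: "q0 \<in> points" "infdist p points = norm (p - q0)"
    using nearest_exists[OF finite_points ne] .
  have le: "norm (p - q0) \<le> norm (p - q)"
    using infdist_le[OF q(1), of p] by (simp add: q0(2) dist_norm)
  have "norm (p - q0) \<le> 19 / sqrt n" using le q(2) by linarith
  then show "sqrt n * infdist p points \<le> 19" using n_pos by (simp add: q0(2) field_simps)
  define F where "F = (\<Prod>q'\<in>points - {q}. norm (p - q'))"
  define F0 where "F0 = (\<Prod>q'\<in>points - {q0}. norm (p - q'))"
  have cmp: "F \<le> F0" "F0 \<le> 760 * F"
    using prod_omit_comparable[OF finite_points q(1) q0(1) le q(3)[OF q0(1)]] by (auto simp: F_def F0_def)
  have P0: "0 < F" using q(4) by (simp add: F_def)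
  define D where "D = exp (- 2 * kappa * n) * n"
  have D0: "0 < D" using n_pos by (simp add: D_def)
  have pq: "product_quotient points p = F0\<^sup>2 / D"
    using product_quotient_nearest[OF finite_points q0] by (simp add: D_def F0_def card_points)
  have "ln (F\<^sup>2 / D) = 2 * (ln F + kappa * n - ln n / 2)"
  proof -
    have "ln D = - 2 * kappa * n + ln n" using n_pos by (simp add: D_def ln_mult_pos)
    then show ?thesis using P0 D0 by (simp add: ln_divide_pos ln_realpow)
  qed
  then have l: "\<bar>ln (F\<^sup>2 / D)\<bar> \<le> 620" using q(5) by (simp add: F_def)
  have pos: "0 < F\<^sup>2 / D" using P0 D0 by simp
  have lo: "exp (- 620) \<le> F\<^sup>2 / D"
  proof -
    have "- 620 \<le> ln (F\<^sup>2 / D)" using l by linarith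
    then have "exp (- 620) \<le> exp (ln (F\<^sup>2 / D))" by (subst exp_le_cancel_iff)
    then show ?thesis using pos by simp
  qed
  have hi: "F\<^sup>2 / D \<le> exp 620"
  proof -
    have "ln (F\<^sup>2 / D) \<le> 620" using l by linarith
    then have "exp (ln (F\<^sup>2 / D)) \<le> exp 620" by (subst exp_le_cancel_iff)
    then show ?thesis using pos by simp
  qed
  have "F\<^sup>2 / D \<le> F0\<^sup>2 / D" using cmp P0 D0 by (intro divide_right_mono power_mono) auto
  then show "exp (- 620) \<le> product_quotient points p" using lo pq by simp
  have "F0\<^sup>2 / D \<le> (760 * F)\<^sup>2 / D" using cmp P0 D0 by (intro divide_right_mono power_mono) auto
  also have "\<dots> = 760\<^sup>2 * (F\<^sup>2 / D)" by (simp add: power_mult_distrib)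
  also have "\<dots> \<le> 760\<^sup>2 * exp 620" using hi by (intro mult_left_mono) auto
  finally show "product_quotient points p \<le> 760\<^sup>2 * exp 620" by (simp add: pq)
qed

end

text \<open>\<open>K\<close> is the largest number with \<open>K (K + 2) \<le> N\<close>, that is, \<open>K + 1\<close> is the integer part of
  \<open>sqrt (N + 1)\<close>.\<close>

lemma ring_parameters_exist:
  assumes "1 \<le> N"
  obtains K m where "ring_parameters K m N"
proof -
  define K where "K = (LEAST K. N < (K + 1) * (K + 3))"
  have "N < (N + 1) * (N + 3)" by simp
  then have up: "N < (K + 1) * (K + 3)" unfolding K_def by (rule LeastI)
  have low: "K * (K + 2) \<le> N"
  proof (cases K)
    case (Suc k)
    then have "k < K" by simp
    then have "\<not> N < (k + 1) * (k + 3)" unfolding K_def by (rule not_less_Least)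
    then show ?thesis unfolding Suc by (simp add: algebra_simps)
  qed simp
  define m where "m = N - K * (K + 1)"
  have "K * (K + 2) = K * (K + 1) + K" by simp
  then have "N = K * (K + 1) + m" "K \<le> m" using low by (simp_all add: m_def)
  moreover have "m \<le> 3 * K + 2" using up by (simp add: m_def algebra_simps)
  moreover have "1 \<le> m" using calculation assms by (cases "K = 0") auto
  ultimately show ?thesis using that[of K m] by (simp add: ring_parameters_def)
qed

lemma bounded_log_iff:
  fixes x :: "'a \<Rightarrow> real"
  assumes "\<And>i. i \<in> S \<Longrightarrow> 0 < x i"
  shows "(\<exists>C>0. \<forall>i\<in>S. \<bar>ln (x i) / 2\<bar> \<le> C) \<longleftrightarrow> (\<exists>a>0. \<exists>b>0. \<forall>i\<in>S. a \<le> x i \<and> x i \<le> b)"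
proof
  assume "\<exists>C>0. \<forall>i\<in>S. \<bar>ln (x i) / 2\<bar> \<le> C"
  then obtain C where C: "\<And>i. i \<in> S \<Longrightarrow> \<bar>ln (x i) / 2\<bar> \<le> C" by blast
  have "exp (- 2 * C) \<le> x i \<and> x i \<le> exp (2 * C)" if "i \<in> S" for i
  proof -
    have "- 2 * C \<le> ln (x i)" "ln (x i) \<le> 2 * C" using C[OF that] by (auto simp: abs_le_iff)
    then have "exp (- 2 * C) \<le> exp (ln (x i))" "exp (ln (x i)) \<le> exp (2 * C)" by (simp_all only: exp_le_cancel_iff)
    then show ?thesis using assms[OF that] by simp
  qed
  then show "\<exists>a>0. \<exists>b>0. \<forall>i\<in>S. a \<le> x i \<and> x i \<le> b" by (meson exp_gt_zero)
next
  assume "\<exists>a>0. \<exists>b>0. \<forall>i\<in>S. a \<le> x i \<and> x i \<le> b"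
  then obtain a b where ab: "0 < a" "0 < b" "\<And>i. i \<in> S \<Longrightarrow> a \<le> x i \<and> x i \<le> b" by blast
  have "\<bar>ln (x i) / 2\<bar> \<le> \<bar>ln a\<bar> + \<bar>ln b\<bar> + 1" if "i \<in> S" for i
  proof -
    have "ln a \<le> ln (x i)" "ln (x i) \<le> ln b" using ab(1) ab(3)[OF that] assms[OF that] by (auto intro: ln_mono)
    then show ?thesis by linarith
  qed
  moreover have "0 < \<bar>ln a\<bar> + \<bar>ln b\<bar> + 1" by simp
  ultimately show "\<exists>C>0. \<forall>i\<in>S. \<bar>ln (x i) / 2\<bar> \<le> C" by blast
qed

theorem theorem1p9:
  shows "(\<exists>C>0::real. \<exists>a>0::real. \<exists>b>0::real. \<forall>N::nat. N \<ge> 1 \<longrightarrow>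
            (\<exists>P::(real^3) set. P \<subseteq> sphere 0 1 \<and> finite P \<and> card P = N \<and>
               (\<forall>p\<in>sphere 0 1.
                  sqrt (real N) * infdist p P \<le> C \<and>
                  \<bar>log_expression P p\<bar> \<le> C \<and>
                  a \<le> product_quotient P p \<and> product_quotient P p \<le> b)))
       \<and>
       (\<forall>P::nat \<Rightarrow> (real^3) set.
          (\<forall>N\<ge>1. P N \<subseteq> sphere 0 1 \<and> finite (P N) \<and> card (P N) = N) \<longrightarrow>
          ((\<exists>C>0::real. \<forall>N\<ge>1. \<forall>p\<in>sphere 0 1. \<bar>log_expression (P N) p\<bar> \<le> C)
           \<longleftrightarrow>
           (\<exists>a>0::real. \<exists>b>0::real. \<forall>N\<ge>1. \<forall>p\<in>sphere 0 1.
              a \<le> product_quotient (P N) p \<and> product_quotient (P N) p \<le> b)))"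
proof (intro conjI allI impI)
  define a :: real where "a = exp (- 620)"
  define b :: real where "b = 760\<^sup>2 * exp 620"
  define C where "C = \<bar>ln a\<bar> + \<bar>ln b\<bar> + 19"
  have ab: "0 < a" "0 < b" "0 < C" by (auto simp: a_def b_def C_def)
  have "\<exists>P::(real^3) set. P \<subseteq> sphere 0 1 \<and> finite P \<and> card P = N \<and>
               (\<forall>p\<in>sphere 0 1.
                  sqrt (real N) * infdist p P \<le> C \<and>
                  \<bar>log_expression P p\<bar> \<le> C \<and>
                  a \<le> product_quotient P p \<and> product_quotient P p \<le> b)" if N: "1 \<le> N" for N
  proof -
    obtain K m where "ring_parameters K m N" using ring_parameters_exist[OF N] .
    then interpret ring_parameters K m N .
    have ne: "points \<noteq> {}" using card_points N1 by auto
    have "sqrt (real N) * infdist p points \<le> C \<and> \<bar>log_expression points p\<bar> \<le> C \<and>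
       a \<le> product_quotient points p \<and> product_quotient points p \<le> b" if p: "p \<in> sphere 0 1" for p
    proof -
      have pq: "a \<le> product_quotient points p" "product_quotient points p \<le> b"
        using points_well_distributed[OF p] by (simp_all add: a_def b_def)
      then have "ln a \<le> ln (product_quotient points p)" "ln (product_quotient points p) \<le> ln b"
        using ab product_quotient_pos[OF finite_points ne, of p] by (auto intro: ln_mono)
      then have "\<bar>log_expression points p\<bar> \<le> C"
        unfolding log_expression_eq[OF finite_points ne] C_def by linarith
      moreover have "sqrt (real N) * infdist p points \<le> C"
        using points_well_distributed(1)[OF p] unfolding C_def by linarith
      ultimately show ?thesis using pq by blast
    qed
    then show ?thesis using points_subset_sphere finite_points card_points by blast
  qed
  then show "\<exists>C>0::real. \<exists>a>0::real. \<exists>b>0::real. \<forall>N::nat. N \<ge> 1 \<longrightarrow>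
            (\<exists>P::(real^3) set. P \<subseteq> sphere 0 1 \<and> finite P \<and> card P = N \<and>
               (\<forall>p\<in>sphere 0 1.
                  sqrt (real N) * infdist p P \<le> C \<and>
                  \<bar>log_expression P p\<bar> \<le> C \<and>
                  a \<le> product_quotient P p \<and> product_quotient P p \<le> b))"
    using ab by blast
next
  fix P :: "nat \<Rightarrow> (real^3) set"
  assume "\<forall>N\<ge>1. P N \<subseteq> sphere 0 1 \<and> finite (P N) \<and> card (P N) = N"
  then have P: "finite (P N)" "P N \<noteq> {}" if "1 \<le> N" for N using that by (metis, metis card.empty not_one_le_zero)
  define S where "S = {1::nat..} \<times> sphere (0::real^3) 1"
  have "(\<exists>C>0. \<forall>i\<in>S. \<bar>ln (product_quotient (P (fst i)) (snd i)) / 2\<bar> \<le> C)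
    \<longleftrightarrow> (\<exists>a>0. \<exists>b>0. \<forall>i\<in>S. a \<le> product_quotient (P (fst i)) (snd i) \<and> product_quotient (P (fst i)) (snd i) \<le> b)"
    using P by (intro bounded_log_iff product_quotient_pos) (auto simp: S_def)
  then show "(\<exists>C>0::real. \<forall>N\<ge>1. \<forall>p\<in>sphere 0 1. \<bar>log_expression (P N) p\<bar> \<le> C)
           \<longleftrightarrow>
           (\<exists>a>0::real. \<exists>b>0::real. \<forall>N\<ge>1. \<forall>p\<in>sphere 0 1.
              a \<le> product_quotient (P N) p \<and> product_quotient (P N) p \<le> b)"
    using P by (simp add: S_def log_expression_eq Ball_def imp_conjL)
qed

end
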